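(* Let $\beta_2\ge\beta_1>0$ and let $V\in L^\infty_{\mathrm{loc}}(\mathbb{R})$ be a nonnegative real-valued potential for which there exist constants $c_1,c_2,c_3>0$ with $$c_1(|x|-c_3)_+^{\beta_1}\le V(x)\le c_2\langle x\rangle^{\beta_2},\qquad \forall x\in\mathbb{R}.$$ Let $s\ge\beta_2/2$ and $\tau\ge0$, and let $\Omega\subset\mathbb{R}$ be a measurable set that is thick of type $(\rho_s,\tau)$, where $\rho_s(x)=\langle x\rangle^{-s}$. Then there exists a constant $C=C(V,\Omega)>0$, depending only on $V$ and $\Omega$, such that for any $\lambda>0$ and any $\phi\in\mathcal{E}_\lambda(\sqrt{H})$, $$\|\phi\|_{L^2(\mathbb{R})}\le Ce^{C\lambda^{\zeta}}\|\phi\|_{L^2(\Omega)},\qquad \zeta=\frac{4\tau}{\beta_1}+1.$$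
   Context: Notation: $(a)_+:=\max\{0,a\}$, $\langle x\rangle:=(1+|x|^2)^{1/2}$, $I_r(x):=[x-r,x+r]$, and $|E|$ is the Lebesgue measure of $E\subset\mathbb{R}$. For $s,\tau\ge 0$, a measurable set $\Omega\subset\mathbb{R}$ is thick of type $(\rho_s,\tau)$ if there exist $\gamma\in(0,1)$ and $L>0$ such that $|\Omega\cap I_{L\rho_s(x)}(x)|\ge\gamma^{\langle x\rangle^\tau}|I_{L\rho_s(x)}(x)|$ for all $x\in\mathbb{R}$. $H=-\partial_x^2+V(x)$ is the Schrödinger operator, i.e. the unique self-adjoint operator on $L^2(\mathbb{R})$ extending $-\partial_x^2+V$ from the Schwartz space. Since $V(x)\to\infty$ as $|x|\to\infty$, there are an orthonormal basis $\{\phi_k\}_{k\in\mathbb{N}}$ of $L^2(\mathbb{R})$ and numbers $0<\lambda_0\le\lambda_1\le\cdots$, $\lambda_k\to\infty$, with $H\phi_k=\lambda_k^2\phi_k$. The spectral subspace is $\mathcal{E}_\lambda(\sqrt H)=\mathrm{span}\{\phi_k:\lambda_k\le\lambda\}$. *)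

theory Defs
  imports "HOL-Analysis.Analysis" "HOL-Library.Function_Algebras"
begin

section \<open>The Hilbert space of complex square-integrable functions on the line\<close>

text \<open>
  Elements of \<open>L\<^sup>2(\<real>)\<close> are represented by functions; two functions represent the same element
  iff they agree almost everywhere.
\<close>

definition L2 :: "(real \<Rightarrow> complex) set" where
  "L2 = {f. f \<in> borel_measurable lebesgue \<and> integrable lebesgue (\<lambda>x. (cmod (f x))\<^sup>2)}"

definition L2_inner :: "(real \<Rightarrow> complex) \<Rightarrow> (real \<Rightarrow> complex) \<Rightarrow> complex" where
  "L2_inner f g = (LINT x|lebesgue. f x * cnj (g x))"

definition L2_norm_on :: "real set \<Rightarrow> (real \<Rightarrow> complex) \<Rightarrow> real" where
  "L2_norm_on A f = sqrt (LINT x:A|lebesgue. (cmod (f x))\<^sup>2)"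

abbreviation L2_norm :: "(real \<Rightarrow> complex) \<Rightarrow> real" where
  "L2_norm \<equiv> L2_norm_on UNIV"

definition L2_dense :: "(real \<Rightarrow> complex) set \<Rightarrow> bool" where
  "L2_dense D \<longleftrightarrow> D \<subseteq> L2 \<and> (\<forall>f\<in>L2. \<forall>e>0. \<exists>g\<in>D. L2_norm (\<lambda>x. f x - g x) < e)"

interpretation cfun: vector_space "\<lambda>(c::complex) (f::real \<Rightarrow> complex) x. c * f x"
  by unfold_locales (auto simp: fun_eq_iff algebra_simps)

definition orthonormal_basis :: "(nat \<Rightarrow> real \<Rightarrow> complex) \<Rightarrow> bool" where
  "orthonormal_basis \<phi> \<longleftrightarrow>
     (\<forall>k. \<phi> k \<in> L2) \<and>
     (\<forall>j k. L2_inner (\<phi> j) (\<phi> k) = (if j = k then 1 else 0)) \<and>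
     L2_dense (cfun.span (range \<phi>))"


section \<open>Self-adjoint operators\<close>

text \<open>
  A (possibly unbounded) operator \<open>T\<close> is given by its graph: \<open>(u, v) \<in> T\<close> means that \<open>u\<close> is in the
  domain and \<open>T u = v\<close>, with all representatives of \<open>u\<close> and \<open>v\<close> allowed. An adjoint graph is
  always closed under linear combinations and under almost-everywhere equality in both components,
  and the adjoint of a densely defined operator is single-valued up to almost-everywhere equality;
  hence these properties need not be required separately in \<open>self_adjoint\<close>.
\<close>

type_synonym L2_operator = "((real \<Rightarrow> complex) \<times> (real \<Rightarrow> complex)) set"

definition adjoint_operator :: "L2_operator \<Rightarrow> L2_operator" where
  "adjoint_operator T =
     {(u, v). u \<in> L2 \<and> v \<in> L2 \<and> (\<forall>(f, g)\<in>T. L2_inner g u = L2_inner f v)}"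

definition self_adjoint :: "L2_operator \<Rightarrow> bool" where
  "self_adjoint T \<longleftrightarrow> L2_dense (Domain T) \<and> adjoint_operator T = T"


section \<open>The Schroedinger operator\<close>

definition vderiv :: "(real \<Rightarrow> complex) \<Rightarrow> real \<Rightarrow> complex" where
  "vderiv f x = vector_derivative f (at x)"

definition schwartz :: "(real \<Rightarrow> complex) set" where
  "schwartz = {f. \<forall>n. (\<forall>x. (vderiv ^^ n) f differentiable (at x)) \<and>
                      (\<forall>m. bounded (range (\<lambda>x. of_real (x ^ m) * (vderiv ^^ n) f x)))}"

text \<open>
  For the potentials considered here the operator \<open>-d\<^sup>2/dx\<^sup>2 + V\<close> on the Schwartz space has exactly
  one self-adjoint extension, so the following predicate holds for exactly one \<open>H\<close>.
\<close>

definition is_schroedinger_operator :: "(real \<Rightarrow> real) \<Rightarrow> L2_operator \<Rightarrow> bool" where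
  "is_schroedinger_operator V H \<longleftrightarrow> self_adjoint H \<and>
     (\<forall>f\<in>schwartz. (f, \<lambda>x. - vderiv (vderiv f) x + of_real (V x) * f x) \<in> H)"

definition sqrt_eigenbasis ::
  "L2_operator \<Rightarrow> (nat \<Rightarrow> real \<Rightarrow> complex) \<Rightarrow> (nat \<Rightarrow> real) \<Rightarrow> bool" where
  "sqrt_eigenbasis H \<phi> \<mu> \<longleftrightarrow> orthonormal_basis \<phi> \<and>
     0 < \<mu> 0 \<and> incseq \<mu> \<and> filterlim \<mu> at_top sequentially \<and>
     (\<forall>k. (\<phi> k, \<lambda>x. of_real ((\<mu> k)\<^sup>2) * \<phi> k x) \<in> H)"

definition spectral_subspace ::
  "(nat \<Rightarrow> real \<Rightarrow> complex) \<Rightarrow> (nat \<Rightarrow> real) \<Rightarrow> real \<Rightarrow> (real \<Rightarrow> complex) set" where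
  "spectral_subspace \<phi> \<mu> l =
     {u \<in> L2. \<exists>v \<in> cfun.span {\<phi> k | k. \<mu> k \<le> l}. AE x in lebesgue. u x = v x}"


section \<open>Potentials and thick sets\<close>

definition L_infty_loc :: "(real \<Rightarrow> real) set" where
  "L_infty_loc = {V. V \<in> borel_measurable lebesgue \<and>
     (\<forall>K. compact K \<longrightarrow> (\<exists>M. AE x in lebesgue. x \<in> K \<longrightarrow> \<bar>V x\<bar> \<le> M))}"

definition jbracket :: "real \<Rightarrow> real" where
  "jbracket x = sqrt (1 + \<bar>x\<bar>\<^sup>2)"

definition rho :: "real \<Rightarrow> real \<Rightarrow> real" where
  "rho s x = jbracket x powr (- s)"

definition thick_of_type :: "(real \<Rightarrow> real) \<Rightarrow> real \<Rightarrow> real set \<Rightarrow> bool" where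
  "thick_of_type r \<tau> \<Omega> \<longleftrightarrow> \<Omega> \<in> sets lebesgue \<and>
     (\<exists>\<gamma> L. 0 < \<gamma> \<and> \<gamma> < 1 \<and> 0 < L \<and>
       (\<forall>x. measure lebesgue (\<Omega> \<inter> {x - L * r x .. x + L * r x})
            \<ge> \<gamma> powr (jbracket x powr \<tau>) * measure lebesgue {x - L * r x .. x + L * r x}))"

end

theory Submission
  imports Defs
begin

text \<open>
  Let \<open>\<phi> = \<Sum> c\<^sub>k \<phi>\<^sub>k\<close> be in the spectral subspace, and take real parts (\<open>V\<close> is real). The ghost extension
  \<open>u(t,x) = \<Sum> c\<^sub>k cosh(\<lambda>\<^sub>k t) \<phi>\<^sub>k(x)\<close> satisfies \<open>u\<^sub>t\<^sub>t + u\<^sub>x\<^sub>x = V u\<close>. With \<open>Z(t,x) = \<integral>\<^sub>0\<^sup>t u\<^sub>x\<close> the function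
  \<open>u + iZ\<close> is almost holomorphic: \<open>u\<^sub>x = Z\<^sub>t\<close> and \<open>u\<^sub>t + Z\<^sub>x = V \<integral>\<^sub>0\<^sup>t u\<close>, and \<open>Z = 0\<close> on the axis. On an interval of
  radius comparable with \<open>\<langle>x\<rangle>\<^sup>-\<^sup>s\<close>, rescaled to unit size, the potential is bounded because \<open>s \<ge> \<beta>\<^sub>2/2\<close>.

  A Carleman estimate for the Cauchy-Riemann operator on a half strip, with weight
  \<open>K x\<^sup>2 + t - m P\<close>, where \<open>P\<close> is the logarithmic potential of the normalised Lebesgue measure on
  \<open>\<Omega>\<close>, gives a Remez-type inequality. The normal derivative of \<open>P\<close> on the axis is supported on \<open>\<Omega>\<close> and produces
  the observation term; the term \<open>t\<close> produces the trace of \<open>u\<close> on the axis; the term \<open>K x\<^sup>2\<close> absorbs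
  \<open>V \<integral>\<^sub>0\<^sup>t u\<close>, as the weight essentially decreases in \<open>t\<close>; and \<open>P\<close> is larger far away than near the interval,
  so that the cutoff error carries a factor \<open>(5/49)\<^sup>m\<close>. The price is a factor \<open>\<delta>\<^sup>-\<^sup>2\<^sup>m\<close>,
  where \<open>\<delta>\<close> is the density of \<open>\<Omega>\<close> in the interval.

  Since \<open>\<integral> V|\<phi>|\<^sup>2 \<le> \<lambda>\<^sup>2 \<parallel>\<phi>\<parallel>\<^sup>2\<close>, the mass of \<open>\<phi>\<close> concentrates in \<open>|x| \<le> R\<close> with \<open>R \<sim> \<lambda>^(2/\<beta>\<^sub>1)\<close>. This region is
  covered by polynomially many (in \<open>\<lambda>\<close>) intervals; with \<open>m \<sim> \<lambda>\<close> the cutoff errors are absorbed by the left hand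
  side, and \<open>\<delta>\<^sup>-\<^sup>2\<^sup>m \<le> exp(C \<lambda> R\<^sup>\<tau>)\<close>, which is even better than claimed.
\<close>

section \<open>Absolutely continuous functions\<close>

text \<open>With a first-order system a merely bounded \<open>V\<close> does no harm: the defect of
  u + iZ contains \<open>V\<close> undifferentiated, and as Z vanishes on the axis, the boundary
  term of the Carleman identity there is a multiple of u^2 alone. The functions t and P are
  harmonic, so the Laplacian of the weight is 2K for every m. Hence K depends only on the bound for
  the rescaled potential, and m stays free for one contest: the squared weight is at least 5^(-m) on
  the interval and at most a constant times 49^(-m) where the cutoff varies, and the ratio (5/49)^m
  < e^(-m) has to beat both the growth of cosh on the strip and the number of intervals. Two
  regularisations keep everything continuous up to the axis: the potential is evaluated at height t
  + e, and the indicator of \<open>\<Omega>\<close> is replaced by continuous densities. Both are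
  removed by limits. The operator is known only through self-adjointness and its values on Schwartz
  functions, so eigenfunctions first need a C^1 representative, obtained by testing with compactly
  supported smooth functions.\<close>

text \<open>Absolute continuity: \<open>F\<close> is a primitive of \<open>f\<close> on \<open>[a, b]\<close>. The potential is only measurable,
  so second derivatives of eigenfunctions exist only in this sense.\<close>

definition acd :: "real \<Rightarrow> real \<Rightarrow> (real \<Rightarrow> real) \<Rightarrow> (real \<Rightarrow> real) \<Rightarrow> bool" where
  "acd a b F f \<longleftrightarrow> f absolutely_integrable_on {a..b} \<and>
     (\<forall>x\<in>{a..b}. (f has_integral (F x - F a)) {a..x})"

lemma acd_has_integral:
  assumes "acd a b F f" "a \<le> x" "x \<le> y" "y \<le> b"
  shows "(f has_integral (F y - F x)) {x..y}"
proof -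
  have f: "f integrable_on {a..b}"
    using assms(1) by (auto simp: acd_def intro: set_lebesgue_integral_eq_integral(1))
  have 1: "f integrable_on {a..y}" "f integrable_on {x..y}"
    using assms by (auto intro!: integrable_subinterval_real[OF f])
  have "integral {a..x} f + integral {x..y} f = integral {a..y} f"
    using assms 1 by (intro Henstock_Kurzweil_Integration.integral_combine) auto
  moreover have "integral {a..x} f = F x - F a" "integral {a..y} f = F y - F a"
    using assms by (auto simp: acd_def intro!: integral_unique)
  ultimately show ?thesis
    using 1(2) by (simp add: has_integral_integrable_integral)
qed

lemma acd_continuous_on:
  assumes "acd a b F f"
  shows "continuous_on {a..b} F"
proof -
  have "f integrable_on {a..b}"
    using assms by (auto simp: acd_def intro: set_lebesgue_integral_eq_integral(1))
  then have "continuous_on {a..b} (\<lambda>x. integral {a..x} f)"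
    by (rule indefinite_integral_continuous_1)
  then have "continuous_on {a..b} (\<lambda>x. F a + integral {a..x} f)"
    by (intro continuous_intros)
  moreover have "F a + integral {a..x} f = F x" if "x \<in> {a..b}" for x
    using assms that by (auto simp: acd_def dest!: bspec[where x=x] integral_unique)
  ultimately show ?thesis by (subst continuous_on_cong[OF refl, symmetric]) auto
qed

lemma acd_deriv:
  assumes "\<And>x. x \<in> {a..b} \<Longrightarrow> (F has_real_derivative f x) (at x within {a..b})"
    and "continuous_on {a..b} f"
  shows "acd a b F f"
  unfolding acd_def
proof
  show "f absolutely_integrable_on {a..b}"
    using assms(2) by (rule absolutely_integrable_continuous_real)
  have "(f has_integral F x - F a) {a..x}" if x: "x \<in> {a..b}" for x
  proof (rule fundamental_theorem_of_calculus)
    show "a \<le> x" using x by simp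
    fix y assume y: "y \<in> {a..x}"
    then have "(F has_real_derivative f y) (at y within {a..b})" using assms(1) x by auto
    then have "(F has_real_derivative f y) (at y within {a..x})"
      by (rule DERIV_subset) (use x in auto)
    then show "(F has_vector_derivative f y) (at y within {a..x})"
      by (simp add: has_real_derivative_iff_has_vector_derivative)
  qed
  then show "\<forall>x\<in>{a..b}. (f has_integral F x - F a) {a..x}" by blast
qed

lemma acd_cong:
  assumes "acd a b F f" "\<And>x. x \<in> {a..b} \<Longrightarrow> F x = F' x" "\<And>x. x \<in> {a..b} \<Longrightarrow> f x = f' x"
  shows "acd a b F' f'"
proof -
  have "f' absolutely_integrable_on {a..b}"
    using assms set_integrable_cong[of lebesgue lebesgue "{a..b}" "{a..b}" f f'] by (simp add: acd_def)
  moreover have "(f' has_integral F' x - F' a) {a..x}" if "x \<in> {a..b}" for x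
    using assms that has_integral_eq[of "{a..x}" f f' "F x - F a"] by (auto simp: acd_def)
  ultimately show ?thesis by (simp add: acd_def)
qed

lemma absolutely_integrable_mult_continuous:
  fixes f g :: "real \<Rightarrow> real"
  assumes "f absolutely_integrable_on {a..b}" "continuous_on {a..b} g"
  shows "(\<lambda>x. f x * g x) absolutely_integrable_on {a..b}"
proof -
  have "(\<lambda>x. g x * f x) absolutely_integrable_on {a..b}"
    using assms
    by (intro absolutely_integrable_bounded_measurable_product_real)
      (auto intro!: continuous_imp_measurable_on_sets_lebesgue compact_imp_bounded compact_continuous_image)
  then show ?thesis by (simp add: mult.commute)
qed

text \<open>A bounded \<open>g\<close> makes \<open>G\<close> Lipschitz; then the defect of the
  product rule has increments of second order and difference quotients suffice, without
  differentiation almost everywhere. Each product formed later has at least one factor with bounded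
  derivative.\<close>

lemma acd_mult:
  assumes F: "acd a b F f" and G: "acd a b G g" and bdd: "\<And>x. x \<in> {a..b} \<Longrightarrow> \<bar>g x\<bar> \<le> M"
  shows "acd a b (\<lambda>x. F x * G x) (\<lambda>x. f x * G x + F x * g x)"
proof (cases "a \<le> b")
  case False
  then show ?thesis by (simp add: acd_def set_integrable_def)
next
  case True
  define h where "h = (\<lambda>x. f x * G x + F x * g x)"
  define \<Phi> where "\<Phi> = (\<lambda>x. integral {a..x} (\<lambda>s. \<bar>f s\<bar>))"
  define D where "D = (\<lambda>x. F x * G x - integral {a..x} h)"
  have cF: "continuous_on {a..b} F" and cG: "continuous_on {a..b} G"
    using F G acd_continuous_on by auto
  have fa: "f absolutely_integrable_on {a..b}" and ga: "g absolutely_integrable_on {a..b}"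
    using F G by (auto simp: acd_def)
  have M0: "0 \<le> M" using bdd[of a] True by auto
  have h1: "(\<lambda>x. f x * G x) absolutely_integrable_on {a..b}"
    by (rule absolutely_integrable_mult_continuous[OF fa cG])
  have h2: "(\<lambda>x. g x * F x) absolutely_integrable_on {a..b}"
    by (rule absolutely_integrable_mult_continuous[OF ga cF])
  have ha: "h absolutely_integrable_on {a..b}"
    unfolding h_def using set_integral_add(1)[OF h1 h2] by (simp add: mult.commute)
  have hi: "h integrable_on {a..b}" and fi: "f integrable_on {a..b}" and gi: "g integrable_on {a..b}"
    using ha fa ga by (auto intro: set_lebesgue_integral_eq_integral(1))
  have fabs: "(\<lambda>x. \<bar>f x\<bar>) integrable_on {a..b}"
    using fa by (auto simp: absolutely_integrable_on_def)
  \<comment> \<open>the increments of \<open>D\<close> are of second order, hence \<open>D\<close> is constant\<close>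
  have key: "\<bar>D y - D x\<bar> \<le> 2 * M * (y - x) * (\<Phi> y - \<Phi> x)" if xy: "a \<le> x" "x \<le> y" "y \<le> b" for x y
  proof -
    have sub: "{x..y} \<subseteq> {a..b}" using xy by auto
    have I: "h integrable_on {x..y}" "f integrable_on {x..y}" "g integrable_on {x..y}"
      "(\<lambda>x. \<bar>f x\<bar>) integrable_on {x..y}"
      using xy by (auto intro: integrable_subinterval_real[OF hi] integrable_subinterval_real[OF fi]
          integrable_subinterval_real[OF gi] integrable_subinterval_real[OF fabs])
    have \<Phi>d: "integral {x..y} (\<lambda>s. \<bar>f s\<bar>) = \<Phi> y - \<Phi> x"
    proof -
      have "integral {a..x} (\<lambda>s. \<bar>f s\<bar>) + integral {x..y} (\<lambda>s. \<bar>f s\<bar>) = integral {a..y} (\<lambda>s. \<bar>f s\<bar>)"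
        using xy by (intro Henstock_Kurzweil_Integration.integral_combine integrable_subinterval_real[OF fabs]) auto
      then show ?thesis by (simp add: \<Phi>_def)
    qed
    have hd: "integral {a..y} h - integral {a..x} h = integral {x..y} h"
    proof -
      have "integral {a..x} h + integral {x..y} h = integral {a..y} h"
        using xy by (intro Henstock_Kurzweil_Integration.integral_combine integrable_subinterval_real[OF hi]) auto
      then show ?thesis by simp
    qed
    have Fi: "integral {x..y} f = F y - F x" and Gi: "integral {x..y} g = G y - G x"
      using acd_has_integral[OF F xy] acd_has_integral[OF G xy] by (auto intro: integral_unique)
    \<comment> \<open>Increment of the product with one factor frozen at each end: \<open>G\<close>
      at \<open>y\<close>, \<open>F\<close> at \<open>x\<close>. Subtracting \<open>h\<close> leaves
      only the differences \<open>G y - G s\<close> and \<open>F x - F s\<close>.\<close>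
    have "D y - D x = integral {x..y} f * G y + F x * integral {x..y} g - integral {x..y} h"
      by (simp add: D_def Fi Gi hd[symmetric] algebra_simps)
    also have "\<dots> = integral {x..y} (\<lambda>s. f s * G y + F x * g s - h s)"
    proof -
      have "((\<lambda>s. f s * G y + F x * g s - h s) has_integral
          (integral {x..y} f * G y + F x * integral {x..y} g - integral {x..y} h)) {x..y}"
        using I by (intro has_integral_diff has_integral_add has_integral_mult_left has_integral_mult_right)
          (auto intro: integrable_integral)
      then show ?thesis by (simp add: integral_unique)
    qed
    finally have Deq: "D y - D x = integral {x..y} (\<lambda>s. f s * G y + F x * g s - h s)" .
    have ptw: "\<bar>f s * G y + F x * g s - h s\<bar> \<le> M * (y - x) * \<bar>f s\<bar> + M * (\<Phi> y - \<Phi> x)"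
      if s: "s \<in> {x..y}" for s
    proof -
      have Gs: "\<bar>G y - G s\<bar> \<le> M * (y - x)"
      proof -
        have "norm (G y - G s) \<le> M * measure lborel {s..y}"
        proof -
          have "(g has_integral (G y - G s)) {s..y}" using acd_has_integral[OF G] s xy by auto
          moreover have "\<And>r. r \<in> {s..y} \<Longrightarrow> norm (g r) \<le> M" using bdd s xy by auto
          ultimately show ?thesis using has_integral_bound[of M g "G y - G s" s y] M0 by simp
        qed
        also have "\<dots> \<le> M * (y - x)" using s M0 by (intro mult_left_mono) auto
        finally show ?thesis by simp
      qed
      have Fs: "\<bar>F x - F s\<bar> \<le> \<Phi> y - \<Phi> x"
      proof -
        have fh: "(f has_integral (F s - F x)) {x..s}" using acd_has_integral[OF F] s xy by auto
        have "norm (F s - F x) \<le> integral {x..s} (\<lambda>s. \<bar>f s\<bar>)"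
        proof -
          have "norm (integral {x..s} f) \<le> integral {x..s} (\<lambda>s. \<bar>f s\<bar>)"
            using fh s xy by (intro integral_norm_bound_integral integrable_subinterval_real[OF fabs]) auto
          then show ?thesis using fh by (simp add: integral_unique)
        qed
        also have "\<dots> \<le> integral {x..y} (\<lambda>s. \<bar>f s\<bar>)"
          using s xy by (intro integral_subset_le integrable_subinterval_real[OF fabs]) auto
        finally show ?thesis using \<Phi>d by auto
      qed
      have gs: "\<bar>g s\<bar> \<le> M" using bdd s xy by auto
      have "f s * G y + F x * g s - h s = f s * (G y - G s) + g s * (F x - F s)"
        by (simp add: h_def algebra_simps)
      also have "\<bar>\<dots>\<bar> \<le> \<bar>f s\<bar> * \<bar>G y - G s\<bar> + \<bar>g s\<bar> * \<bar>F x - F s\<bar>"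
        by (metis abs_mult abs_triangle_ineq)
      also have "\<dots> \<le> \<bar>f s\<bar> * (M * (y - x)) + M * (\<Phi> y - \<Phi> x)"
        using Gs Fs gs M0 by (intro add_mono mult_mono) auto
      finally show ?thesis by (simp add: algebra_simps)
    qed
    have "norm (integral {x..y} (\<lambda>s. f s * G y + F x * g s - h s))
        \<le> integral {x..y} (\<lambda>s. M * (y - x) * \<bar>f s\<bar> + M * (\<Phi> y - \<Phi> x))"
      using ptw I by (intro integral_norm_bound_integral) (auto intro!: integrable_diff integrable_add integrable_on_mult_left integrable_on_mult_right)
    also have "\<dots> = M * (y - x) * (\<Phi> y - \<Phi> x) + M * (\<Phi> y - \<Phi> x) * (y - x)"
      using I xy by (subst Henstock_Kurzweil_Integration.integral_add) (auto simp: \<Phi>d intro!: integrable_on_mult_right)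
    finally show ?thesis unfolding Deq by (simp add: algebra_simps)
  qed
  have c\<Phi>: "continuous_on {a..b} \<Phi>"
    unfolding \<Phi>_def using fabs by (rule indefinite_integral_continuous_1)
  have key': "\<bar>(D y - D x) / (y - x)\<bar> \<le> 2 * M * \<bar>\<Phi> y - \<Phi> x\<bar>"
    if "x \<in> {a..b}" "y \<in> {a..b}" for x y
  proof (cases x y rule: linorder_cases)
    case less
    then have "\<bar>D y - D x\<bar> \<le> (2 * M * \<bar>\<Phi> y - \<Phi> x\<bar>) * \<bar>y - x\<bar>"
    proof -
      have "2 * M * (y - x) * (\<Phi> y - \<Phi> x) \<le> 2 * M * (y - x) * \<bar>\<Phi> y - \<Phi> x\<bar>"
        using M0 less by (intro mult_left_mono) auto
      also have "\<dots> = (2 * M * \<bar>\<Phi> y - \<Phi> x\<bar>) * \<bar>y - x\<bar>" using less by simp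
      finally show ?thesis using key[of x y] that less by simp
    qed
    then show ?thesis using less by (simp add: field_simps abs_divide)
  next
    case greater
    then have "\<bar>D x - D y\<bar> \<le> (2 * M * \<bar>\<Phi> x - \<Phi> y\<bar>) * \<bar>x - y\<bar>"
    proof -
      have "2 * M * (x - y) * (\<Phi> x - \<Phi> y) \<le> 2 * M * (x - y) * \<bar>\<Phi> x - \<Phi> y\<bar>"
        using M0 greater by (intro mult_left_mono) auto
      also have "\<dots> = (2 * M * \<bar>\<Phi> x - \<Phi> y\<bar>) * \<bar>x - y\<bar>" using greater by simp
      finally show ?thesis using key[of y x] that greater by simp
    qed
    then show ?thesis using greater by (simp add: field_simps abs_divide abs_minus_commute)
  qed (use M0 in auto)
  have "(D has_real_derivative 0) (at x within {a..b})" if x: "x \<in> {a..b}" for x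
    unfolding has_field_derivative_iff
  proof (rule Lim_null_comparison)
    show "\<forall>\<^sub>F y in at x within {a..b}. norm ((D y - D x) / (y - x)) \<le> 2 * M * \<bar>\<Phi> y - \<Phi> x\<bar>"
      using key'[OF x] by (auto simp: eventually_at_filter)
    have "(\<Phi> \<longlongrightarrow> \<Phi> x) (at x within {a..b})"
      using c\<Phi> x by (auto simp: continuous_on_def)
    then show "((\<lambda>y. 2 * M * \<bar>\<Phi> y - \<Phi> x\<bar>) \<longlongrightarrow> 0) (at x within {a..b})"
      by (auto intro!: tendsto_eq_intros)
  qed
  then obtain c where c: "\<And>x. x \<in> {a..b} \<Longrightarrow> D x = c"
    using has_field_derivative_zero_constant[of "{a..b}" D] by (metis convex_real_interval(5))
  have "(h has_integral F x * G x - F a * G a) {a..x}" if x: "x \<in> {a..b}" for x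
  proof -
    have "h integrable_on {a..x}" using x by (auto intro: integrable_subinterval_real[OF hi])
    moreover have "integral {a..x} h = F x * G x - F a * G a"
      using c[OF x] c[of a] True by (simp add: D_def)
    ultimately show ?thesis by (simp add: has_integral_integrable_integral)
  qed
  then show ?thesis using ha by (simp add: acd_def h_def)
qed

lemma acd_add:
  assumes "acd a b F f" "acd a b G g"
  shows "acd a b (\<lambda>x. F x + G x) (\<lambda>x. f x + g x)"
  using assms unfolding acd_def
  by (auto intro!: set_integral_add simp: has_integral_add add_diff_add)

lemma acd_cmult:
  assumes "acd a b F f"
  shows "acd a b (\<lambda>x. c * F x) (\<lambda>x. c * f x)"
  using assms unfolding acd_def
  by (auto simp: right_diff_distrib[symmetric] intro!: has_integral_mult_right)

lemma acd_sum:
  assumes "\<And>k. k \<in> S \<Longrightarrow> acd a b (F k) (f k)"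
  shows "acd a b (\<lambda>x. \<Sum>k\<in>S. F k x) (\<lambda>x. \<Sum>k\<in>S. f k x)"
  using assms
proof (induction S rule: infinite_finite_induct)
  case (insert x S)
  then show ?case by (auto intro!: acd_add)
qed (auto simp: acd_def)

section \<open>Smooth test functions\<close>

text \<open>The derivative is existentially quantified at each stage, so closure under sums,
  products and affine substitutions is a plain induction that never names a higher derivative.
  Smoothness is the property for all \<open>n\<close>.\<close>

primrec times_differentiable :: "nat \<Rightarrow> (real \<Rightarrow> real) \<Rightarrow> bool" where
  "times_differentiable 0 f \<longleftrightarrow> True"
| "times_differentiable (Suc n) f \<longleftrightarrow>
     (\<exists>f'. (\<forall>x. (f has_real_derivative f' x) (at x)) \<and> times_differentiable n f')"

lemma times_differentiable_SucI:
  "(\<And>x. (f has_real_derivative f' x) (at x)) \<Longrightarrow> times_differentiable n f' \<Longrightarrow> times_differentiable (Suc n) f"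
  by auto

lemma times_differentiable_SucE:
  assumes "times_differentiable (Suc n) f"
  obtains f' where "\<And>x. (f has_real_derivative f' x) (at x)" "times_differentiable n f'"
  using assms by auto

declare times_differentiable.simps(2) [simp del]

lemma times_differentiable_Suc_imp: "times_differentiable (Suc n) f \<Longrightarrow> times_differentiable n f"
proof (induction n arbitrary: f)
  case (Suc n)
  from Suc.prems show ?case
    by (rule times_differentiable_SucE) (rule times_differentiable_SucI, auto intro: Suc.IH)
qed simp

lemma times_differentiable_const: "times_differentiable n (\<lambda>x. c)"
proof (induction n arbitrary: c)
  case (Suc n)
  show ?case by (rule times_differentiable_SucI[OF DERIV_const Suc])
qed simp

lemma times_differentiable_add:
  "times_differentiable n f \<Longrightarrow> times_differentiable n g \<Longrightarrow> times_differentiable n (\<lambda>x. f x + g x)"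
proof (induction n arbitrary: f g)
  case (Suc n)
  obtain f' g' where d: "\<And>x. (f has_real_derivative f' x) (at x)" "times_differentiable n f'"
    "\<And>x. (g has_real_derivative g' x) (at x)" "times_differentiable n g'"
    using Suc.prems by (meson times_differentiable_SucE)
  show ?case by (rule times_differentiable_SucI[OF DERIV_add[OF d(1,3)] Suc.IH[OF d(2,4)]])
qed simp

lemma times_differentiable_mult:
  "times_differentiable n f \<Longrightarrow> times_differentiable n g \<Longrightarrow> times_differentiable n (\<lambda>x. f x * g x)"
proof (induction n arbitrary: f g)
  case (Suc n)
  obtain f' g' where d: "\<And>x. (f has_real_derivative f' x) (at x)" "times_differentiable n f'"
    "\<And>x. (g has_real_derivative g' x) (at x)" "times_differentiable n g'"
    using Suc.prems by (meson times_differentiable_SucE)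
  have "times_differentiable n f" "times_differentiable n g"
    using Suc.prems by (auto intro: times_differentiable_Suc_imp)
  then have "times_differentiable n (\<lambda>x. f' x * g x + g' x * f x)"
    using Suc.IH d by (intro times_differentiable_add) auto
  with DERIV_mult[OF d(1,3)] show ?case by (rule times_differentiable_SucI)
qed simp

lemma times_differentiable_affine:
  "times_differentiable n f \<Longrightarrow> times_differentiable n (\<lambda>x. f (c * x + d))"
proof (induction n arbitrary: f)
  case (Suc n)
  obtain f' where d: "\<And>x. (f has_real_derivative f' x) (at x)" "times_differentiable n f'"
    using Suc.prems by (meson times_differentiable_SucE)
  have "((\<lambda>x. f (c * x + d)) has_real_derivative f' (c * x + d) * c) (at x)" for x
    by (rule DERIV_chain2[OF d(1)]) (auto intro!: derivative_eq_intros)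
  moreover have "times_differentiable n (\<lambda>x. f' (c * x + d) * c)"
    using Suc.IH[OF d(2)] times_differentiable_const by (intro times_differentiable_mult)
  ultimately show ?case by (rule times_differentiable_SucI)
qed simp

section \<open>The function exp(-1/x) and a bump\<close>

definition flat_exp :: "real poly \<Rightarrow> real \<Rightarrow> real" where
  "flat_exp p x = (if 0 < x then poly p (inverse x) * exp (- inverse x) else 0)"

lemma poly_over_exp_tendsto: "((\<lambda>z. poly p z * exp (- z)) \<longlongrightarrow> 0) (at_top :: real filter)"
proof -
  have "((\<lambda>z. \<Sum>i\<le>degree p. coeff p i * (z ^ i / exp z)) \<longlongrightarrow> (\<Sum>i\<le>degree p. coeff p i * 0)) (at_top :: real filter)"
    by (intro tendsto_intros tendsto_power_div_exp_0)
  moreover have "(\<Sum>i\<le>degree p. coeff p i * (z ^ i / exp z)) = poly p z * exp (- z)" for z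
    by (simp add: poly_altdef sum_distrib_right exp_minus divide_inverse mult.assoc)
  ultimately show ?thesis by simp
qed

text \<open>The functions p(1/x) exp(-1/x) are closed under differentiation: with z = 1/x the
  derivative replaces p(z) by z^2 (p(z) - p'(z)). Smoothness at 0 thus reduces to one first-order
  statement for arbitrary \<open>p\<close>.\<close>

lemma flat_exp_deriv: "(flat_exp p has_real_derivative flat_exp (monom 1 2 * (p - pderiv p)) x) (at x)"
proof (cases x "0::real" rule: linorder_cases)
  case less
  have "((\<lambda>y. 0) has_real_derivative flat_exp (monom 1 2 * (p - pderiv p)) x) (at x)"
    using less by (simp add: flat_exp_def)
  then show ?thesis
    by (rule has_field_derivative_transform_within_open[of _ _ _ "{..<0}"]) (use less in \<open>auto simp: flat_exp_def\<close>)
next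
  case greater
  have i: "(inverse has_real_derivative - (inverse x ^ 2)) (at x)"
    using DERIV_inverse[of x UNIV] greater by (simp add: power2_eq_square)
  have "((\<lambda>y. poly p (inverse y) * exp (- inverse y)) has_real_derivative
      (poly (pderiv p) (inverse x) * - (inverse x ^ 2)) * exp (- inverse x)
      + (exp (- inverse x) * - (- (inverse x ^ 2))) * poly p (inverse x)) (at x)"
    by (intro DERIV_mult DERIV_chain2[OF poly_DERIV] DERIV_chain2[OF DERIV_exp] DERIV_minus i)
  then have "((\<lambda>y. poly p (inverse y) * exp (- inverse y)) has_real_derivative
      flat_exp (monom 1 2 * (p - pderiv p)) x) (at x)"
    by (rule DERIV_cong) (use greater in \<open>simp add: flat_exp_def poly_monom algebra_simps\<close>)
  then show ?thesis
    by (rule has_field_derivative_transform_within_open[of _ _ _ "{0<..}"]) (use greater in \<open>auto simp: flat_exp_def\<close>)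
next
  case equal
  \<comment> \<open>The difference quotient at 0 is again of the same kind, with z p(z) in place of
    p(z); in z = 1/y it is a polynomial times exp(-z) at infinity.\<close>
  have "((\<lambda>y. flat_exp p y / y) \<longlongrightarrow> 0) (at_right 0)"
  proof (rule Lim_transform_eventually)
    have "((\<lambda>y. poly (pCons 0 p) (inverse y) * exp (- inverse y)) \<longlongrightarrow> 0) (at_right (0::real))"
      by (rule filterlim_compose[OF poly_over_exp_tendsto filterlim_inverse_at_top_right])
    then show "((\<lambda>y. poly (pCons 0 p) (inverse y) * exp (- inverse y)) \<longlongrightarrow> 0) (at_right (0::real))" .
    show "\<forall>\<^sub>F y in at_right 0. poly (pCons 0 p) (inverse y) * exp (- inverse y) = flat_exp p y / y"
      by (auto simp: eventually_at_filter flat_exp_def divide_inverse)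
  qed
  moreover have "((\<lambda>y. flat_exp p y / y) \<longlongrightarrow> 0) (at_left 0)"
    by (rule Lim_transform_eventually[of "\<lambda>_. 0"]) (auto simp: eventually_at_filter flat_exp_def)
  ultimately have "((\<lambda>y. flat_exp p y / y) \<longlongrightarrow> 0) (at 0)" by (simp add: filterlim_split_at)
  then show ?thesis using equal by (simp add: has_field_derivative_iff flat_exp_def)
qed

lemma times_differentiable_flat_exp: "times_differentiable n (flat_exp p)"
proof (induction n arbitrary: p)
  case (Suc n)
  show ?case by (rule times_differentiable_SucI[OF flat_exp_deriv Suc])
qed simp

definition bump :: "real \<Rightarrow> real" where "bump x = flat_exp 1 x * flat_exp 1 (1 - x)"

lemma times_differentiable_bump: "times_differentiable n bump"
  unfolding bump_def[abs_def]
  using times_differentiable_affine[OF times_differentiable_flat_exp, of n 1 "-1" 1]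
  by (intro times_differentiable_mult times_differentiable_flat_exp) simp

lemma bump_nonneg: "0 \<le> bump x" by (simp add: bump_def flat_exp_def)

lemma bump_eq_0: "x \<le> 0 \<or> 1 \<le> x \<Longrightarrow> bump x = 0" by (auto simp: bump_def flat_exp_def)

lemma bump_continuous: "continuous_on S bump"
proof -
  obtain b' where "\<And>x. (bump has_real_derivative b' x) (at x)"
    using times_differentiable_bump[of "Suc 0"] by (meson times_differentiable_SucE)
  then show ?thesis by (intro DERIV_continuous_on) (rule has_field_derivative_at_within)
qed

section \<open>Repeated antiderivatives and smooth steps\<close>

definition antideriv :: "(real \<Rightarrow> real) \<Rightarrow> real \<Rightarrow> real" where "antideriv g x = integral {-1..x} g"

lemma antideriv_eq_0: "(\<And>x. x \<le> 0 \<Longrightarrow> g x = 0) \<Longrightarrow> x \<le> 0 \<Longrightarrow> antideriv g x = 0"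
  unfolding antideriv_def by (intro integral_unique has_integral_is_0) auto

text \<open>The base point -1 lies strictly left of 0, where \<open>g\<close> may start to be
  nonzero, so the fundamental theorem applies in a full neighbourhood of every x >= 0. For x < 0 the
  function is locally 0, also below -1, where the interval is empty.\<close>

lemma antideriv_deriv:
  assumes g: "continuous_on UNIV g" and g0: "\<And>x. x \<le> 0 \<Longrightarrow> g x = 0"
  shows "(antideriv g has_real_derivative g x) (at x)"
proof (cases "x < 0")
  case True
  have "((\<lambda>x. 0) has_real_derivative g x) (at x)" using True g0 by simp
  then show ?thesis
    by (rule has_field_derivative_transform_within_open[of _ _ _ "{..<0}"]) 
      (use True antideriv_eq_0[of g] g0 in auto)
next
  case False
  have "(antideriv g has_real_derivative g x) (at x within {-1..x + 1})"
    unfolding antideriv_def[abs_def] using False g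
    by (intro integral_has_real_derivative) (auto intro: continuous_on_subset)
  moreover have "at x within {-1..x+1} = at x" using False by (intro at_within_interior) simp
  ultimately show ?thesis by simp
qed

lemma antideriv_continuous:
  assumes g: "continuous_on UNIV g" and g0: "\<And>x. x \<le> 0 \<Longrightarrow> g x = 0"
  shows "continuous_on S (antideriv g)"
  by (intro DERIV_continuous_on) (rule has_field_derivative_at_within[OF antideriv_deriv[OF g g0]])

lemma antideriv_above:
  assumes g: "continuous_on UNIV g" and G: "\<And>x. 1 \<le> x \<Longrightarrow> (G has_real_derivative g x) (at x within {1..})"
    and x: "1 \<le> x"
  shows "antideriv g x = antideriv g 1 + (G x - G 1)"
proof -
  have "integral {-1..1} g + integral {1..x} g = integral {-1..x} g"
    using x g by (intro Henstock_Kurzweil_Integration.integral_combine)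
      (auto intro!: integrable_continuous_real intro: continuous_on_subset)
  moreover have "(g has_integral (G x - G 1)) {1..x}"
  proof (rule fundamental_theorem_of_calculus)
    fix y assume "y \<in> {1..x}"
    then have "(G has_real_derivative g y) (at y within {1..x})"
      by (intro DERIV_subset[OF G]) auto
    then show "(G has_vector_derivative g y) (at y within {1..x})"
      by (simp add: has_real_derivative_iff_has_vector_derivative)
  qed (rule x)
  ultimately show ?thesis by (simp add: antideriv_def integral_unique)
qed

lemma times_differentiable_antideriv:
  assumes "continuous_on UNIV g" "\<And>x. x \<le> 0 \<Longrightarrow> g x = 0" "times_differentiable n g"
  shows "times_differentiable n (antideriv g)"
  by (rule times_differentiable_Suc_imp, rule times_differentiable_SucI[OF antideriv_deriv assms(3)])
    (use assms in auto)

text \<open>\<open>S\<close> is the normalised primitive of the bump. Two further antiderivatives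
  give \<open>S2\<close>, and its being exactly quadratic beyond 1 is what allows combinations of
  translates to have compact support.\<close>

lemma smooth_step:
  obtains S S1 S2 :: "real \<Rightarrow> real" and \<kappa>1 \<kappa>2 :: real where
    "\<And>n. times_differentiable n S2" "\<And>x. (S2 has_real_derivative S1 x) (at x)"
    "\<And>x. (S1 has_real_derivative S x) (at x)" "continuous_on UNIV S"
    "\<And>x. 0 \<le> S x \<and> S x \<le> 1" "\<And>x. x \<le> 0 \<Longrightarrow> S x = 0 \<and> S1 x = 0 \<and> S2 x = 0"
    "\<And>x. 1 \<le> x \<Longrightarrow> S x = 1 \<and> S1 x = x - \<kappa>1 \<and> S2 x = x\<^sup>2 / 2 - \<kappa>1 * x + \<kappa>2"
proof -
  define B0 where "B0 = integral {-1..1} bump"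
  have B0: "0 < B0"
  proof -
    have "0 \<le> B0" unfolding B0_def by (intro integral_nonneg integrable_continuous_real bump_continuous) (auto simp: bump_nonneg)
    moreover have "B0 \<noteq> 0"
    proof
      assume "B0 = 0"
      then have "bump (1/2) = 0"
        unfolding B0_def using integral_eq_0_iff[of "-1" 1 bump] bump_continuous bump_nonneg by auto
      then show False by (simp add: bump_def flat_exp_def)
    qed
    ultimately show ?thesis by simp
  qed
  define g where "g = (\<lambda>x. bump x * (1 / B0))"
  define S where "S = antideriv g"
  define S1 where "S1 = antideriv S"
  define S2 where "S2 = antideriv S1"
  have gc: "continuous_on UNIV g" unfolding g_def by (intro continuous_intros bump_continuous)
  have g0: "x \<le> 0 \<Longrightarrow> g x = 0" for x by (simp add: g_def bump_eq_0)
  have gs: "times_differentiable n g" for n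
    unfolding g_def by (intro times_differentiable_mult times_differentiable_bump times_differentiable_const)
  have Sc: "continuous_on UNIV S" unfolding S_def by (rule antideriv_continuous[OF gc g0])
  have S0: "x \<le> 0 \<Longrightarrow> S x = 0" for x unfolding S_def by (rule antideriv_eq_0[OF g0])
  have S1c: "continuous_on UNIV S1" unfolding S1_def by (rule antideriv_continuous[OF Sc S0])
  have S10: "x \<le> 0 \<Longrightarrow> S1 x = 0" for x unfolding S1_def by (rule antideriv_eq_0[OF S0])
  have S20: "x \<le> 0 \<Longrightarrow> S2 x = 0" for x unfolding S2_def by (rule antideriv_eq_0[OF S10])
  have sm: "times_differentiable n S2" for n
    unfolding S2_def S1_def S_def
    by (intro times_differentiable_antideriv gs gc g0 Sc[unfolded S_def] S0[unfolded S_def]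
        S1c[unfolded S1_def S_def] S10[unfolded S1_def S_def])
  have Sone: "S 1 = 1"
    using B0 unfolding S_def antideriv_def g_def by (simp add: B0_def)
  have Sge: "S x = 1" if "1 \<le> x" for x
  proof -
    have "S x = S 1 + (0 - 0)" unfolding S_def
      by (rule antideriv_above[OF gc _ that]) (auto simp: g_def bump_eq_0)
    then show ?thesis using Sone by simp
  qed
  have Sb: "0 \<le> S x \<and> S x \<le> 1" for x
  proof (cases "x \<le> 1")
    case True
    have mono: "S y \<le> S z" if "y \<le> z" for y z
    proof (rule DERIV_nonneg_imp_nondecreasing[OF that])
      fix r
      have "(S has_real_derivative g r) (at r)" unfolding S_def by (rule antideriv_deriv[OF gc g0])
      moreover have "0 \<le> g r" using B0 bump_nonneg by (simp add: g_def)
      ultimately show "\<exists>d. (S has_real_derivative d) (at r) \<and> 0 \<le> d" by blast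
    qed
    have "S (min 0 x) = 0" by (rule S0) simp
    then have "0 \<le> S x" using mono[of "min 0 x" x] by simp
    then show ?thesis using mono[OF True] Sone by simp
  next
    case False
    then show ?thesis using Sge by simp
  qed
  define k1 where "k1 = 1 - S1 1"
  define k2 where "k2 = S2 1 - 1/2 + k1"
  have S1ge: "S1 x = x - k1" if "1 \<le> x" for x
  proof -
    have "S1 x = S1 1 + (x - 1)" unfolding S1_def
      by (rule antideriv_above[OF Sc _ that, where G="\<lambda>x. x"]) (use Sge in auto)
    then show ?thesis by (simp add: k1_def)
  qed
  have S2ge: "S2 x = x\<^sup>2 / 2 - k1 * x + k2" if "1 \<le> x" for x
  proof -
    have "S2 x = S2 1 + ((x\<^sup>2 / 2 - k1 * x) - (1\<^sup>2 / 2 - k1 * 1))" unfolding S2_def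
      by (rule antideriv_above[OF S1c _ that, where G="\<lambda>x. x\<^sup>2 / 2 - k1 * x"])
        (use S1ge in \<open>auto intro!: derivative_eq_intros\<close>)
    then show ?thesis by (simp add: k2_def)
  qed
  show ?thesis
  proof (rule that[of S2 S1 S k1 k2])
    show "(S2 has_real_derivative S1 x) (at x)" for x
      unfolding S2_def using S10 by (intro antideriv_deriv S1c)
    show "(S1 has_real_derivative S x) (at x)" for x
      unfolding S1_def using S0 by (intro antideriv_deriv Sc)
  qed (use sm Sc Sb S0 S10 S20 Sge S1ge S2ge in blast)+
qed

section \<open>A du Bois-Reymond lemma of second order\<close>

lemma absolutely_integrable_interval_eq_0:
  fixes f :: "real \<Rightarrow> real"
  assumes "\<And>a b. f integrable_on {a..b}" "\<And>a b. a \<le> b \<Longrightarrow> integral {a..b} f = 0"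
  shows "negligible {x. f x \<noteq> 0}"
proof -
  \<comment> \<open>Lebesgue differentiation: outside a null set \<open>f\<close> is the limit of
    its averages over intervals to the right, and these averages vanish.\<close>
  obtain N where N: "negligible N" "\<And>x e. \<lbrakk>x \<notin> N; 0 < e\<rbrakk> \<Longrightarrow>
      \<exists>d>0. \<forall>h. 0 < h \<and> h < d \<longrightarrow> norm (integral (cbox x (x + h *\<^sub>R One)) f /\<^sub>R h ^ DIM(real) - f x) < e"
    using integrable_ccontinuous_explicit[of f] assms(1) by (metis box_real(2))
  have "f x = 0" if x: "x \<notin> N" for x
  proof (rule ccontr)
    assume "f x \<noteq> 0"
    then obtain d where d: "0 < d" "\<And>h. 0 < h \<Longrightarrow> h < d \<Longrightarrow> norm (integral (cbox x (x + h *\<^sub>R One)) f /\<^sub>R h ^ DIM(real) - f x) < \<bar>f x\<bar>"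
      using N(2)[OF x, of "\<bar>f x\<bar>"] by auto
    show False using d(2)[of "d/2"] d(1) assms(2)[of x "x + d/2"] by simp
  qed
  then have "{x. f x \<noteq> 0} \<subseteq> N" by auto
  then show ?thesis by (rule negligible_subset[OF N(1)])
qed

text \<open>Testing with second antiderivatives of smoothed step functions shows that the primitive of
  \<^term>\<open>h\<close> has vanishing third divided differences.\<close>

lemma weakly_affine:
  fixes h :: "real \<Rightarrow> real"
  assumes h: "\<And>a b. h absolutely_integrable_on {a..b}"
    and weak: "\<And>f f1 f2 R. (\<And>n. times_differentiable n f) \<Longrightarrow> (\<And>x. (f has_real_derivative f1 x) (at x)) \<Longrightarrow>
      (\<And>x. (f1 has_real_derivative f2 x) (at x)) \<Longrightarrow> continuous_on UNIV f2 \<Longrightarrow> (\<And>x. R - 1 \<le> \<bar>x\<bar> \<Longrightarrow> f x = 0) \<Longrightarrow> 1 < R \<Longrightarrow>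
      integral {-R..R} (\<lambda>x. h x * f2 x) = 0"
  shows "\<exists>\<alpha> \<beta>. negligible {x. h x \<noteq> \<alpha> + \<beta> * x}"
proof -
  obtain S S1 S2 :: "real \<Rightarrow> real" and k1 k2 :: real where
    S: "\<And>n. times_differentiable n S2" "\<And>x. (S2 has_real_derivative S1 x) (at x)"
    "\<And>x. (S1 has_real_derivative S x) (at x)" "continuous_on UNIV S"
    "\<And>x. 0 \<le> S x \<and> S x \<le> 1" "\<And>x. x \<le> 0 \<Longrightarrow> S x = 0 \<and> S1 x = 0 \<and> S2 x = 0"
    "\<And>x. 1 \<le> x \<Longrightarrow> S x = 1 \<and> S1 x = x - k1 \<and> S2 x = x\<^sup>2 / 2 - k1 * x + k2"
    by (rule smooth_step) (rule that)
  have hi: "h integrable_on {a..b}" for a b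
    using h by (rule set_lebesgue_integral_eq_integral(1))
  have combine: "integral {a..c} h = integral {a..b} h + integral {b..c} h" if "a \<le> b" "b \<le> c" for a b c
    using that hi by (intro Henstock_Kurzweil_Integration.integral_combine[symmetric])
  have third: "integral {-A..a} h = (1 - a\<^sup>2) * integral {-A..0} h
      + (a * (a + 1) / 2) * integral {-A..1} h + (a * (a - 1) / 2) * integral {-A..-1} h"
    if A: "\<bar>a\<bar> + 3 \<le> A" for a A
  proof -
    \<comment> \<open>Lagrange weights at \<open>a\<close> for the nodes 0, 1, -1. Interpolation of
      quadratics is exact, so \<open>comb\<close> annihilates the quadratic form of
      \<open>S2\<close> to the right of all nodes; to the left \<open>S2\<close> is 0. Hence
      \<open>comb S2 n\<close> has compact support, while its second derivative is a combination of
      steps.\<close>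
    define c0 where "c0 = 1 - a\<^sup>2"
    define c1 where "c1 = a * (a + 1) / 2"
    define c2 where "c2 = a * (a - 1) / 2"
    define comb where "comb = (\<lambda>(g::real \<Rightarrow> real) n x. - g (n * (x - a)) + c0 * g (n * x) + c1 * g (n * (x - 1)) + c2 * g (n * (x + 1)))"
    have z: "integral {-A..A} (\<lambda>x. h x * comb S n x) = 0" if n: "1 \<le> n" for n :: real
    proof (rule weak)
      have sc: "((\<lambda>x. g (n * (x - p))) has_real_derivative n * g' (n * (x - p))) (at x)"
        if "\<And>x. (g has_real_derivative g' x) (at x)" for g g' :: "real \<Rightarrow> real" and p x
      proof -
        have "((\<lambda>x. n * (x - p)) has_real_derivative n) (at x)" by (auto intro!: derivative_eq_intros)
        from DERIV_chain2[OF that this] show ?thesis by (simp add: mult.commute)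
      qed
      have sc0: "((\<lambda>x. g (n * x)) has_real_derivative n * g' (n * x)) (at x)"
        "((\<lambda>x. g (n * (x + 1))) has_real_derivative n * g' (n * (x + 1))) (at x)"
        if "\<And>x. (g has_real_derivative g' x) (at x)" for g g' :: "real \<Rightarrow> real" and x
        using sc[OF that, of 0 x] sc[OF that, of "-1" x] by auto
      have cd: "((\<lambda>x. r * comb g n x) has_real_derivative (r * n) * comb g' n x) (at x)"
        if "\<And>x. (g has_real_derivative g' x) (at x)" for g g' :: "real \<Rightarrow> real" and x r
        unfolding comb_def
        by (rule DERIV_cong[OF DERIV_cmult[OF DERIV_add[OF DERIV_add[OF DERIV_add[OF DERIV_minus[OF sc[OF that, of a]]
              DERIV_cmult[OF sc0(1)[OF that], of c0]] DERIV_cmult[OF sc[OF that, of 1], of c1]] DERIV_cmult[OF sc0(2)[OF that], of c2]]]])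
          (simp add: algebra_simps)
      show "times_differentiable m (\<lambda>x. (1 / n\<^sup>2) * comb S2 n x)" for m
      proof -
        have "times_differentiable m (\<lambda>x. S2 (n * x + d))" for d
          by (rule times_differentiable_affine[OF S(1)])
        from this[of "- n * a"] this[of 0] this[of "- n"] this[of n]
        have "times_differentiable m (\<lambda>x. (1 / n\<^sup>2) * ((-1) * S2 (n * x + - n * a) + c0 * S2 (n * x + 0) + c1 * S2 (n * x + - n) + c2 * S2 (n * x + n)))"
          by (intro times_differentiable_mult times_differentiable_const times_differentiable_add)
        then show ?thesis by (simp add: comb_def algebra_simps)
      qed
      show "((\<lambda>x. (1 / n\<^sup>2) * comb S2 n x) has_real_derivative (1 / n) * comb S1 n x) (at x)" for x
        using cd[OF S(2), of "1 / n\<^sup>2" x] n by (simp add: power2_eq_square)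
      show "((\<lambda>x. (1 / n) * comb S1 n x) has_real_derivative comb S n x) (at x)" for x
        using cd[OF S(3), of "1 / n" x] n by simp
      show "continuous_on UNIV (comb S n)"
        unfolding comb_def by (intro continuous_intros continuous_on_compose2[OF S(4)]) auto
      show "1 < A" using A by simp
      fix x assume x: "A - 1 \<le> \<bar>x\<bar>"
      show "(1 / n\<^sup>2) * comb S2 n x = 0"
      proof (cases "0 \<le> x")
        case True
        then have ge: "1 \<le> x - a" "1 \<le> x" "1 \<le> x - 1" "1 \<le> x + 1" using x A by auto
        have ge': "1 \<le> n * y" if "1 \<le> y" for y using mult_mono[of 1 n 1 y] n that by simp
        have v: "S2 (n * y) = (n * y)\<^sup>2 / 2 - k1 * (n * y) + k2" if "1 \<le> y" for y
          using S(7)[OF ge'[OF that]] by simp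
        have "comb S2 n x = - ((n * (x - a))\<^sup>2 / 2 - k1 * (n * (x - a)) + k2) + c0 * ((n * x)\<^sup>2 / 2 - k1 * (n * x) + k2)
            + c1 * ((n * (x - 1))\<^sup>2 / 2 - k1 * (n * (x - 1)) + k2) + c2 * ((n * (x + 1))\<^sup>2 / 2 - k1 * (n * (x + 1)) + k2)"
          unfolding comb_def by (simp only: v[OF ge(1)] v[OF ge(2)] v[OF ge(3)] v[OF ge(4)])
        also have "\<dots> = 0" by (simp add: c0_def c1_def c2_def field_simps power2_eq_square)
        finally have "comb S2 n x = 0" .
        then show ?thesis by simp
      next
        case False
        then have le: "x - a \<le> 0" "x \<le> 0" "x - 1 \<le> 0" "x + 1 \<le> 0" using x A by auto
        have le': "n * y \<le> 0" if "y \<le> 0" for y using n that by (simp add: mult_nonneg_nonpos)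
        show ?thesis unfolding comb_def
          using S(6)[OF le'[OF le(1)]] S(6)[OF le'[OF le(2)]] S(6)[OF le'[OF le(3)]] S(6)[OF le'[OF le(4)]] by simp
      qed
    qed
    have int: "(\<lambda>x. h x * S (r * (x - p))) integrable_on {-A..A}" for r p
    proof -
      have "continuous_on {-A..A} (\<lambda>x. S (r * (x - p)))"
        by (intro continuous_on_compose2[OF S(4)] continuous_intros) auto
      then have "(\<lambda>x. h x * S (r * (x - p))) absolutely_integrable_on {-A..A}"
        by (rule absolutely_integrable_mult_continuous[OF h])
      then show ?thesis by (rule set_lebesgue_integral_eq_integral(1))
    qed
    \<comment> \<open>For large \<open>n\<close> the step at \<open>p\<close> becomes the indicator
      of x > p, so testing yields a relation between integrals of \<open>h\<close> over the
      intervals from \<open>p\<close> to \<open>A\<close>.\<close>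
    have lim: "(\<lambda>n. integral {-A..A} (\<lambda>x. h x * S (real (Suc n) * (x - p)))) \<longlonglongrightarrow> integral {p..A} h"
      if p: "\<bar>p\<bar> \<le> A" for p
    proof -
      have "(\<lambda>n. integral {-A..A} (\<lambda>x. h x * S (real (Suc n) * (x - p)))) \<longlonglongrightarrow> integral {-A..A} (\<lambda>x. if x \<in> {p<..} then h x else 0)"
      proof (rule dominated_convergence(2))
        show "(\<lambda>x. h x * S (real (Suc n) * (x - p))) integrable_on {-A..A}" for n by (rule int)
        show "(\<lambda>x. \<bar>h x\<bar>) integrable_on {-A..A}" using h[of "-A" A] by (simp add: absolutely_integrable_on_def)
        show "norm (h x * S (real (Suc n) * (x - p))) \<le> \<bar>h x\<bar>" for n x
          using S(5)[of "real (Suc n) * (x - p)"] by (simp add: abs_mult mult_left_le)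
        show "(\<lambda>n. h x * S (real (Suc n) * (x - p))) \<longlonglongrightarrow> (if x \<in> {p<..} then h x else 0)" for x
        proof (cases "p < x")
          case True
          obtain n0 :: nat where n0: "1 / (x - p) \<le> real n0" using real_arch_simple by blast
          have "h x * S (real (Suc n) * (x - p)) = h x" if "n0 \<le> n" for n
          proof -
            have "1 \<le> real n0 * (x - p)" using n0 True by (simp add: field_simps)
            also have "\<dots> \<le> real (Suc n) * (x - p)" using that True by (intro mult_right_mono) auto
            finally show ?thesis using S(7) by simp
          qed
          then have "\<forall>\<^sub>F n in sequentially. h x = h x * S (real (Suc n) * (x - p))"
            by (intro eventually_sequentiallyI[of n0]) simp
          then have "(\<lambda>n. h x * S (real (Suc n) * (x - p))) \<longlonglongrightarrow> h x"
            by (rule Lim_transform_eventually[OF tendsto_const])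
          then show ?thesis using True by simp
        next
          case False
          then have "real (Suc n) * (x - p) \<le> 0" for n by (intro mult_nonneg_nonpos) auto
          then show ?thesis using S(6) False by simp
        qed
      qed
      also have "integral {-A..A} (\<lambda>x. if x \<in> {p<..} then h x else 0) = integral {p..A} h"
      proof -
        have "integral {-A..A} (\<lambda>x. if x \<in> {p<..} then h x else 0) = integral ({-A..A} \<inter> {p<..}) h"
          by (subst Int_commute) (rule Henstock_Kurzweil_Integration.integral_restrict_Int)
        also have "\<dots> = integral {p..A} h"
          by (rule integral_spike_set) (use p in \<open>auto intro: negligible_subset[of "{p}"]\<close>)
        finally show ?thesis .
      qed
      finally show ?thesis .
    qed
    have split: "integral {-A..A} (\<lambda>x. h x * comb S r x) =
      - integral {-A..A} (\<lambda>x. h x * S (r * (x - a))) + c0 * integral {-A..A} (\<lambda>x. h x * S (r * (x - 0)))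
       + c1 * integral {-A..A} (\<lambda>x. h x * S (r * (x - 1))) + c2 * integral {-A..A} (\<lambda>x. h x * S (r * (x - (-1))))"
      for r
    proof (rule integral_unique)
      have "((\<lambda>x. - (h x * S (r * (x - a))) + c0 * (h x * S (r * (x - 0)))
       + c1 * (h x * S (r * (x - 1))) + c2 * (h x * S (r * (x - (-1))))) has_integral
        (- integral {-A..A} (\<lambda>x. h x * S (r * (x - a))) + c0 * integral {-A..A} (\<lambda>x. h x * S (r * (x - 0)))
       + c1 * integral {-A..A} (\<lambda>x. h x * S (r * (x - 1))) + c2 * integral {-A..A} (\<lambda>x. h x * S (r * (x - (-1)))))) {-A..A}"
        by (intro has_integral_add has_integral_neg has_integral_mult_right integrable_integral int)
      moreover have "- (h x * S (r * (x - a))) + c0 * (h x * S (r * (x - 0)))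
       + c1 * (h x * S (r * (x - 1))) + c2 * (h x * S (r * (x - (-1)))) = h x * comb S r x" for x
        by (simp add: comb_def distrib_left right_diff_distrib mult.left_commute)
      ultimately show "((\<lambda>x. h x * comb S r x) has_integral
        (- integral {-A..A} (\<lambda>x. h x * S (r * (x - a))) + c0 * integral {-A..A} (\<lambda>x. h x * S (r * (x - 0)))
       + c1 * integral {-A..A} (\<lambda>x. h x * S (r * (x - 1))) + c2 * integral {-A..A} (\<lambda>x. h x * S (r * (x - (-1)))))) {-A..A}"
        by (simp only:)
    qed
    have "- integral {-A..A} (\<lambda>x. h x * S (real (Suc n) * (x - a))) + c0 * integral {-A..A} (\<lambda>x. h x * S (real (Suc n) * (x - 0)))
       + c1 * integral {-A..A} (\<lambda>x. h x * S (real (Suc n) * (x - 1))) + c2 * integral {-A..A} (\<lambda>x. h x * S (real (Suc n) * (x - (-1)))) = 0" for n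
      unfolding split[symmetric] by (rule z) simp
    moreover have "(\<lambda>n. - integral {-A..A} (\<lambda>x. h x * S (real (Suc n) * (x - a))) + c0 * integral {-A..A} (\<lambda>x. h x * S (real (Suc n) * (x - 0)))
       + c1 * integral {-A..A} (\<lambda>x. h x * S (real (Suc n) * (x - 1))) + c2 * integral {-A..A} (\<lambda>x. h x * S (real (Suc n) * (x - (-1)))))
      \<longlonglongrightarrow> - integral {a..A} h + c0 * integral {0..A} h + c1 * integral {1..A} h + c2 * integral {-1..A} h"
      by (intro tendsto_intros lim) (use A in auto)
    ultimately have "(\<lambda>n. 0) \<longlonglongrightarrow> - integral {a..A} h + c0 * integral {0..A} h + c1 * integral {1..A} h + c2 * integral {-1..A} h"
      by (simp only:)
    then have zero: "- integral {a..A} h + c0 * integral {0..A} h + c1 * integral {1..A} h + c2 * integral {-1..A} h = 0"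
      by (simp only: LIMSEQ_const_iff)
    \<comment> \<open>Passage to integrals starting at \<open>-A\<close>: the full integrals cancel
      because the three weights add up to 1.\<close>
    have tail: "integral {p..A} h = integral {-A..A} h - integral {-A..p} h" if "\<bar>p\<bar> \<le> A" for p
    proof -
      have "-A \<le> p" "p \<le> A" using that by auto
      from combine[OF this] show ?thesis by linarith
    qed
    have "\<bar>a\<bar> \<le> A" "\<bar>0\<bar> \<le> A" "\<bar>1\<bar> \<le> A" "\<bar>-1\<bar> \<le> A" using A by auto
    note t = this[THEN tail]
    have "- (integral {-A..A} h - integral {-A..a} h) + c0 * (integral {-A..A} h - integral {-A..0} h)
      + c1 * (integral {-A..A} h - integral {-A..1} h) + c2 * (integral {-A..A} h - integral {-A..-1} h) = 0"
      using zero unfolding t .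
    moreover have "c0 + c1 + c2 = 1" by (simp add: c0_def c1_def c2_def field_simps power2_eq_square)
    moreover have "i = c0 * r + c1 * s + c2 * t"
      if "- (J - i) + c0 * (J - r) + c1 * (J - s) + c2 * (J - t) = 0" "c0 + c1 + c2 = 1" for i J r s t :: real
    proof -
      have "- (J - i) + c0 * (J - r) + c1 * (J - s) + c2 * (J - t) = i - (c0 * r + c1 * s + c2 * t) + (c0 + c1 + c2 - 1) * J"
        by (simp add: algebra_simps)
      then show ?thesis using that by simp
    qed
    ultimately show ?thesis unfolding c0_def[symmetric] c1_def[symmetric] c2_def[symmetric] by blast
  qed
  define P where "P = integral {0..1} h"
  define M where "M = integral {-1..0} h"
  \<comment> \<open>Read off from \<open>third\<close>: the primitive of \<open>h\<close> at a is
    its value at 0 plus a (P + M)/2 + a^2 (P - M)/2, and \<open>h\<close> should be the derivative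
    of this.\<close>
  define \<alpha> where "\<alpha> = (P + M) / 2"
  define \<beta> where "\<beta> = P - M"
  have diff: "integral {a..b} h = \<alpha> * (b - a) + \<beta> * (b\<^sup>2 - a\<^sup>2) / 2" if ab: "a \<le> b" for a b
  proof -
    define A where "A = \<bar>a\<bar> + \<bar>b\<bar> + 3"
    have A: "\<bar>a\<bar> + 3 \<le> A" "\<bar>b\<bar> + 3 \<le> A" by (auto simp: A_def)
    have e1: "integral {a..b} h = integral {-A..b} h - integral {-A..a} h" using combine[of "-A" a b] ab A by auto
    have e2: "integral {-A..1} h = integral {-A..0} h + P" "integral {-A..0} h = integral {-A..-1} h + M"
      using combine[of "-A" 0 1] combine[of "-A" "-1" 0] A by (auto simp: P_def M_def)
    show ?thesis unfolding e1 third[OF A(1)] third[OF A(2)] e2 \<alpha>_def \<beta>_def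
      by (simp add: field_simps power2_eq_square)
  qed
  have aff: "((\<lambda>x. \<alpha> + \<beta> * x) has_integral (\<alpha> * (b - a) + \<beta> * (b\<^sup>2 - a\<^sup>2) / 2)) {a..b}" if "a \<le> b" for a b
  proof -
    have "((\<lambda>x. \<alpha> + \<beta> * x) has_integral ((\<alpha> * b + \<beta> * b\<^sup>2 / 2) - (\<alpha> * a + \<beta> * a\<^sup>2 / 2))) {a..b}"
      using that by (intro fundamental_theorem_of_calculus)
        (auto simp: has_real_derivative_iff_has_vector_derivative[symmetric] intro!: derivative_eq_intros)
    then show ?thesis by (simp add: algebra_simps diff_divide_distrib)
  qed
  have "negligible {x. h x - (\<alpha> + \<beta> * x) \<noteq> 0}"
  proof (rule absolutely_integrable_interval_eq_0)
    show "(\<lambda>x. h x - (\<alpha> + \<beta> * x)) integrable_on {a..b}" for a b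
      by (intro integrable_diff hi integrable_continuous_real continuous_intros)
    fix a b :: real assume ab: "a \<le> b"
    have "((\<lambda>x. h x - (\<alpha> + \<beta> * x)) has_integral (integral {a..b} h - (\<alpha> * (b - a) + \<beta> * (b\<^sup>2 - a\<^sup>2) / 2))) {a..b}"
      by (intro has_integral_diff aff ab integrable_integral hi)
    then show "integral {a..b} (\<lambda>x. h x - (\<alpha> + \<beta> * x)) = 0" using diff[OF ab] by (simp add: integral_unique)
  qed
  then show ?thesis by auto
qed

section \<open>Regularity of weak eigenfunctions\<close>

lemma vderiv_of_real:
  assumes "(f has_real_derivative d) (at x)"
  shows "vderiv (\<lambda>x. complex_of_real (f x)) x = complex_of_real d"
    and "(\<lambda>x. complex_of_real (f x)) differentiable (at x)"
proof -
  have "((\<lambda>x. complex_of_real (f x)) has_vector_derivative complex_of_real d) (at x)"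
    using assms by (intro has_vector_derivative_of_real) (simp add: has_real_derivative_iff_has_vector_derivative)
  then show "vderiv (\<lambda>x. complex_of_real (f x)) x = complex_of_real d"
    "(\<lambda>x. complex_of_real (f x)) differentiable (at x)"
    unfolding vderiv_def by (auto intro: vector_derivative_at differentiableI_vector)
qed

lemma deriv_vanishes_outside:
  assumes "\<And>x. R < \<bar>x\<bar> \<Longrightarrow> f x = (0::real)" "(f has_real_derivative d) (at x)" "R < \<bar>x\<bar>"
  shows "d = 0"
proof -
  have "((\<lambda>x. 0) has_real_derivative d) (at x)"
    by (rule has_field_derivative_transform_within_open[OF assms(2), of "{x. R < \<bar>x\<bar>}"])
      (use assms in \<open>auto intro!: open_Collect_less continuous_intros\<close>)
  then show ?thesis using DERIV_unique DERIV_const by blast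
qed

text \<open>All iterates of \<open>vderiv\<close> stay real-valued, smooth and supported in [-R,R],
  so each derivative times a power is continuous on a compact set and zero elsewhere.\<close>

lemma schwartz_of_real:
  fixes f :: "real \<Rightarrow> real"
  assumes f: "\<And>n. times_differentiable n f" and supp: "\<And>x. R < \<bar>x\<bar> \<Longrightarrow> f x = 0"
  shows "(\<lambda>x. complex_of_real (f x)) \<in> schwartz"
proof -
  define G where "G = (\<lambda>n. (deriv ^^ n) f)"
  have G: "(\<forall>m. times_differentiable m (G n)) \<and> (\<forall>x. R < \<bar>x\<bar> \<longrightarrow> G n x = 0)
      \<and> (vderiv ^^ n) (\<lambda>x. complex_of_real (f x)) = (\<lambda>x. complex_of_real (G n x))" for n
  proof (induction n)
    case 0
    then show ?case using f supp by (simp add: G_def)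
  next
    case (Suc n)
    have d: "(G n has_real_derivative G (Suc n) x) (at x)" for x
    proof -
      obtain g' where g': "\<And>x. (G n has_real_derivative g' x) (at x)"
        using Suc by (meson times_differentiable_SucE)
      have "G (Suc n) x = deriv (G n) x" by (simp add: G_def)
      then show ?thesis using g'[of x] DERIV_imp_deriv[OF g'] by simp
    qed
    have "times_differentiable m (G (Suc n))" for m
    proof -
      have "times_differentiable (Suc m) (G n)" using Suc by simp
      then obtain g' where g': "\<And>x. (G n has_real_derivative g' x) (at x)" "times_differentiable m g'"
        by (meson times_differentiable_SucE)
      have "g' = G (Suc n)" using DERIV_unique[OF g'(1) d] by blast
      then show ?thesis using g'(2) by simp
    qed
    moreover have "G (Suc n) x = 0" if "R < \<bar>x\<bar>" for x
      by (rule deriv_vanishes_outside[OF _ d that]) (use Suc in auto)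
    moreover have "(vderiv ^^ Suc n) (\<lambda>x. complex_of_real (f x)) = (\<lambda>x. complex_of_real (G (Suc n) x))"
      using Suc vderiv_of_real(1)[OF d] by auto
    ultimately show ?case by blast
  qed
  show ?thesis unfolding schwartz_def
  proof (intro CollectI allI conjI)
    fix n x
    obtain g' where d: "\<And>x. (G n has_real_derivative g' x) (at x)"
      using G by (meson times_differentiable_SucE)
    show "(vderiv ^^ n) (\<lambda>x. complex_of_real (f x)) differentiable (at x)"
      using G vderiv_of_real(2)[OF d] by simp
  next
    fix n m
    obtain g' where d: "\<And>x. (G n has_real_derivative g' x) (at x)"
      using G by (meson times_differentiable_SucE)
    have "continuous_on {-R..R} (G n)" by (intro DERIV_continuous_on) (rule has_field_derivative_at_within[OF d])
    then have "bounded ((\<lambda>x. complex_of_real (x ^ m) * complex_of_real (G n x)) ` {-R..R})"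
      by (intro compact_imp_bounded compact_continuous_image continuous_intros) auto
    moreover have "range (\<lambda>x. complex_of_real (x ^ m) * complex_of_real (G n x)) \<subseteq>
        insert 0 ((\<lambda>x. complex_of_real (x ^ m) * complex_of_real (G n x)) ` {-R..R})"
    proof safe
      fix x
      assume "complex_of_real (x ^ m) * complex_of_real (G n x) \<notin> (\<lambda>x. complex_of_real (x ^ m) * complex_of_real (G n x)) ` {-R..R}"
      then have "x \<notin> {-R..R}" by blast
      then have "\<not> (- R \<le> x \<and> x \<le> R)" by simp
      then have "R < \<bar>x\<bar>" by linarith
      then show "complex_of_real (x ^ m) * complex_of_real (G n x) = 0" using G by simp
    qed
    ultimately have "bounded (range (\<lambda>x. complex_of_real (x ^ m) * complex_of_real (G n x)))"
      by (meson bounded_insert bounded_subset)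
    then show "bounded (range (\<lambda>x. complex_of_real (x ^ m) * (vderiv ^^ n) (\<lambda>x. complex_of_real (f x)) x))"
      using G by simp
  qed
qed

lemma acd_spike:
  assumes "acd a b F f" "negligible N" "\<And>x. x \<notin> N \<Longrightarrow> f x = g x"
  shows "acd a b F g"
  using assms unfolding acd_def
  by (auto intro: absolutely_integrable_spike[where f=f and S=N] has_integral_spike[where f=f and S=N])

text \<open>The signed integral from 0 to \<open>x\<close>: one of the two intervals is always empty
  or a point. This is a primitive on the whole line, not just to the right of a base point.\<close>

definition oriented_integral :: "(real \<Rightarrow> real) \<Rightarrow> real \<Rightarrow> real" where
  "oriented_integral q x = integral {0..x} q - integral {x..0} q"

lemma oriented_integral_diff:
  assumes q: "\<And>a b. q integrable_on {a..b}" and ab: "a \<le> b"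
  shows "oriented_integral q b - oriented_integral q a = integral {a..b} q"
proof -
  have comb: "integral {r..s} q + integral {s..t} q = integral {r..t} q" if "r \<le> s" "s \<le> t" for r s t
    using that q by (intro Henstock_Kurzweil_Integration.integral_combine)
  have z: "integral {s..r} q = 0" if "r \<le> s" for r s :: real
    using that by (cases "r = s") auto
  consider "0 \<le> a" | "a < 0" "0 \<le> b" | "b < 0" using ab by linarith
  then show ?thesis
    by cases (use comb[of 0 a b] comb[of a 0 b] comb[of a b 0] z[of 0 a] z[of 0 b] z[of a 0] z[of b 0] ab
        in \<open>auto simp: oriented_integral_def\<close>)
qed

lemma acd_oriented_integral:
  assumes "\<And>a b. q absolutely_integrable_on {a..b}"
  shows "acd a b (oriented_integral q) q"
  unfolding acd_def
proof (intro conjI ballI assms)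
  have qi: "q integrable_on {a..b}" for a b using assms by (rule set_lebesgue_integral_eq_integral(1))
  fix x assume "x \<in> {a..b}"
  then show "(q has_integral oriented_integral q x - oriented_integral q a) {a..x}"
    using oriented_integral_diff[OF qi, of a x] qi by (simp add: has_integral_integrable_integral)
qed

lemma oriented_integral_deriv:
  assumes q: "continuous_on UNIV q"
  shows "(oriented_integral q has_real_derivative q x) (at x)"
proof -
  have qi: "q integrable_on {a..b}" for a b
    using q by (auto intro!: integrable_continuous_real intro: continuous_on_subset)
  have "((\<lambda>y. integral {x - 1..y} q) has_real_derivative q x) (at x within {x - 1..x + 1})"
    using q by (intro integral_has_real_derivative) (auto intro: continuous_on_subset)
  then have "((\<lambda>y. oriented_integral q (x - 1) + integral {x - 1..y} q) has_real_derivative 0 + q x) (at x within {x - 1..x + 1})"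
    by (intro DERIV_add DERIV_const)
  moreover have "at x within {x - 1..x+1} = at x" by (intro at_within_interior) simp
  ultimately have "((\<lambda>y. oriented_integral q (x - 1) + integral {x - 1..y} q) has_real_derivative q x) (at x)" by simp
  then show ?thesis
  proof (rule has_field_derivative_transform_within_open[of _ _ _ "{x-1<..}"])
    fix y assume "y \<in> {x - 1<..}"
    then show "oriented_integral q (x - 1) + integral {x - 1..y} q = oriented_integral q y"
      using oriented_integral_diff[OF qi, of "x - 1" y] by simp
  qed auto
qed

text \<open>Passage between Lebesgue integrals over the line, in which the operator is defined, and
  interval integrals, in which the calculus is done.\<close>

lemma integral_eq_integral_support:
  fixes g :: "real \<Rightarrow> real"
  assumes "g absolutely_integrable_on {-R..R}" "\<And>x. R < \<bar>x\<bar> \<Longrightarrow> g x = 0"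
  shows "(LINT x|lebesgue. g x) = integral {-R..R} g" "integrable lebesgue g"
proof -
  have "indicator {-R..R} x *\<^sub>R g x = g x" for x
  proof (cases "R < \<bar>x\<bar>")
    case True
    then show ?thesis using assms(2) by simp
  next
    case False
    then have "x \<in> {-R..R}" by auto
    then show ?thesis by simp
  qed
  then have eq: "(\<lambda>x. indicator {-R..R} x *\<^sub>R g x) = g" by blast
  show "(LINT x|lebesgue. g x) = integral {-R..R} g" "integrable lebesgue g"
    using set_lebesgue_integral_eq_integral(2)[OF assms(1)] assms(1)
    unfolding set_lebesgue_integral_def set_integrable_def eq by simp_all
qed

lemma square_integrable_imp_absolutely_integrable:
  fixes u :: "real \<Rightarrow> real"
  assumes u: "u \<in> borel_measurable lebesgue" "integrable lebesgue (\<lambda>x. (u x)\<^sup>2)"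
  shows "u absolutely_integrable_on {a..b}"
  unfolding set_integrable_def
proof (rule Bochner_Integration.integrable_bound)
  show "integrable lebesgue (\<lambda>x. indicator {a..b} x + (u x)\<^sup>2)"
    by (intro Bochner_Integration.integrable_add u(2)) (simp add: integrable_indicator_iff emeasure_lborel_Icc_eq)
  show "(\<lambda>x. indicat_real {a..b} x *\<^sub>R u x) \<in> borel_measurable lebesgue"
    using u(1) by (intro borel_measurable_scaleR borel_measurable_indicator) auto
  have "\<bar>u x\<bar> \<le> 1 + (u x)\<^sup>2" for x
    using sum_squares_bound[of 1 "\<bar>u x\<bar>"] by (simp) 
  then show "AE x in lebesgue. norm (indicat_real {a..b} x *\<^sub>R u x) \<le> norm (indicator {a..b} x + (u x)\<^sup>2)"
    by (auto simp: indicator_def)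
qed

text \<open>Subtract from \<open>u\<close> a second primitive \<open>Q2\<close> of (V - E) u.
  Integration by parts shows that the difference has weak second derivative 0, hence it is affine
  almost everywhere, and \<open>Q2\<close> plus this affine function is the representative
  sought.\<close>

lemma weak_eigenfunction_regular:
  fixes u V :: "real \<Rightarrow> real" and E :: real
  assumes u: "u \<in> borel_measurable lebesgue" "integrable lebesgue (\<lambda>x. (u x)\<^sup>2)"
    and V: "V \<in> borel_measurable lebesgue" "\<And>R. \<exists>M. \<forall>x\<in>{-R..R}. \<bar>V x\<bar> \<le> M"
    and weak: "\<And>f f1 f2 R. (\<And>n. times_differentiable n f) \<Longrightarrow> (\<And>x. (f has_real_derivative f1 x) (at x)) \<Longrightarrow>
      (\<And>x. (f1 has_real_derivative f2 x) (at x)) \<Longrightarrow> continuous_on UNIV f2 \<Longrightarrow> (\<And>x. R < \<bar>x\<bar> \<Longrightarrow> f x = 0) \<Longrightarrow>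
      (LINT x|lebesgue. (- f2 x + V x * f x) * u x) = (LINT x|lebesgue. f x * (E * u x))"
  shows "\<exists>\<psi> \<psi>'. (AE x in lebesgue. u x = \<psi> x) \<and> (\<forall>x. (\<psi> has_real_derivative \<psi>' x) (at x)) \<and>
    (\<forall>a b. acd a b \<psi>' (\<lambda>x. (V x - E) * \<psi> x))"
proof -
  have ua: "u absolutely_integrable_on {a..b}" for a b
    by (rule square_integrable_imp_absolutely_integrable[OF u])
  have Vb: "bounded ((\<lambda>x. V x - E) ` {a..b})" for a b
  proof -
    obtain M where M: "\<forall>x\<in>{-(\<bar>a\<bar> + \<bar>b\<bar>)..\<bar>a\<bar> + \<bar>b\<bar>}. \<bar>V x\<bar> \<le> M" using V(2) by blast
    show ?thesis unfolding bounded_iff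
    proof (intro exI ballI)
      fix y assume "y \<in> (\<lambda>x. V x - E) ` {a..b}"
      then obtain x where x: "y = V x - E" "x \<in> {a..b}" by auto
      then have "x \<in> {-(\<bar>a\<bar> + \<bar>b\<bar>)..\<bar>a\<bar> + \<bar>b\<bar>}" by auto
      then have "\<bar>V x\<bar> \<le> M" using M by blast
      then show "norm y \<le> M + \<bar>E\<bar>" using x by simp
    qed
  qed
  \<comment> \<open>Integrable on bounded intervals because \<open>V\<close> is bounded there;
    almost everywhere it is the second derivative that the representative is going to have.\<close>
  define q where "q = (\<lambda>x. (V x - E) * u x)"
  have qa: "q absolutely_integrable_on {a..b}" for a b
    unfolding q_def using V(1) by (intro absolutely_integrable_bounded_measurable_product_real Vb ua)
      (auto intro!: borel_measurable_diff measurable_restrict_space1)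
  define Q1 where "Q1 = oriented_integral q"
  define Q2 where "Q2 = oriented_integral Q1"
  have Q1: "acd a b Q1 q" for a b unfolding Q1_def by (rule acd_oriented_integral[OF qa])
  have Q1c: "continuous_on UNIV Q1"
  proof (intro continuous_at_imp_continuous_on ballI)
    fix x
    have "continuous_on {x - 1..x + 1} Q1" by (rule acd_continuous_on[OF Q1])
    then show "isCont Q1 x" by (rule continuous_on_interior) simp
  qed
  have Q2: "(Q2 has_real_derivative Q1 x) (at x)" for x unfolding Q2_def by (rule oriented_integral_deriv[OF Q1c])
  have Q2c: "continuous_on S Q2" for S by (intro DERIV_continuous_on) (rule has_field_derivative_at_within[OF Q2])
  have h: "(\<lambda>x. u x - Q2 x) absolutely_integrable_on {a..b}" for a b
    by (intro set_integral_diff(1) ua absolutely_integrable_continuous_real Q2c)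
  have "\<exists>\<alpha> \<beta>. negligible {x. u x - Q2 x \<noteq> \<alpha> + \<beta> * x}"
  proof (rule weakly_affine[OF h])
    fix f f1 f2 R
    assume f: "\<And>n. times_differentiable n f" "\<And>x. (f has_real_derivative f1 x) (at x)"
      "\<And>x. (f1 has_real_derivative f2 x) (at x)" "continuous_on UNIV f2" "\<And>x. R - 1 \<le> \<bar>x\<bar> \<Longrightarrow> f x = 0" "1 < (R::real)"
    have f0: "f x = 0" if "R - 1 < \<bar>x\<bar>" for x using f(5) that by simp
    have f10: "f1 x = 0" if "R - 1 < \<bar>x\<bar>" for x by (rule deriv_vanishes_outside[OF f0 f(2) that])
    have f20: "f2 x = 0" if "R - 1 < \<bar>x\<bar>" for x by (rule deriv_vanishes_outside[OF f10 f(3) that])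
    have fc: "continuous_on S f" "continuous_on S f1" "continuous_on S f2" for S
      using DERIV_continuous_on[OF has_field_derivative_at_within[OF f(2)]]
        DERIV_continuous_on[OF has_field_derivative_at_within[OF f(3)]] f(4) by (auto intro: continuous_on_subset)
    have i1: "(\<lambda>x. u x * f2 x) absolutely_integrable_on {-R..R}" and i2: "(\<lambda>x. q x * f x) absolutely_integrable_on {-R..R}"
      by (intro absolutely_integrable_mult_continuous ua qa fc)+
    have L: "(LINT x|lebesgue. u x * f2 x) = integral {-R..R} (\<lambda>x. u x * f2 x)" "integrable lebesgue (\<lambda>x. u x * f2 x)"
      by (rule integral_eq_integral_support[OF i1]; use f20 in simp)+
    have L': "(LINT x|lebesgue. q x * f x) = integral {-R..R} (\<lambda>x. q x * f x)" "integrable lebesgue (\<lambda>x. q x * f x)"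
      by (rule integral_eq_integral_support[OF i2]; use f0 in simp)+
    have i3: "integrable lebesgue (\<lambda>x. E * (f x * u x))"
    proof -
      have "(\<lambda>x. u x * f x) absolutely_integrable_on {-R..R}" by (intro absolutely_integrable_mult_continuous ua fc)
      then have "integrable lebesgue (\<lambda>x. u x * f x)" by (rule integral_eq_integral_support(2)) (use f0 in simp)
      then show ?thesis by (simp add: mult.commute)
    qed
    have "(LINT x|lebesgue. (- f2 x + V x * f x) * u x) = (LINT x|lebesgue. q x * f x - u x * f2 x + E * (f x * u x))"
      by (intro Bochner_Integration.integral_cong refl) (simp add: q_def algebra_simps)
    also have "\<dots> = (LINT x|lebesgue. q x * f x) - (LINT x|lebesgue. u x * f2 x) + (LINT x|lebesgue. E * (f x * u x))"
      using L(2) L'(2) i3 by simp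
    also have "(LINT x|lebesgue. E * (f x * u x)) = (LINT x|lebesgue. f x * (E * u x))"
      by (simp add: mult_ac)
    finally have uf: "integral {-R..R} (\<lambda>x. u x * f2 x) = integral {-R..R} (\<lambda>x. q x * f x)"
      using weak[OF f(1-4), of R] f0 L L' by simp
    have bnd: "\<exists>M. \<forall>x\<in>{-R..R}. \<bar>g x\<bar> \<le> M" if "continuous_on {-R..R} g" for g :: "real \<Rightarrow> real"
    proof -
      have "bounded (g ` {-R..R})" using that by (intro compact_imp_bounded compact_continuous_image) auto
      then show ?thesis unfolding bounded_iff by fastforce
    qed
    obtain M1 where M1: "\<And>x. x \<in> {-R..R} \<Longrightarrow> \<bar>f1 x\<bar> \<le> M1" using bnd[OF fc(2)] by blast
    obtain M2 where M2: "\<And>x. x \<in> {-R..R} \<Longrightarrow> \<bar>f2 x\<bar> \<le> M2" using bnd[OF fc(3)] by blast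
    have fd: "acd (-R) R f f1" "acd (-R) R f1 f2"
      by (intro acd_deriv has_field_derivative_at_within[OF f(2)] has_field_derivative_at_within[OF f(3)] fc)+
    have Q2d: "acd (-R) R Q2 Q1"
      by (intro acd_deriv has_field_derivative_at_within[OF Q2] continuous_on_subset[OF Q1c] subset_UNIV)
    have a1: "acd (-R) R (\<lambda>x. Q1 x * f x) (\<lambda>x. q x * f x + Q1 x * f1 x)" by (rule acd_mult[OF Q1 fd(1) M1])
    have a2: "acd (-R) R (\<lambda>x. Q2 x * f1 x) (\<lambda>x. Q1 x * f1 x + Q2 x * f2 x)" by (rule acd_mult[OF Q2d fd(2) M2])
    \<comment> \<open>The test functions vanish already for |x| >= R - 1. This margin forces
      \<open>f\<close> and \<open>f1\<close> to vanish at the endpoints, so both integrations by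
      parts have no boundary terms.\<close>
    have b: "f R = 0" "f (-R) = 0" "f1 R = 0" "f1 (-R) = 0" using f0[of R] f0[of "-R"] f10[of R] f10[of "-R"] f(6) by auto
    have "((\<lambda>x. q x * f x + Q1 x * f1 x - (Q1 x * f1 x + Q2 x * f2 x)) has_integral (0 - 0)) {-R..R}"
      using acd_has_integral[OF a1, of "-R" R] acd_has_integral[OF a2, of "-R" R] b f(6) by (intro has_integral_diff) auto
    then have "((\<lambda>x. q x * f x - Q2 x * f2 x) has_integral 0) {-R..R}" by simp
    moreover have i4: "(\<lambda>x. Q2 x * f2 x) integrable_on {-R..R}" by (intro integrable_continuous_real continuous_intros Q2c fc)
    moreover have i5: "(\<lambda>x. q x * f x) integrable_on {-R..R}" "(\<lambda>x. u x * f2 x) integrable_on {-R..R}"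
      using i1 i2 by (auto intro: set_lebesgue_integral_eq_integral(1))
    ultimately have "integral {-R..R} (\<lambda>x. q x * f x) - integral {-R..R} (\<lambda>x. Q2 x * f2 x) = 0"
      using Henstock_Kurzweil_Integration.integral_diff[OF i5(1) i4] by (simp only: integral_unique)
    then show "integral {-R..R} (\<lambda>x. (u x - Q2 x) * f2 x) = 0"
      using uf Henstock_Kurzweil_Integration.integral_diff[OF i5(2) i4] by (simp add: left_diff_distrib)
  qed
  then obtain \<alpha> \<beta> where ab: "negligible {x. u x - Q2 x \<noteq> \<alpha> + \<beta> * x}" by blast
  define \<psi> where "\<psi> = (\<lambda>x. Q2 x + (\<alpha> + \<beta> * x))"
  define \<psi>' where "\<psi>' = (\<lambda>x. Q1 x + \<beta>)"
  have neg: "negligible {x. u x \<noteq> \<psi> x}"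
    by (rule negligible_subset[OF ab]) (auto simp: \<psi>_def)
  have "AE x in lebesgue. u x = \<psi> x"
    using neg by (subst (asm) negligible_iff_null_sets) (auto dest: AE_not_in)
  moreover have "(\<psi> has_real_derivative \<psi>' x) (at x)" for x
    unfolding \<psi>_def \<psi>'_def using Q2 by (auto intro!: derivative_eq_intros)
  moreover have "acd a b \<psi>' (\<lambda>x. (V x - E) * \<psi> x)" for a b
  proof (rule acd_spike[OF _ neg])
    show "acd a b \<psi>' q"
      using Q1[of a b] by (simp add: acd_def \<psi>'_def)
  qed (simp add: q_def)
  ultimately show ?thesis by blast
qed

section \<open>A Carleman estimate for the Cauchy-Riemann operator\<close>

lemma continuous_on_slice:
  assumes "continuous_on (A \<times> B) (\<lambda>z. f (fst z) (snd z))" "t \<in> A"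
  shows "continuous_on B (f t)"
proof -
  have "continuous_on B (\<lambda>x. f (fst (t, x)) (snd (t, x)))"
    by (rule continuous_on_compose2[OF assms(1)]) (use assms(2) in \<open>auto intro!: continuous_intros\<close>)
  then show ?thesis by simp
qed

text \<open>With \<open>v = a + ib\<close>, the left hand side is the \<open>t\<close>-derivative of \<open>a\<^sub>x b + p\<^sub>t |v|\<^sup>2/2\<close>, the two squares are
  \<open>|(\<partial>\<^sub>x + i\<partial>\<^sub>t - p\<^sub>x - ip\<^sub>t) v|\<^sup>2\<close> and its counterpart for the adjoint operator, and the terms \<open>b\<^sub>x a\<^sub>t + b a\<^sub>x\<^sub>t\<close> and
  \<open>(\<dots>)p\<^sub>x + |v|\<^sup>2 p\<^sub>x\<^sub>x\<close> are \<open>x\<close>-derivatives. Dropping the adjoint square gives the Carleman inequality.\<close>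

lemma carleman_identity:
  fixes a ax aT axT b bT bx px pt pxx ptt :: real
  shows "axT * b + ax * bT + ptt * (a\<^sup>2 + b\<^sup>2) / 2 + pt * (a * aT + b * bT) =
    (bx * aT + b * axT) + (ptt + pxx) * (a\<^sup>2 + b\<^sup>2) / 2
     - ((2 * a * ax + 2 * b * bx) * px + (a\<^sup>2 + b\<^sup>2) * pxx) / 2
     - ((ax - bT - px * a + pt * b)\<^sup>2 + (aT + bx - pt * a - px * b)\<^sup>2) / 4
     + ((ax + bT + px * a + pt * b)\<^sup>2 + (bx - aT + px * b - pt * a)\<^sup>2) / 4"
  by (simp add: field_simps power2_eq_square)

lemma carleman_density_derivative:
  fixes a ax aT axT b bT pt ptt :: real
  shows "(axT * b + bT * ax) + (ptt * (a * a + b * b) + (aT * a + aT * a + (bT * b + bT * b)) * pt) / 2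
    = axT * b + ax * bT + ptt * (a\<^sup>2 + b\<^sup>2) / 2 + pt * (a * aT + b * bT)"
  by (simp add: field_simps power2_eq_square)

text \<open>For fixed \<open>t\<close> the identity is integrated over \<open>x\<close>, where the
  total x-derivatives drop out, and the result is integrated from 0 to \<open>T\<close>. The density
  contains a_x b instead of -a b_x: \<open>bx\<close> is only bounded and measurable in
  \<open>x\<close>, so it may occur for fixed \<open>t\<close> but should not be differentiated in
  \<open>t\<close> or integrated in both variables. The continuous majorant \<open>G\<close> takes
  the place of the defect for the same reason.\<close>

lemma carleman_estimate:
  fixes a ax aT axT b bT bx px pt pxx ptt G :: "real \<Rightarrow> real \<Rightarrow> real" and R T :: real
  defines "D \<equiv> {0..T} \<times> {-R..R}"
  assumes RT: "0 \<le> R" "0 \<le> T"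
  assumes cont: "continuous_on D (\<lambda>z. a (fst z) (snd z))" "continuous_on D (\<lambda>z. ax (fst z) (snd z))"
    "continuous_on D (\<lambda>z. aT (fst z) (snd z))" "continuous_on D (\<lambda>z. axT (fst z) (snd z))"
    "continuous_on D (\<lambda>z. b (fst z) (snd z))" "continuous_on D (\<lambda>z. bT (fst z) (snd z))"
    "continuous_on D (\<lambda>z. px (fst z) (snd z))" "continuous_on D (\<lambda>z. pt (fst z) (snd z))"
    "continuous_on D (\<lambda>z. pxx (fst z) (snd z))" "continuous_on D (\<lambda>z. ptt (fst z) (snd z))"
    "continuous_on D (\<lambda>z. G (fst z) (snd z))"
  assumes dx: "\<And>t x. t \<in> {0..T} \<Longrightarrow> x \<in> {-R..R} \<Longrightarrow> (a t has_real_derivative ax t x) (at x within {-R..R})"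
    "\<And>t x. t \<in> {0..T} \<Longrightarrow> x \<in> {-R..R} \<Longrightarrow> (aT t has_real_derivative axT t x) (at x within {-R..R})"
    "\<And>t x. t \<in> {0..T} \<Longrightarrow> x \<in> {-R..R} \<Longrightarrow> (px t has_real_derivative pxx t x) (at x within {-R..R})"
  assumes dt: "\<And>t x. t \<in> {0..T} \<Longrightarrow> x \<in> {-R..R} \<Longrightarrow> ((\<lambda>t. a t x) has_real_derivative aT t x) (at t within {0..T})"
    "\<And>t x. t \<in> {0..T} \<Longrightarrow> x \<in> {-R..R} \<Longrightarrow> ((\<lambda>t. ax t x) has_real_derivative axT t x) (at t within {0..T})"
    "\<And>t x. t \<in> {0..T} \<Longrightarrow> x \<in> {-R..R} \<Longrightarrow> ((\<lambda>t. b t x) has_real_derivative bT t x) (at t within {0..T})"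
    "\<And>t x. t \<in> {0..T} \<Longrightarrow> x \<in> {-R..R} \<Longrightarrow> ((\<lambda>t. pt t x) has_real_derivative ptt t x) (at t within {0..T})"
  assumes bx: "\<And>t. t \<in> {0..T} \<Longrightarrow> acd (-R) R (b t) (bx t)"
    and bx_bdd: "\<And>t. t \<in> {0..T} \<Longrightarrow> \<exists>M. \<forall>x\<in>{-R..R}. \<bar>bx t x\<bar> \<le> M"
  assumes bd: "\<And>t. t \<in> {0..T} \<Longrightarrow> a t R = 0" "\<And>t. t \<in> {0..T} \<Longrightarrow> a t (-R) = 0"
    "\<And>t. t \<in> {0..T} \<Longrightarrow> b t R = 0" "\<And>t. t \<in> {0..T} \<Longrightarrow> b t (-R) = 0"
    "\<And>x. x \<in> {-R..R} \<Longrightarrow> a T x = 0" "\<And>x. x \<in> {-R..R} \<Longrightarrow> b T x = 0" "\<And>x. x \<in> {-R..R} \<Longrightarrow> b 0 x = 0"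
  assumes G: "\<And>t x. t \<in> {0..T} \<Longrightarrow> x \<in> {-R..R} \<Longrightarrow>
    (ax t x - bT t x - px t x * a t x + pt t x * b t x)\<^sup>2 +
    (aT t x + bx t x - pt t x * a t x - px t x * b t x)\<^sup>2 \<le> G t x"
  shows "integral {-R..R} (\<lambda>x. pt 0 x * (a 0 x)\<^sup>2) / 2
       + integral {0..T} (\<lambda>t. integral {-R..R} (\<lambda>x. (ptt t x + pxx t x) * ((a t x)\<^sup>2 + (b t x)\<^sup>2))) / 2
     \<le> integral {0..T} (\<lambda>t. integral {-R..R} (G t)) / 4"
proof -
  note sl = continuous_on_slice[OF cont(1)[unfolded D_def]] continuous_on_slice[OF cont(2)[unfolded D_def]]
    continuous_on_slice[OF cont(3)[unfolded D_def]] continuous_on_slice[OF cont(4)[unfolded D_def]]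
    continuous_on_slice[OF cont(5)[unfolded D_def]] continuous_on_slice[OF cont(6)[unfolded D_def]]
    continuous_on_slice[OF cont(7)[unfolded D_def]] continuous_on_slice[OF cont(8)[unfolded D_def]]
    continuous_on_slice[OF cont(9)[unfolded D_def]] continuous_on_slice[OF cont(10)[unfolded D_def]]
    continuous_on_slice[OF cont(11)[unfolded D_def]]
  define m where "m = (\<lambda>t x. ax t x * b t x + pt t x * ((a t x)\<^sup>2 + (b t x)\<^sup>2) / 2)"
  define m' where "m' = (\<lambda>t x. axT t x * b t x + ax t x * bT t x + ptt t x * ((a t x)\<^sup>2 + (b t x)\<^sup>2) / 2
      + pt t x * (a t x * aT t x + b t x * bT t x))"
  define q where "q = (\<lambda>t x. (ptt t x + pxx t x) * ((a t x)\<^sup>2 + (b t x)\<^sup>2))"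
  have cm': "continuous_on D (\<lambda>z. m' (fst z) (snd z))" and cq: "continuous_on D (\<lambda>z. q (fst z) (snd z))"
    unfolding m'_def q_def by (intro continuous_intros cont; simp)+
  have M': "((\<lambda>t. integral {-R..R} (m t)) has_real_derivative integral {-R..R} (m' t)) (at t within {0..T})"
    if t: "t \<in> {0..T}" for t
  proof -
    have "((\<lambda>t. integral (cbox (-R) R) (m t)) has_field_derivative integral (cbox (-R) R) (m' t)) (at t within {0..T})"
    proof (rule leibniz_rule_field_derivative)
      show "((\<lambda>t. m t x) has_real_derivative m' t x) (at t within {0..T})"
        if "t \<in> {0..T}" "x \<in> cbox (-R) R" for t x
      proof -
        note d = dt[of t x]
        have "((\<lambda>t. ax t x * b t x + pt t x * (a t x * a t x + b t x * b t x) / 2) has_real_derivative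
           (axT t x * b t x + bT t x * ax t x) + (ptt t x * (a t x * a t x + b t x * b t x)
             + (aT t x * a t x + aT t x * a t x + (bT t x * b t x + bT t x * b t x)) * pt t x) / 2) (at t within {0..T})"
          using that by (intro DERIV_add DERIV_mult DERIV_cdivide d) auto
        moreover have "(axT t x * b t x + bT t x * ax t x) + (ptt t x * (a t x * a t x + b t x * b t x)
             + (aT t x * a t x + aT t x * a t x + (bT t x * b t x + bT t x * b t x)) * pt t x) / 2 = m' t x"
          unfolding m'_def by (rule carleman_density_derivative)
        ultimately show ?thesis
          unfolding m_def power2_eq_square by simp
      qed
      show "m t integrable_on cbox (-R) R" if "t \<in> {0..T}" for t
        unfolding m_def using that
        by (intro integrable_continuous continuous_intros) (use that sl in auto)
      show "continuous_on ({0..T} \<times> cbox (-R) R) (\<lambda>(x, y). m' x y)"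
        using cm' by (simp add: D_def split_def)
    qed (use t in auto)
    then show ?thesis by simp
  qed
  have low: "integral {-R..R} (q t) / 2 - integral {-R..R} (G t) / 4 \<le> integral {-R..R} (m' t)"
    if t: "t \<in> {0..T}" for t
  proof -
    obtain M where M: "\<And>x. x \<in> {-R..R} \<Longrightarrow> \<bar>bx t x\<bar> \<le> M" using bx_bdd[OF t] by blast
    have "compact (axT t ` {-R..R})" "compact (pxx t ` {-R..R})"
      using t by (auto intro!: compact_continuous_image sl[of t])
    then have "bounded (axT t ` {-R..R})" "bounded (pxx t ` {-R..R})"
      by (auto intro: compact_imp_bounded)
    then obtain M1 M2 where M1: "\<And>x. x \<in> {-R..R} \<Longrightarrow> \<bar>axT t x\<bar> \<le> M1" and M2: "\<And>x. x \<in> {-R..R} \<Longrightarrow> \<bar>pxx t x\<bar> \<le> M2"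
      unfolding bounded_iff by fastforce
    \<comment> \<open>\<open>h1\<close> and \<open>h2\<close> are the x-derivatives of b a_t and of
      (a^2 + b^2) p_x, which vanish at \<open>R\<close> and \<open>-R\<close>.\<close>
    define h1 where "h1 = (\<lambda>x. bx t x * aT t x + b t x * axT t x)"
    define h2 where "h2 = (\<lambda>x. (2 * a t x * ax t x + 2 * b t x * bx t x) * px t x + ((a t x)\<^sup>2 + (b t x)\<^sup>2) * pxx t x)"
    have "acd (-R) R (\<lambda>x. b t x * aT t x) h1"
      unfolding h1_def using t dx sl by (intro acd_mult[OF bx[OF t] _ M1] acd_deriv) auto
    then have h1: "(h1 has_integral 0) {-R..R}"
      using acd_has_integral[of "-R" R "\<lambda>x. b t x * aT t x" h1 "-R" R] RT bd t by auto
    have aa: "acd (-R) R (\<lambda>x. a t x * a t x) (\<lambda>x. ax t x * a t x + a t x * ax t x)"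
      using t dx sl by (intro acd_deriv) (auto intro!: continuous_intros derivative_eq_intros)
    have bb: "acd (-R) R (\<lambda>x. b t x * b t x) (\<lambda>x. bx t x * b t x + b t x * bx t x)"
      by (intro acd_mult[OF bx[OF t] bx[OF t] M])
    have "acd (-R) R (\<lambda>x. (a t x * a t x + b t x * b t x) * px t x)
        (\<lambda>x. (ax t x * a t x + a t x * ax t x + (bx t x * b t x + b t x * bx t x)) * px t x
           + (a t x * a t x + b t x * b t x) * pxx t x)"
      using t dx sl by (intro acd_mult[OF acd_add[OF aa bb] _ M2] acd_deriv) auto
    then have "((\<lambda>x. (ax t x * a t x + a t x * ax t x + (bx t x * b t x + b t x * bx t x)) * px t x
           + (a t x * a t x + b t x * b t x) * pxx t x) has_integral 0) {-R..R}"
      by (drule_tac x="-R" and y=R in acd_has_integral) (use RT bd t in auto)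
    then have h2: "(h2 has_integral 0) {-R..R}"
      by (rule has_integral_eq[rotated]) (simp add: h2_def power2_eq_square)
    have qi: "q t integrable_on {-R..R}" and Gi: "G t integrable_on {-R..R}" and mi: "m' t integrable_on {-R..R}"
      using t sl continuous_on_slice[OF cm'[unfolded D_def]] continuous_on_slice[OF cq[unfolded D_def]]
      by (auto intro!: integrable_continuous_real)
    have "((\<lambda>x. h1 x + q t x / 2 - h2 x / 2 - G t x / 4) has_integral
        (0 + integral {-R..R} (q t) / 2 - 0 / 2 - integral {-R..R} (G t) / 4)) {-R..R}"
      using h1 h2 qi Gi by (intro has_integral_diff has_integral_add has_integral_divide)
        (auto intro: integrable_integral)
    moreover have "h1 x + q t x / 2 - h2 x / 2 - G t x / 4 \<le> m' t x" if x: "x \<in> {-R..R}" for x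
    proof -
      have "m' t x = h1 x + q t x / 2 - h2 x / 2
        - ((ax t x - bT t x - px t x * a t x + pt t x * b t x)\<^sup>2 + (aT t x + bx t x - pt t x * a t x - px t x * b t x)\<^sup>2) / 4
        + ((ax t x + bT t x + px t x * a t x + pt t x * b t x)\<^sup>2 + (bx t x - aT t x + px t x * b t x - pt t x * a t x)\<^sup>2) / 4"
        unfolding m'_def h1_def h2_def q_def by (rule carleman_identity)
      moreover have "0 \<le> ((ax t x + bT t x + px t x * a t x + pt t x * b t x)\<^sup>2 + (bx t x - aT t x + px t x * b t x - pt t x * a t x)\<^sup>2) / 4"
        by simp
      moreover have "A - g / 4 \<le> r" if "r = A - X / 4 + Y / 4" "0 \<le> Y / 4" "X \<le> g" for A X Y g r :: real
        using that by linarith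
      ultimately show ?thesis using G[OF t x] by blast
    qed
    ultimately have "0 + integral {-R..R} (q t) / 2 - 0 / 2 - integral {-R..R} (G t) / 4 \<le> integral {-R..R} (m' t)"
      using mi by (intro has_integral_le[OF _ integrable_integral]) auto
    then show ?thesis by simp
  qed
  have FTC: "((\<lambda>t. integral {-R..R} (m' t)) has_integral (integral {-R..R} (m T) - integral {-R..R} (m 0))) {0..T}"
    using RT(2) M'[unfolded has_real_derivative_iff_has_vector_derivative]
    by (intro fundamental_theorem_of_calculus)
  have mT: "integral {-R..R} (m T) = 0"
    using bd by (intro integral_unique has_integral_is_0) (auto simp: m_def)
  have m0: "integral {-R..R} (m 0) = integral {-R..R} (\<lambda>x. pt 0 x * (a 0 x)\<^sup>2) / 2"
  proof -
    have "integral {-R..R} (m 0) = integral {-R..R} (\<lambda>x. pt 0 x * (a 0 x)\<^sup>2 / 2)"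
      using bd by (intro integral_cong) (auto simp: m_def)
    then show ?thesis by simp
  qed
  have cqi: "(\<lambda>t. integral {-R..R} (q t)) integrable_on {0..T}" and cGi: "(\<lambda>t. integral {-R..R} (G t)) integrable_on {0..T}"
    using integral_continuous_on_param[of "{0..T}" "-R" R q] cq integral_continuous_on_param[of "{0..T}" "-R" R G] cont(11)
    by (auto simp: D_def split_def intro!: integrable_continuous_real)
  have "integral {0..T} (\<lambda>t. integral {-R..R} (q t) / 2 - integral {-R..R} (G t) / 4) \<le> 0 - integral {-R..R} (m 0)"
  proof (rule has_integral_le[OF integrable_integral FTC[unfolded mT]])
    show "(\<lambda>t. integral {-R..R} (q t) / 2 - integral {-R..R} (G t) / 4) integrable_on {0..T}"
      using cqi cGi by (intro integrable_diff integrable_on_divide) auto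
  qed (use low in auto)
  also have "integral {0..T} (\<lambda>t. integral {-R..R} (q t) / 2 - integral {-R..R} (G t) / 4)
     = integral {0..T} (\<lambda>t. integral {-R..R} (q t)) / 2 - integral {0..T} (\<lambda>t. integral {-R..R} (G t)) / 4"
    using cqi cGi by (subst Henstock_Kurzweil_Integration.integral_diff) (auto intro!: integrable_on_divide)
  finally show ?thesis unfolding m0 q_def by simp
qed

section \<open>Logarithmic potentials\<close>

text \<open>The kernel \<open>g\<close> is a parameter so that the potential and all its derivatives
  are instances of one formula. The shift \<open>e\<close> lifts the evaluation point off the
  charge, which keeps every kernel continuous up to t = 0; dividing by the integral of
  \<open>h\<close> normalises the charge to 1.\<close>

definition log_potential ::
  "(real \<Rightarrow> real) \<Rightarrow> real \<Rightarrow> (real \<Rightarrow> real \<Rightarrow> real) \<Rightarrow> real \<Rightarrow> real \<Rightarrow> real" where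
  "log_potential h e g t x = integral {-1..1} (\<lambda>y. h y * g (t + e) (x - y)) / integral {-1..1} h"

text \<open>\<open>logk\<close> is log |X + i s| and the others are its derivatives. It is harmonic,
  so its second s-derivative is \<open>- logk_xx\<close> and gets no name; \<open>logk_s\<close> is
  pi times the Poisson kernel of the half plane.\<close>

definition "logk s X = ln (X\<^sup>2 + s\<^sup>2) / (2::real)"
definition "logk_x s X = X / (X\<^sup>2 + s\<^sup>2 :: real)"
definition "logk_s s X = s / (X\<^sup>2 + s\<^sup>2 :: real)"
definition "logk_xx s X = (s\<^sup>2 - X\<^sup>2) / (X\<^sup>2 + s\<^sup>2 :: real)\<^sup>2"
definition "logk_xs s X = - 2 * X * s / (X\<^sup>2 + s\<^sup>2 :: real)\<^sup>2"

lemma sq_sum_pos: "0 < s \<Longrightarrow> 0 < (X::real)\<^sup>2 + s\<^sup>2"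
  by (simp add: add_nonneg_pos)

lemma sq_sum_neq: "0 < s \<Longrightarrow> (X::real)\<^sup>2 + s\<^sup>2 \<noteq> 0"
  using sq_sum_pos[of s X] by simp

lemma logk_derivs:
  assumes "0 < s"
  shows "(logk s has_real_derivative logk_x s X) (at X)"
    "((\<lambda>s. logk s X) has_real_derivative logk_s s X) (at s)"
    "(logk_x s has_real_derivative logk_xx s X) (at X)"
    "((\<lambda>s. logk_x s X) has_real_derivative logk_xs s X) (at s)"
    "((\<lambda>s. logk_s s X) has_real_derivative - logk_xx s X) (at s)"
    "(logk_s s has_real_derivative logk_xs s X) (at X)"
proof -
  have minus_eq: "- logk_xx s X = (X\<^sup>2 - s\<^sup>2) / (X\<^sup>2 + s\<^sup>2)\<^sup>2"
    by (simp add: logk_xx_def minus_divide_left)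
  show "(logk s has_real_derivative logk_x s X) (at X)"
    "((\<lambda>s. logk s X) has_real_derivative logk_s s X) (at s)"
    "(logk_x s has_real_derivative logk_xx s X) (at X)"
    "((\<lambda>s. logk_x s X) has_real_derivative logk_xs s X) (at s)"
    "((\<lambda>s. logk_s s X) has_real_derivative - logk_xx s X) (at s)"
    "(logk_s s has_real_derivative logk_xs s X) (at X)"
    unfolding minus_eq unfolding logk_def logk_x_def logk_s_def logk_xx_def logk_xs_def
    using sq_sum_pos[OF assms, of X] sq_sum_neq[OF assms, of X]
    by (auto intro!: derivative_eq_intros simp: field_simps power2_eq_square)
qed

lemma logk_continuous:
  "continuous_on ({0<..} \<times> UNIV) (\<lambda>z. logk (fst z) (snd z))"
  "continuous_on ({0<..} \<times> UNIV) (\<lambda>z. logk_x (fst z) (snd z))"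
  "continuous_on ({0<..} \<times> UNIV) (\<lambda>z. logk_s (fst z) (snd z))"
  "continuous_on ({0<..} \<times> UNIV) (\<lambda>z. logk_xx (fst z) (snd z))"
  "continuous_on ({0<..} \<times> UNIV) (\<lambda>z. logk_xs (fst z) (snd z))"
  unfolding logk_def logk_x_def logk_s_def logk_xx_def logk_xs_def
  by (auto intro!: continuous_intros simp: sq_sum_neq sq_sum_pos)

section \<open>Continuity and derivatives of the regularised potential\<close>

context
  fixes h :: "real \<Rightarrow> real" and e :: real
  assumes h: "continuous_on {-1..1} h" and e: "0 < e"
begin

lemma log_potential_integrand_continuous:
  assumes "continuous_on ({0<..} \<times> UNIV) (\<lambda>z. g (fst z) (snd z))"
  shows "continuous_on (({0..} \<times> UNIV) \<times> {-1..1}) (\<lambda>w. h (snd w) * g (fst (fst w) + e) (snd (fst w) - snd w))"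
proof -
  have "continuous_on (({0..} \<times> UNIV) \<times> {-1..1::real}) (\<lambda>w. g (fst (fst w + (e, - snd w))) (snd (fst w + (e, - snd w))))"
    by (rule continuous_on_compose2[OF assms]) (use e in \<open>auto intro!: continuous_intros\<close>)
  moreover have "continuous_on (({0::real..} \<times> (UNIV::real set)) \<times> {-1..1}) (\<lambda>w. h (snd w))"
    by (rule continuous_on_compose2[OF h]) (auto intro!: continuous_intros)
  ultimately show ?thesis by (auto intro!: continuous_intros)
qed

lemma log_potential_continuous:
  assumes "continuous_on ({0<..} \<times> UNIV) (\<lambda>z. g (fst z) (snd z))"
  shows "continuous_on ({0..} \<times> UNIV) (\<lambda>z. log_potential h e g (fst z) (snd z))"
proof -
  have "continuous_on ({0..} \<times> UNIV) (\<lambda>z. integral (cbox (-1) 1) (\<lambda>y. h y * g (fst z + e) (snd z - y)))"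
    using log_potential_integrand_continuous[OF assms]
    by (intro integral_continuous_on_param) (simp add: split_def)
  then show ?thesis unfolding log_potential_def by (auto simp: divide_inverse intro!: continuous_intros)
qed

lemma log_potential_integrable:
  assumes "continuous_on ({0<..} \<times> UNIV) (\<lambda>z. g (fst z) (snd z))" "0 \<le> t"
  shows "(\<lambda>y. h y * g (t + e) (x - y)) integrable_on {-1..1}"
proof (rule integrable_continuous_real)
  have "continuous_on {-1..1} (\<lambda>y. h (snd ((t,x),y)) * g (fst (fst ((t,x),y)) + e) (snd (fst ((t,x),y)) - snd ((t,x),y)))"
    by (rule continuous_on_compose2[OF log_potential_integrand_continuous[OF assms(1)]])
      (use assms(2) in \<open>auto intro!: continuous_intros\<close>)
  then show "continuous_on {-1..1} (\<lambda>y. h y * g (t + e) (x - y))" by simp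
qed

lemma log_potential_deriv_x:
  assumes g: "continuous_on ({0<..} \<times> UNIV) (\<lambda>z. g (fst z) (snd z))"
    and g': "continuous_on ({0<..} \<times> UNIV) (\<lambda>z. g' (fst z) (snd z))"
    and der: "\<And>s X. 0 < s \<Longrightarrow> (g s has_real_derivative g' s X) (at X)" and t: "0 \<le> t"
  shows "(log_potential h e g t has_real_derivative log_potential h e g' t x) (at x)"
proof -
  have "((\<lambda>x. integral (cbox (-1) 1) (\<lambda>y. h y * g (t + e) (x - y))) has_field_derivative
      integral (cbox (-1) 1) (\<lambda>y. h y * g' (t + e) (x - y))) (at x within UNIV)"
  proof (rule leibniz_rule_field_derivative)
    show "((\<lambda>x. h y * g (t + e) (x - y)) has_real_derivative h y * g' (t + e) (x - y)) (at x within UNIV)" for x y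
    proof -
      have "((\<lambda>x. g (t + e) (x - y)) has_real_derivative g' (t + e) (x - y) * (1 - 0)) (at x)"
        by (rule DERIV_chain2[OF der]) (use e t in \<open>auto intro!: derivative_eq_intros\<close>)
      then show ?thesis by (simp add: DERIV_cmult)
    qed
    have "continuous_on (UNIV \<times> {-1..1}) (\<lambda>w. h (snd ((t, fst w), snd w)) *
        g' (fst (fst ((t, fst w), snd w)) + e) (snd (fst ((t, fst w), snd w)) - snd ((t, fst w), snd w)))"
      by (rule continuous_on_compose2[OF log_potential_integrand_continuous[OF g']])
        (use t in \<open>auto intro!: continuous_intros\<close>)
    then show "continuous_on (UNIV \<times> cbox (-1) 1) (\<lambda>(x, y). h y * g' (t + e) (x - y))"
      by (simp add: split_def)
  qed (use log_potential_integrable[OF g t] in auto)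
  then show ?thesis unfolding log_potential_def by (auto intro!: DERIV_cdivide)
qed

lemma log_potential_deriv_t:
  assumes g: "continuous_on ({0<..} \<times> UNIV) (\<lambda>z. g (fst z) (snd z))"
    and g': "continuous_on ({0<..} \<times> UNIV) (\<lambda>z. g' (fst z) (snd z))"
    and der: "\<And>s X. 0 < s \<Longrightarrow> ((\<lambda>s. g s X) has_real_derivative g' s X) (at s)" and t: "0 \<le> t"
  shows "((\<lambda>t. log_potential h e g t x) has_real_derivative log_potential h e g' t x) (at t within {0..})"
proof -
  have "((\<lambda>t. integral (cbox (-1) 1) (\<lambda>y. h y * g (t + e) (x - y))) has_field_derivative
      integral (cbox (-1) 1) (\<lambda>y. h y * g' (t + e) (x - y))) (at t within {0..})"
  proof (rule leibniz_rule_field_derivative)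
    show "((\<lambda>t. h y * g (t + e) (x - y)) has_real_derivative h y * g' (t + e) (x - y)) (at t within {0..})" 
      if "t \<in> {0..}" for t y
    proof -
      have "((\<lambda>t. g (t + e) (x - y)) has_real_derivative g' (t + e) (x - y) * (1 + 0)) (at t within {0..})"
        by (rule DERIV_chain2[OF der]) (use e that in \<open>auto intro!: derivative_eq_intros\<close>)
      then show ?thesis by (simp add: DERIV_cmult)
    qed
    have "continuous_on ({0..} \<times> {-1..1}) (\<lambda>w. h (snd ((fst w, x), snd w)) *
        g' (fst (fst ((fst w, x), snd w)) + e) (snd (fst ((fst w, x), snd w)) - snd ((fst w, x), snd w)))"
      by (rule continuous_on_compose2[OF log_potential_integrand_continuous[OF g']])
        (auto intro!: continuous_intros)
    then show "continuous_on ({0..} \<times> cbox (-1) 1) (\<lambda>(t, y). h y * g' (t + e) (x - y))"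
      by (simp add: split_def)
  qed (use log_potential_integrable[OF g] t in auto)
  then show ?thesis unfolding log_potential_def by (auto intro!: DERIV_cdivide)
qed

section \<open>Bounds for the potential\<close>

lemma log_potential_ge:
  assumes g: "continuous_on ({0<..} \<times> UNIV) (\<lambda>z. g (fst z) (snd z))" and t: "0 \<le> t"
    and N: "0 < integral {-1..1} h" and h0: "\<And>y. y \<in> {-1..1} \<Longrightarrow> 0 \<le> h y"
    and c: "\<And>y. y \<in> {-1..1} \<Longrightarrow> c \<le> g (t + e) (x - y)"
  shows "c \<le> log_potential h e g t x"
proof -
  have "integral {-1..1} (\<lambda>y. h y * c) \<le> integral {-1..1} (\<lambda>y. h y * g (t + e) (x - y))"
    using h0 c by (intro integral_le log_potential_integrable[OF g t])
      (auto intro!: integrable_continuous_real continuous_intros h mult_left_mono)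
  then show ?thesis using N by (simp add: log_potential_def field_simps)
qed

lemma log_potential_le:
  assumes g: "continuous_on ({0<..} \<times> UNIV) (\<lambda>z. g (fst z) (snd z))" and t: "0 \<le> t"
    and N: "0 < integral {-1..1} h" and h0: "\<And>y. y \<in> {-1..1} \<Longrightarrow> 0 \<le> h y"
    and c: "\<And>y. y \<in> {-1..1} \<Longrightarrow> g (t + e) (x - y) \<le> c"
  shows "log_potential h e g t x \<le> c"
proof -
  have "integral {-1..1} (\<lambda>y. h y * g (t + e) (x - y)) \<le> integral {-1..1} (\<lambda>y. h y * c)"
    using h0 c by (intro integral_le log_potential_integrable[OF g t])
      (auto intro!: integrable_continuous_real continuous_intros h mult_left_mono)
  then show ?thesis using N by (simp add: log_potential_def field_simps)
qed

lemma log_potential_mono_t: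
  assumes N: "0 < integral {-1..1} h" and h0: "\<And>y. y \<in> {-1..1} \<Longrightarrow> 0 \<le> h y"
    and st: "0 \<le> s" "s \<le> t"
  shows "log_potential h e logk s x \<le> log_potential h e logk t x"
proof -
  have "logk (s + e) (x - y) \<le> logk (t + e) (x - y)" for y
    unfolding logk_def using st e sq_sum_pos[of "s+e" "x-y"]
    by (intro divide_right_mono ln_mono add_left_mono power_mono) auto
  then have "integral {-1..1} (\<lambda>y. h y * logk (s + e) (x - y)) \<le> integral {-1..1} (\<lambda>y. h y * logk (t + e) (x - y))"
    using h0 st by (intro integral_le log_potential_integrable logk_continuous) (auto intro!: mult_left_mono)
  then show ?thesis using N by (simp add: log_potential_def divide_right_mono)
qed

text \<open>The charge lies in [-1,1]; wherever |x| >= 8 or t >= 8 the distance to it is at least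
  7.\<close>

lemma log_potential_far:
  assumes N: "0 < integral {-1..1} h" and h0: "\<And>y. y \<in> {-1..1} \<Longrightarrow> 0 \<le> h y"
    and t: "0 \<le> t" and far: "8 \<le> \<bar>x\<bar> \<or> 8 \<le> t"
  shows "ln 7 \<le> log_potential h e logk t x"
proof (rule log_potential_ge[OF logk_continuous(1) t N h0])
  fix y :: real assume y: "y \<in> {-1..1}"
  have "7\<^sup>2 \<le> (x - y)\<^sup>2 + (t + e)\<^sup>2"
  proof (cases "8 \<le> t")
    case True
    then have "7\<^sup>2 \<le> (t + e)\<^sup>2" using e by (intro power_mono) auto
    then show ?thesis using zero_le_power2[of "x - y"] by linarith
  next
    case False
    then have "7 \<le> \<bar>x - y\<bar>" using far y by auto
    then have "7\<^sup>2 \<le> \<bar>x - y\<bar>\<^sup>2" by (intro power_mono) auto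
    then show ?thesis using zero_le_power2[of "t + e"] unfolding power2_abs by linarith
  qed
  then have "ln (7\<^sup>2) \<le> ln ((x - y)\<^sup>2 + (t + e)\<^sup>2)" by (intro ln_mono) auto
  moreover have "ln ((7::real)\<^sup>2) = 2 * ln 7" by (subst ln_realpow) auto
  ultimately show "ln 7 \<le> logk (t + e) (x - y)" unfolding logk_def by linarith
qed

text \<open>Horizontal distances are at most 2 and the shift is at most 1, so the distance to the
  charge is at most sqrt 5. The gap between sqrt 5 and 7 is the source of the gain (5/49)^m.\<close>

lemma log_potential_near:
  assumes N: "0 < integral {-1..1} h" and h0: "\<And>y. y \<in> {-1..1} \<Longrightarrow> 0 \<le> h y"
    and x: "\<bar>x\<bar> \<le> 1" and e1: "e \<le> 1"
  shows "log_potential h e logk 0 x \<le> ln 5 / 2"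
proof (rule log_potential_le[OF logk_continuous(1) order_refl N h0])
  fix y :: real assume y: "y \<in> {-1..1}"
  have "\<bar>x - y\<bar>\<^sup>2 \<le> 2\<^sup>2" using x y by (intro power_mono) auto
  moreover have "e\<^sup>2 \<le> 1\<^sup>2" using e e1 by (intro power_mono) auto
  ultimately have "(x - y)\<^sup>2 + e\<^sup>2 \<le> 5" by simp
  then have "ln ((x - y)\<^sup>2 + e\<^sup>2) \<le> ln 5" using sq_sum_pos[OF e, of "x - y"] by (intro ln_mono) auto
  then show "logk (0 + e) (x - y) \<le> ln 5 / 2" by (simp add: logk_def)
qed

text \<open>Replacing \<^term>\<open>h\<close> by the indicator of the interval of radius \<open>N = \<integral>h\<close> around \<^term>\<open>x\<close>
  only decreases the potential, up to the error caused by the shift \<^term>\<open>e\<close>.\<close>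

lemma log_potential_axis:
  assumes h1: "\<And>y. y \<in> {-1..1} \<Longrightarrow> 0 \<le> h y \<and> h y \<le> 1"
    and eN: "e \<le> integral {-1..1} h"
  shows "ln (integral {-1..1} h) - 3 \<le> log_potential h e logk 0 x"
proof -
  define N where "N = integral {-1..1} h"
  have N: "0 < N" "e \<le> N" using e eN by (auto simp: N_def)
  \<comment> \<open>Outside the interval of radius \<open>N\<close> about \<open>x\<close> this is
    at most 0. Since \<open>e\<close> is at most \<open>N\<close>, it is at least -(ln 2)/2 inside,
    so z + 1/2 is nonnegative there and bounds h z from above. \<open>A\<close> is an antiderivative
    of z + 1/2, and the bound 3 N below is 2 (N/2 + N).\<close>
  define z where "z = (\<lambda>y. ln N - logk e (x - y))"
  define A where "A = (\<lambda>y. (y - x) * (ln N + 1/2) - ((y - x) * (ln ((y - x)\<^sup>2 + e\<^sup>2) / 2) - (y - x) + e * arctan ((y - x) / e)))"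
  have "(A has_real_derivative z y + 1/2) (at y)" for y
  proof -
    have p: "(y - x)\<^sup>2 + e\<^sup>2 > 0" using sq_sum_pos[OF e] .
    define D where "D = (y - x)\<^sup>2 + e\<^sup>2"
    have d1: "((\<lambda>y. y - x) has_real_derivative 1) (at y)" by (auto intro!: derivative_eq_intros)
    have d2: "((\<lambda>y. ln ((y - x)\<^sup>2 + e\<^sup>2) / 2) has_real_derivative (y - x) / D) (at y)"
      using DERIV_chain2[OF logk_derivs(1)[OF e] d1] by (simp add: logk_def logk_x_def D_def)
    have "((\<lambda>y. e * arctan ((y - x) / e)) has_real_derivative e * (inverse (1 + ((y - x) / e)\<^sup>2) * (1 / e))) (at y)"
      by (intro DERIV_cmult DERIV_chain2[OF DERIV_arctan] DERIV_cdivide d1)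
    moreover have "e * (inverse (1 + ((y - x) / e)\<^sup>2) * (1 / e)) = e\<^sup>2 / D"
      using e p by (simp add: D_def field_simps power2_eq_square)
    ultimately have d3: "((\<lambda>y. e * arctan ((y - x) / e)) has_real_derivative e\<^sup>2 / D) (at y)" by simp
    have "(A has_real_derivative 1 * (ln N + 1/2) -
        (((1 * (ln ((y - x)\<^sup>2 + e\<^sup>2) / 2) + (y - x) / D * (y - x)) - 1) + e\<^sup>2 / D)) (at y)"
      unfolding A_def by (intro DERIV_diff DERIV_add DERIV_mult DERIV_cmult_right d1 d2 d3)
    moreover have "(y - x) / D * (y - x) + e\<^sup>2 / D = 1"
    proof -
      have "(y - x) / D * (y - x) + e\<^sup>2 / D = ((y - x)\<^sup>2 + e\<^sup>2) / D" by (simp add: add_divide_distrib power2_eq_square)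
      then show ?thesis using p e by (simp add: D_def)
    qed
    moreover have "z y + 1/2 = 1 * (ln N + 1/2) - (1 * (ln ((y - x)\<^sup>2 + e\<^sup>2) / 2))"
      by (simp add: z_def logk_def power2_commute[of x y])
    ultimately show ?thesis by (smt (verit))
  qed
  then have A: "((\<lambda>y. z y + 1/2) has_integral (A (x + N) - A (x - N))) {x - N..x + N}"
    using N by (intro fundamental_theorem_of_calculus)
      (auto simp: has_real_derivative_iff_has_vector_derivative[symmetric] intro: has_field_derivative_at_within)
  have "A (x + N) - A (x - N) = 2 * (N * (ln N + 1/2) - N * (ln (N\<^sup>2 + e\<^sup>2) / 2) + N - e * arctan (N / e))"
    by (simp add: A_def arctan_minus algebra_simps)
  also have "\<dots> \<le> 3 * N"
  proof -
    have "ln (N\<^sup>2) \<le> ln (N\<^sup>2 + e\<^sup>2)" using N by (intro ln_mono) auto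
    then have "N * ln N \<le> N * (ln (N\<^sup>2 + e\<^sup>2) / 2)" using N by (intro mult_left_mono) (auto simp: ln_realpow)
    moreover have "0 \<le> e * arctan (N / e)" using N e by auto
    ultimately show ?thesis by (simp add: algebra_simps)
  qed
  finally have Ale: "A (x + N) - A (x - N) \<le> 3 * N" .
  have hz: "(\<lambda>y. h y * z y) integrable_on {-1..1}"
  proof -
    have "(\<lambda>y. h y * logk (0 + e) (x - y)) integrable_on {-1..1}"
      by (intro log_potential_integrable logk_continuous) auto
    moreover have "(\<lambda>y. h y * ln N) integrable_on {-1..1}"
      by (intro integrable_continuous_real continuous_intros h)
    ultimately show ?thesis unfolding z_def by (auto simp: right_diff_distrib intro!: integrable_diff)
  qed
  have "integral {-1..1} (\<lambda>y. h y * z y) \<le> A (x + N) - A (x - N)"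
  proof (rule has_integral_le)
    show "((\<lambda>y. if y \<in> {-1..1} then h y * z y else 0) has_integral integral {-1..1} (\<lambda>y. h y * z y)) UNIV"
      using hz by (simp only: has_integral_restrict_UNIV) (rule integrable_integral)
    show "((\<lambda>y. if y \<in> {x - N..x + N} then z y + 1/2 else 0) has_integral (A (x + N) - A (x - N))) UNIV"
      using A by (simp only: has_integral_restrict_UNIV)
    fix y
    show "(if y \<in> {-1..1} then h y * z y else 0) \<le> (if y \<in> {x - N..x + N} then z y + 1/2 else 0)"
    proof (cases "y \<in> {x - N..x + N}")
      case True
      have "\<bar>x - y\<bar> \<le> N" using True by auto
      then have "(x - y)\<^sup>2 \<le> N\<^sup>2" "e\<^sup>2 \<le> N\<^sup>2" using N e by (auto simp: abs_le_square_iff[symmetric])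
      then have "(x - y)\<^sup>2 + e\<^sup>2 \<le> 2 * N\<^sup>2" by simp
      then have "ln ((x - y)\<^sup>2 + e\<^sup>2) \<le> ln (2 * N\<^sup>2)" using sq_sum_pos[OF e, of "x - y"] by (intro ln_mono) auto
      also have "\<dots> = ln 2 + 2 * ln N" using N by (simp add: ln_mult ln_realpow)
      also have "ln 2 \<le> (1::real)" using ln_le_minus_one[of "2::real"] by simp
      finally have z0: "0 \<le> z y + 1/2" by (simp add: z_def logk_def)
      have "h y * z y \<le> z y + 1/2" if y: "y \<in> {-1..1}"
      proof (cases "0 \<le> z y")
        case True
        then have "h y * z y \<le> 1 * z y" using h1[OF y] by (intro mult_right_mono) auto
        then show ?thesis by simp
      next
        case False
        then have "h y * z y \<le> 0" using h1[OF y] by (simp add: mult_nonneg_nonpos)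
        then show ?thesis using z0 by simp
      qed
      then show ?thesis using True z0 by simp
    next
      case False
      then have "N \<le> \<bar>x - y\<bar>" by auto
      then have "N\<^sup>2 \<le> \<bar>x - y\<bar>\<^sup>2" using N by (intro power_mono) auto
      then have "N\<^sup>2 \<le> (x - y)\<^sup>2 + e\<^sup>2" using zero_le_power2[of e] unfolding power2_abs by linarith
      then have "ln (N\<^sup>2) \<le> ln ((x - y)\<^sup>2 + e\<^sup>2)" using N by (intro ln_mono) auto
      then have "z y \<le> 0" using N by (simp add: z_def logk_def ln_realpow)
      then show ?thesis using False h1 by (auto simp: mult_nonneg_nonpos)
    qed
  qed
  also note Ale
  finally have "integral {-1..1} (\<lambda>y. h y * z y) \<le> 3 * N" .
  moreover have "integral {-1..1} (\<lambda>y. h y * z y) = N * ln N - integral {-1..1} (\<lambda>y. h y * logk (0 + e) (x - y))"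
  proof -
    have "integral {-1..1} (\<lambda>y. h y * ln N - h y * logk (0 + e) (x - y))
      = integral {-1..1} (\<lambda>y. h y * ln N) - integral {-1..1} (\<lambda>y. h y * logk (0 + e) (x - y))"
      by (intro Henstock_Kurzweil_Integration.integral_diff log_potential_integrable logk_continuous
          integrable_continuous_real continuous_intros h) auto
    then show ?thesis by (simp add: z_def right_diff_distrib N_def)
  qed
  ultimately have "N * (ln N - 3) \<le> integral {-1..1} (\<lambda>y. h y * logk (0 + e) (x - y))"
    by (simp add: algebra_simps)
  then show ?thesis using N unfolding log_potential_def N_def[symmetric] by (simp add: field_simps)
qed

end

text \<open>As \<open>e\<close> tends to 0, \<open>logk_s e\<close> is pi times an approximate
  identity. After interchanging the integrals, for fixed y it acts on \<open>q\<close>, whose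
  uniform continuity makes the error uniform in y; an upper bound with slack \<open>w\<close>
  suffices.\<close>

lemma log_potential_normal_derivative_limit:
  fixes q :: "real \<Rightarrow> real"
  assumes h: "continuous_on {-1..1} h" and h1: "\<And>y. y \<in> {-1..1} \<Longrightarrow> 0 \<le> h y \<and> h y \<le> 1"
    and N: "0 < integral {-1..1} h"
    and q: "continuous_on {-9..9} q" and q0: "\<And>x. x \<in> {-9..9} \<Longrightarrow> 0 \<le> q x" and w: "0 < w"
  shows "\<exists>e0>0. \<forall>e. 0 < e \<and> e \<le> e0 \<longrightarrow>
    integral {-9..9} (\<lambda>x. log_potential h e logk_s 0 x * q x)
      \<le> (pi * integral {-1..1} (\<lambda>y. h y * q y) + w) / integral {-1..1} h"
proof -
  have "bounded (q ` {-9..9})" using q by (intro compact_imp_bounded compact_continuous_image) auto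
  then obtain Q where Q: "0 < Q" "\<And>x. x \<in> {-9..9} \<Longrightarrow> \<bar>q x\<bar> \<le> Q" 
    by (metis bounded_pos image_eqI real_norm_def)
  define w1 where "w1 = w / (4 * pi)"
  have w1: "0 < w1" using w by (simp add: w1_def)
  have "uniformly_continuous_on {-9..9} q" using q by (intro compact_uniformly_continuous) auto
  then obtain d where d: "0 < d" "\<And>x y. x \<in> {-9..9} \<Longrightarrow> y \<in> {-9..9} \<Longrightarrow> \<bar>x - y\<bar> < d \<Longrightarrow> \<bar>q x - q y\<bar> < w1"
    unfolding uniformly_continuous_on_def dist_real_def using w1 by blast
  \<comment> \<open>At distance at least \<open>d\<close> the kernel is at most e/d^2; the error 2 Q
    e/d^2 over length 18 is then w/4 for e = e0. Near y the oscillation \<open>w1\<close> costs pi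
    w1 = w/4. Together this is w/2, and integration over [-1,1] gives \<open>w\<close>.\<close>
  define e0 where "e0 = w * d\<^sup>2 / (144 * Q)"
  have e0: "0 < e0" using w d Q by (simp add: e0_def)
  show ?thesis
  proof (intro exI[of _ e0] conjI e0 allI impI, elim conjE)
    fix e assume e: "0 < e" "e \<le> e0"
    define k where "k = (\<lambda>x y. logk_s e (x - y))"
    have k0: "0 \<le> k x y" for x y using e sq_sum_pos[of e "x - y"] by (simp add: k_def logk_s_def)
    have kc: "continuous_on UNIV (\<lambda>z. k (fst z) (snd z))"
      unfolding k_def logk_s_def using sq_sum_neq[OF e(1)] by (auto intro!: continuous_intros)
    have kc1: "continuous_on S (\<lambda>x. k x y)" for S y
      unfolding k_def logk_s_def using sq_sum_neq[OF e(1)] by (auto intro!: continuous_intros)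
    have ki: "integral {-9..9} (\<lambda>x. k x y) \<le> pi" for y
    proof -
      have "((\<lambda>x. k x y) has_integral (arctan ((9 - y) / e) - arctan ((-9 - y) / e))) {-9..9}"
      proof (rule fundamental_theorem_of_calculus)
        fix x
        have "((\<lambda>x. arctan ((x - y) / e)) has_real_derivative (1 / e) / (1 + ((x - y) / e)\<^sup>2)) (at x within {-9..9})"
          using e by (auto intro!: derivative_eq_intros simp: field_simps)
        moreover have "(1 / e) / (1 + ((x - y) / e)\<^sup>2) = k x y"
          using e sq_sum_neq[OF e(1), of "x - y"] by (simp add: k_def logk_s_def field_simps power2_eq_square)
        ultimately show "((\<lambda>x. arctan ((x - y) / e)) has_vector_derivative k x y) (at x within {-9..9})"
          by (simp add: has_real_derivative_iff_has_vector_derivative)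
      qed auto
      then have "integral {-9..9} (\<lambda>x. k x y) = arctan ((9 - y) / e) - arctan ((-9 - y) / e)"
        by (rule integral_unique)
      then show ?thesis using arctan_bounded[of "(9 - y) / e"] arctan_bounded[of "(-9 - y) / e"] by linarith
    qed
    have inner: "integral {-9..9} (\<lambda>x. q x * k x y) \<le> pi * q y + w / 2" if y: "y \<in> {-1..1}" for y
    proof -
      have qy: "0 \<le> q y + w1" using q0[of y] y w1 by auto
      have "integral {-9..9} (\<lambda>x. q x * k x y) \<le> integral {-9..9} (\<lambda>x. (q y + w1) * k x y + 2 * Q * e / d\<^sup>2)"
      proof (rule integral_le)
        fix x :: real assume x: "x \<in> {-9..9}"
        show "q x * k x y \<le> (q y + w1) * k x y + 2 * Q * e / d\<^sup>2"
        proof (cases "\<bar>x - y\<bar> < d")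
          case True
          then have "q x \<le> q y + w1" using d(2)[OF x _ True] y by auto
          then have "q x * k x y \<le> (q y + w1) * k x y" using k0 by (intro mult_right_mono)
          then show ?thesis using Q e by (smt (verit) divide_nonneg_nonneg mult_nonneg_nonneg zero_le_power2)
        next
          case False
          then have "d\<^sup>2 \<le> \<bar>x - y\<bar>\<^sup>2" using d by (intro power_mono) auto
          then have "d\<^sup>2 \<le> (x - y)\<^sup>2 + e\<^sup>2" using zero_le_power2[of e] unfolding power2_abs by linarith
          then have "k x y \<le> e / d\<^sup>2" unfolding k_def logk_s_def using e d sq_sum_pos[OF e(1)] by (intro divide_left_mono) auto
          then have "q x * k x y \<le> Q * (e / d\<^sup>2)" using Q(2)[OF x] k0[of x y] Q(1) by (intro mult_mono) auto
          moreover have "0 \<le> (q y + w1) * k x y" using qy k0 by simp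
          moreover have "0 \<le> Q * (e / d\<^sup>2)" using Q e by simp
          ultimately show ?thesis by simp
        qed
      qed (auto intro!: integrable_continuous_real continuous_intros q kc1)
      also have "\<dots> = (q y + w1) * integral {-9..9} (\<lambda>x. k x y) + 36 * Q * e / d\<^sup>2"
      proof -
        have "((\<lambda>x. (q y + w1) * k x y + 2 * Q * e / d\<^sup>2) has_integral
          ((q y + w1) * integral {-9..9} (\<lambda>x. k x y) + (9 - (-9)) *\<^sub>R (2 * Q * e / d\<^sup>2))) {-9..9}"
          by (intro has_integral_add has_integral_mult_right integrable_integral integrable_continuous_real kc1
              has_integral_const_real[of "2 * Q * e / d\<^sup>2" "-9" "9::real", simplified]) (use has_integral_const_real[of "2 * Q * e / d\<^sup>2" "-9" "9::real"] in simp)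
        then show ?thesis by (simp add: integral_unique)
      qed
      also have "\<dots> \<le> (q y + w1) * pi + w / 4"
      proof (rule add_mono)
        show "(q y + w1) * integral {-9..9} (\<lambda>x. k x y) \<le> (q y + w1) * pi" using qy ki by (intro mult_left_mono)
        have "36 * Q * e \<le> 36 * Q * e0" using e Q by (intro mult_left_mono) auto
        also have "\<dots> = w / 4 * d\<^sup>2" using Q by (simp add: e0_def)
        finally show "36 * Q * e / d\<^sup>2 \<le> w / 4" using d by (simp add: field_simps)
      qed
      also have "\<dots> = pi * q y + w / 2" by (simp add: w1_def field_simps)
      finally show ?thesis .
    qed
    show "integral {-9..9} (\<lambda>x. log_potential h e logk_s 0 x * q x)
      \<le> (pi * integral {-1..1} (\<lambda>y. h y * q y) + w) / integral {-1..1} h"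
    proof -
      have qc: "continuous_on {-1..1} q" using q by (rule continuous_on_subset) auto
      have box: "cbox (-9, -1) (9, 1) = {-9..9::real} \<times> {-1..1::real}" by (simp add: cbox_Pair_eq)
      have cont: "continuous_on ({-9..9} \<times> {-1..1}) (\<lambda>z. h (snd z) * k (fst z) (snd z) * q (fst z))"
      proof -
        have "continuous_on ({-9..9::real} \<times> {-1..1}) (\<lambda>z. h (snd z))"
          by (rule continuous_on_compose2[OF h]) (auto intro!: continuous_intros)
        moreover have "continuous_on ({-9..9} \<times> {-1..1::real}) (\<lambda>z. q (fst z))"
          by (rule continuous_on_compose2[OF q]) (auto intro!: continuous_intros)
        ultimately show ?thesis using continuous_on_subset[OF kc] by (intro continuous_intros) auto
      qed
      have innerc: "continuous_on {-1..1} (\<lambda>y. integral {-9..9} (\<lambda>x. h y * k x y * q x))"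
      proof -
        have "continuous_on ({-1..1} \<times> {-9..9}) (\<lambda>w. h (snd (snd w, fst w)) * k (fst (snd w, fst w)) (snd (snd w, fst w)) * q (fst (snd w, fst w)))"
          by (rule continuous_on_compose2[OF cont]) (auto intro!: continuous_intros)
        then have "continuous_on {-1..1} (\<lambda>y. integral (cbox (-9) 9) (\<lambda>x. h y * k x y * q x))"
          by (intro integral_continuous_on_param) (simp add: split_def)
        then show ?thesis by simp
      qed
      have "integral {-9..9} (\<lambda>x. log_potential h e logk_s 0 x * q x)
        = integral {-9..9} (\<lambda>x. integral {-1..1} (\<lambda>y. h y * k x y * q x)) / integral {-1..1} h"
        by (simp add: log_potential_def k_def flip: integral_mult_left integral_divide)
      also have "integral {-9..9} (\<lambda>x. integral {-1..1} (\<lambda>y. h y * k x y * q x))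
        = integral {-1..1} (\<lambda>y. integral {-9..9} (\<lambda>x. h y * k x y * q x))"
        using integral_swap_continuous[of "-9::real" "-1::real" 9 1 "\<lambda>x y. h y * k x y * q x"] cont
        by (simp add: box split_def)
      also have "\<dots> \<le> integral {-1..1} (\<lambda>y. pi * (h y * q y) + w / 2)"
      proof (rule integral_le)
        show "(\<lambda>y. integral {-9..9} (\<lambda>x. h y * k x y * q x)) integrable_on {-1..1}"
          by (intro integrable_continuous_real innerc)
        show "(\<lambda>y. pi * (h y * q y) + w / 2) integrable_on {-1..1}"
          by (intro integrable_continuous_real continuous_intros h qc)
        fix y :: real assume y: "y \<in> {-1..1}"
        have "integral {-9..9} (\<lambda>x. h y * k x y * q x) = h y * integral {-9..9} (\<lambda>x. q x * k x y)"
          by (simp add: mult_ac flip: integral_mult_right)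
        also have "\<dots> \<le> h y * (pi * q y + w / 2)" using inner[OF y] h1[OF y] by (intro mult_left_mono) auto
        also have "\<dots> \<le> pi * (h y * q y) + w / 2"
          using h1[OF y] w by (simp add: algebra_simps)
        finally show "integral {-9..9} (\<lambda>x. h y * k x y * q x) \<le> pi * (h y * q y) + w / 2" .
      qed
      also have "\<dots> = pi * integral {-1..1} (\<lambda>y. h y * q y) + w"
      proof -
        have "((\<lambda>y. pi * (h y * q y) + w / 2) has_integral (pi * integral {-1..1} (\<lambda>y. h y * q y) + w)) {-1..1}"
          by (intro has_integral_add has_integral_mult_right integrable_integral integrable_continuous_real
              continuous_intros h qc) (use has_integral_const_real[of "w/2" "-1" "1::real"] in simp)
        then show ?thesis by (rule integral_unique)
      qed
      finally show ?thesis using N by (simp add: divide_right_mono)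
    qed
  qed
qed

section \<open>The local Remez-type inequality\<close>

lemma max0_square_deriv: "((\<lambda>y. (max 0 y)\<^sup>2) has_real_derivative 2 * max 0 y) (at (y::real))"
proof (cases y "0::real" rule: linorder_cases)
  case less
  have "((\<lambda>y. 0) has_real_derivative 2 * max 0 y) (at y)" using less by simp
  then show ?thesis
    by (rule has_field_derivative_transform_within_open[of _ _ _ "{..<0}"]) (use less in auto)
next
  case greater
  have "((\<lambda>y. y\<^sup>2) has_real_derivative 2 * max 0 y) (at y)" using greater by (auto intro!: derivative_eq_intros)
  then show ?thesis
    by (rule has_field_derivative_transform_within_open[of _ _ _ "{0<..}"]) (use greater in auto)
next
  case equal
  have "((\<lambda>y. ((max 0 y)\<^sup>2 - (max 0 0)\<^sup>2) / (y - 0)) \<longlongrightarrow> 0) (at (0::real))"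
  proof (rule Lim_null_comparison)
    show "\<forall>\<^sub>F y in at (0::real). norm (((max 0 y)\<^sup>2 - (max 0 0)\<^sup>2) / (y - 0)) \<le> \<bar>y\<bar>"
      by (auto simp: eventually_at_filter max_def power2_eq_square)
    show "((\<lambda>y. \<bar>y\<bar>) \<longlongrightarrow> 0) (at (0::real))"
      by (auto intro!: tendsto_eq_intros)
  qed
  then show ?thesis using equal by (simp add: has_field_derivative_iff)
qed

text \<open>Piecewise polynomial building block of a cutoff equal to 1 for |s| <= 8 and 0 for |s| >=
  9. The cutoff is C^1, which is enough because the mixed derivative of cutoff t times cutoff x
  involves only first derivatives of each factor.\<close>

definition cutoff_excess :: "real \<Rightarrow> real" where "cutoff_excess s = (max 0 (s - 8))\<^sup>2 + (max 0 (- s - 8))\<^sup>2"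
definition cutoff_excess' :: "real \<Rightarrow> real" where "cutoff_excess' s = 2 * max 0 (s - 8) - 2 * max 0 (- s - 8)"
definition cutoff :: "real \<Rightarrow> real" where "cutoff s = (max 0 (1 - cutoff_excess s))\<^sup>2"
definition cutoff' :: "real \<Rightarrow> real" where "cutoff' s = - 2 * max 0 (1 - cutoff_excess s) * cutoff_excess' s"

lemma cutoff_deriv: "(cutoff has_real_derivative cutoff' s) (at s)"
proof -
  have d1: "((\<lambda>s. (max 0 (s - 8))\<^sup>2) has_real_derivative 2 * max 0 (s - 8) * (1 - 0)) (at s)"
    by (rule DERIV_chain2[OF max0_square_deriv]) (auto intro!: derivative_eq_intros)
  have d2: "((\<lambda>s. (max 0 (- s - 8))\<^sup>2) has_real_derivative 2 * max 0 (- s - 8) * (- 1 - 0)) (at s)"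
    by (rule DERIV_chain2[OF max0_square_deriv]) (auto intro!: derivative_eq_intros)
  have "(cutoff_excess has_real_derivative cutoff_excess' s) (at s)"
    using DERIV_add[OF d1 d2] unfolding cutoff_excess_def cutoff_excess'_def by simp
  then have "((\<lambda>s. 1 - cutoff_excess s) has_real_derivative 0 - cutoff_excess' s) (at s)"
    by (intro DERIV_diff DERIV_const)
  from DERIV_chain2[OF max0_square_deriv this]
  have "((\<lambda>s. (max 0 (1 - cutoff_excess s))\<^sup>2) has_real_derivative cutoff' s) (at s)"
    by (simp add: cutoff'_def mult_ac)
  then show ?thesis by (simp add: cutoff_def[abs_def])
qed

lemma cutoff'_continuous: "continuous_on S cutoff'"
  unfolding cutoff'_def cutoff_excess_def cutoff_excess'_def by (intro continuous_intros)

lemma cutoff_continuous: "continuous_on S cutoff"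
  unfolding cutoff_def cutoff_excess_def by (intro continuous_intros)

lemma cutoff_nonneg: "0 \<le> cutoff s" by (simp add: cutoff_def)

lemma cutoff_le_1: "cutoff s \<le> 1"
proof -
  have "0 \<le> cutoff_excess s" by (simp add: cutoff_excess_def)
  then have "(max 0 (1 - cutoff_excess s))\<^sup>2 \<le> 1\<^sup>2" by (intro power_mono) auto
  then show ?thesis by (simp add: cutoff_def)
qed

lemma cutoff_eq_1: "\<bar>s\<bar> \<le> 8 \<Longrightarrow> cutoff s = 1"
  by (simp add: cutoff_def cutoff_excess_def max_absorb1)

lemma cutoff'_eq_0: "\<bar>s\<bar> \<le> 8 \<Longrightarrow> cutoff' s = 0"
  by (simp add: cutoff'_def cutoff_excess'_def max_absorb1)

lemma cutoff_boundary: "cutoff 9 = 0" "cutoff (-9) = 0"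
  by (simp_all add: cutoff_def cutoff_excess_def)

lemma cutoff_antimono: "0 \<le> s \<Longrightarrow> s \<le> t \<Longrightarrow> cutoff t \<le> cutoff s"
proof -
  assume "0 \<le> s" "s \<le> t"
  then have "cutoff_excess s \<le> cutoff_excess t"
    unfolding cutoff_excess_def by (intro add_mono power_mono) auto
  then show ?thesis unfolding cutoff_def by (intro power_mono) auto
qed

lemma cutoff'_bound: "(cutoff' s)\<^sup>2 \<le> 16"
proof (cases "\<bar>s\<bar> \<le> 9")
  case True
  have "\<bar>cutoff_excess' s\<bar> \<le> 2" using True by (auto simp: cutoff_excess'_def max_def)
  moreover have "\<bar>max 0 (1 - cutoff_excess s)\<bar> \<le> 1" by (auto simp: cutoff_excess_def max_def)
  ultimately have "\<bar>max 0 (1 - cutoff_excess s)\<bar> * \<bar>cutoff_excess' s\<bar> \<le> 1 * 2" by (intro mult_mono) auto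
  then have "\<bar>cutoff' s\<bar> \<le> 4" by (simp add: cutoff'_def abs_mult mult.commute)
  then have "\<bar>cutoff' s\<bar>\<^sup>2 \<le> 4\<^sup>2" by (intro power_mono) auto
  then show ?thesis by simp
next
  case False
  then consider "1 \<le> max 0 (s - 8)" | "1 \<le> max 0 (- s - 8)" by fastforce
  then have "1 \<le> cutoff_excess s"
    unfolding cutoff_excess_def by cases (auto intro: add_increasing add_increasing2 one_le_power)
  then show ?thesis by (simp add: cutoff'_def)
qed

section \<open>Inequalities for squares and iterated integrals\<close>

lemma square_add_le: "(X::real)\<^sup>2 + (Y + W)\<^sup>2 \<le> 2 * (X\<^sup>2 + Y\<^sup>2) + 2 * W\<^sup>2"
proof -
  have "(Y + W)\<^sup>2 \<le> 2 * Y\<^sup>2 + 2 * W\<^sup>2" using sum_squares_bound[of Y W] by (simp add: power2_sum)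
  moreover have "X\<^sup>2 \<le> 2 * X\<^sup>2" by simp
  ultimately show ?thesis unfolding distrib_left by linarith
qed

lemma integral_Cauchy_Schwarz_interval:
  fixes f :: "real \<Rightarrow> real"
  assumes "continuous_on {0..T} f" "0 < T"
  shows "(integral {0..T} f)\<^sup>2 \<le> T * integral {0..T} (\<lambda>s. (f s)\<^sup>2)"
proof -
  define c where "c = integral {0..T} f / T"
  have "((\<lambda>s. (f s)\<^sup>2 - 2 * c * f s + c\<^sup>2) has_integral
      (integral {0..T} (\<lambda>s. (f s)\<^sup>2) - 2 * c * integral {0..T} f + T * c\<^sup>2)) {0..T}"
    using assms has_integral_const_real[of "c\<^sup>2" 0 T]
    by (intro has_integral_add has_integral_diff has_integral_mult_right integrable_integral
        integrable_continuous_real continuous_intros) auto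
  then have "0 \<le> integral {0..T} (\<lambda>s. (f s)\<^sup>2) - 2 * c * integral {0..T} f + T * c\<^sup>2"
  proof (rule has_integral_nonneg)
    fix s
    have "0 \<le> (f s - c)\<^sup>2" by simp
    then show "0 \<le> (f s)\<^sup>2 - 2 * c * f s + c\<^sup>2" by (simp add: power2_eq_square algebra_simps)
  qed
  also have "\<dots> = integral {0..T} (\<lambda>s. (f s)\<^sup>2) - (integral {0..T} f)\<^sup>2 / T"
    using assms by (simp add: c_def power2_eq_square field_simps)
  finally show ?thesis using assms by (simp add: field_simps)
qed

lemma continuous_on_first: "continuous_on A f \<Longrightarrow> continuous_on (A \<times> B) (\<lambda>z. f (fst z))"
  by (rule continuous_on_compose2[of A f]) (auto intro!: continuous_intros)

lemma continuous_on_second: "continuous_on B f \<Longrightarrow> continuous_on (A \<times> B) (\<lambda>z. f (snd z))"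
  by (rule continuous_on_compose2[of B f]) (auto intro!: continuous_intros)

lemma iterated_integral_continuous:
  fixes f :: "real \<Rightarrow> real \<Rightarrow> real"
  assumes f: "continuous_on ({a..b} \<times> {c..d}) (\<lambda>z. f (fst z) (snd z))"
  shows "continuous_on {a..b} (\<lambda>t. integral {c..d} (f t))"
    and "continuous_on {c..d} (\<lambda>x. integral {a..b} (\<lambda>t. f t x))"
    and "integral {a..b} (\<lambda>t. integral {c..d} (f t)) = integral {c..d} (\<lambda>x. integral {a..b} (\<lambda>t. f t x))"
proof -
  show "continuous_on {a..b} (\<lambda>t. integral {c..d} (f t))"
    using integral_continuous_on_param[of "{a..b}" c d f] f by (simp add: split_def)
  have "continuous_on ({c..d} \<times> {a..b}) (\<lambda>w. f (fst (snd w, fst w)) (snd (snd w, fst w)))"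
    by (rule continuous_on_compose2[OF f]) (auto intro!: continuous_intros)
  then show "continuous_on {c..d} (\<lambda>x. integral {a..b} (\<lambda>t. f t x))"
    using integral_continuous_on_param[of "{c..d}" a b "\<lambda>x t. f t x"] by (simp add: split_def)
  show "integral {a..b} (\<lambda>t. integral {c..d} (f t)) = integral {c..d} (\<lambda>x. integral {a..b} (\<lambda>t. f t x))"
    using integral_swap_continuous[of a c b d f] f by (simp add: cbox_Pair_eq split_def)
qed

text \<open>Chosen so that the \<open>K\<close>-term absorbs the \<open>V\<close>-term exactly: exp
  18 is the square of the possible growth exp 9 of the weight in t, one factor 9 comes from
  Cauchy-Schwarz on [0,9], the other from integrating over t, and 1/2 appears because the Laplacian
  of the weight is 2 K.\<close>

definition carleman_const :: "real \<Rightarrow> real" where "carleman_const B = 81 * exp 18 * B\<^sup>2 / 2"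

text \<open>In the application \<open>u = cosh(t \<surd>H) \<phi>\<close>, and \<open>S\<close> and \<open>Z\<close> are the primitives of \<open>u\<close> and \<open>u\<^sub>x\<close> in \<open>t\<close>.\<close>

locale ghost_extension =
  fixes u ux uT uxT S Z :: "real \<Rightarrow> real \<Rightarrow> real" and V :: "real \<Rightarrow> real" and B :: real
  assumes cont: "continuous_on ({0..9} \<times> {-9..9}) (\<lambda>z. u (fst z) (snd z))"
    "continuous_on ({0..9} \<times> {-9..9}) (\<lambda>z. ux (fst z) (snd z))"
    "continuous_on ({0..9} \<times> {-9..9}) (\<lambda>z. uT (fst z) (snd z))"
    "continuous_on ({0..9} \<times> {-9..9}) (\<lambda>z. uxT (fst z) (snd z))"
    "continuous_on ({0..9} \<times> {-9..9}) (\<lambda>z. S (fst z) (snd z))"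
    "continuous_on ({0..9} \<times> {-9..9}) (\<lambda>z. Z (fst z) (snd z))"
  and dx: "\<And>t x. t \<in> {0..9} \<Longrightarrow> x \<in> {-9..9} \<Longrightarrow> (u t has_real_derivative ux t x) (at x within {-9..9})"
    "\<And>t x. t \<in> {0..9} \<Longrightarrow> x \<in> {-9..9} \<Longrightarrow> (uT t has_real_derivative uxT t x) (at x within {-9..9})"
  and dt: "\<And>t x. t \<in> {0..9} \<Longrightarrow> x \<in> {-9..9} \<Longrightarrow> ((\<lambda>t. u t x) has_real_derivative uT t x) (at t within {0..9})"
    "\<And>t x. t \<in> {0..9} \<Longrightarrow> x \<in> {-9..9} \<Longrightarrow> ((\<lambda>t. ux t x) has_real_derivative uxT t x) (at t within {0..9})"
    "\<And>t x. t \<in> {0..9} \<Longrightarrow> x \<in> {-9..9} \<Longrightarrow> ((\<lambda>t. S t x) has_real_derivative u t x) (at t within {0..9})"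
    "\<And>t x. t \<in> {0..9} \<Longrightarrow> x \<in> {-9..9} \<Longrightarrow> ((\<lambda>t. Z t x) has_real_derivative ux t x) (at t within {0..9})"
  and init: "\<And>x. x \<in> {-9..9} \<Longrightarrow> S 0 x = 0" "\<And>x. x \<in> {-9..9} \<Longrightarrow> Z 0 x = 0"
  and Zx: "\<And>t. t \<in> {0..9} \<Longrightarrow> acd (-9) 9 (Z t) (\<lambda>x. V x * S t x - uT t x)"
  and V: "\<And>x. x \<in> {-9..9} \<Longrightarrow> 0 \<le> V x \<and> V x \<le> B"
begin

lemma B_nonneg: "0 \<le> B" using V[of 0] by auto

abbreviation "K \<equiv> carleman_const B"

text \<open>Here \<open>e\<close> is fixed, so the observation is smeared over the axis by
  \<open>logk_s\<close>; it becomes an integral against \<open>h\<close> only as \<open>e\<close>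
  tends to 0. \<open>Q\<close> enters through the cutoff error.\<close>

lemma weighted_estimate:
  fixes h :: "real \<Rightarrow> real" and m :: nat
  assumes h: "continuous_on {-1..1} h" and h1: "\<And>y. y \<in> {-1..1} \<Longrightarrow> 0 \<le> h y \<and> h y \<le> 1"
    and N: "0 < integral {-1..1} h" and e: "0 < e"
    and Q: "\<And>t. t \<in> {0..9} \<Longrightarrow> integral {-9..9} (\<lambda>x. (u t x)\<^sup>2 + (Z t x)\<^sup>2) \<le> Q"
  defines "W \<equiv> \<lambda>x. (cutoff x)\<^sup>2 * exp (2 * K * x\<^sup>2 - 2 * m * log_potential h e logk 0 x) * (u 0 x)\<^sup>2"
  shows "integral {-9..9} W \<le> m * integral {-9..9} (\<lambda>x. log_potential h e logk_s 0 x * W x)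
    + 288 * exp (162 * K + 18) * (1/49) ^ m * Q"
proof -
  let ?D = "{0..9::real} \<times> {-9..9::real}"
  let ?P = "\<lambda>g. log_potential h e g"
  define p where "p = (\<lambda>t x. K * x\<^sup>2 + t - m * ?P logk t x)"
  define px where "px = (\<lambda>t x. 2 * K * x - m * ?P logk_x t x)"
  define pt where "pt = (\<lambda>t x. 1 - m * ?P logk_s t x)"
  define pxt where "pxt = (\<lambda>t x. - m * ?P logk_xs t x)"
  define pxx where "pxx = (\<lambda>t x. 2 * K - m * ?P logk_xx t x)"
  define ptt where "ptt = (\<lambda>t x. m * ?P logk_xx t x)"
  have Pc: "continuous_on ?D (\<lambda>z. ?P g (fst z) (snd z))" 
    if "continuous_on ({0<..} \<times> UNIV) (\<lambda>z. g (fst z) (snd z))" for g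
    using log_potential_continuous[OF h e that] by (rule continuous_on_subset) auto
  note Pcs = logk_continuous[THEN Pc]
  have pc: "continuous_on ?D (\<lambda>z. p (fst z) (snd z))" "continuous_on ?D (\<lambda>z. px (fst z) (snd z))"
    "continuous_on ?D (\<lambda>z. pt (fst z) (snd z))" "continuous_on ?D (\<lambda>z. pxt (fst z) (snd z))"
    "continuous_on ?D (\<lambda>z. pxx (fst z) (snd z))" "continuous_on ?D (\<lambda>z. ptt (fst z) (snd z))"
    unfolding p_def px_def pt_def pxt_def pxx_def ptt_def by (intro continuous_intros Pcs)+
  have Px: "(?P logk t has_real_derivative ?P logk_x t x) (at x within X)"
      "(?P logk_x t has_real_derivative ?P logk_xx t x) (at x within X)"
      "(?P logk_s t has_real_derivative ?P logk_xs t x) (at x within X)" if "t \<in> {0..9}" for t x X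
    using that by (auto intro!: has_field_derivative_at_within[OF log_potential_deriv_x[OF h e]] logk_continuous logk_derivs)
  have Pt: "((\<lambda>t. ?P g t x) has_real_derivative ?P g' t x) (at t within {0..9})"
      if "continuous_on ({0<..} \<times> UNIV) (\<lambda>z. g (fst z) (snd z))"
         "continuous_on ({0<..} \<times> UNIV) (\<lambda>z. g' (fst z) (snd z))"
         "\<And>s X. 0 < s \<Longrightarrow> ((\<lambda>s. g s X) has_real_derivative g' s X) (at s)" "t \<in> {0..9}" for t x g g'
    using that(4) by (intro DERIV_subset[OF log_potential_deriv_t[OF h e that(1-3)]]) auto
  have mxx: "?P (\<lambda>s X. - logk_xx s X) t x = - ?P logk_xx t x" for t x
    by (simp add: log_potential_def integral_neg)
  have cxx: "continuous_on ({0<..} \<times> UNIV) (\<lambda>z. - logk_xx (fst z) (snd z))"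
    by (intro continuous_intros logk_continuous)
  have pdx: "(p t has_real_derivative px t x) (at x within {-9..9})"
     "(px t has_real_derivative pxx t x) (at x within {-9..9})"
     "(pt t has_real_derivative pxt t x) (at x within {-9..9})" if "t \<in> {0..9}" for t x
    unfolding p_def px_def pxx_def pt_def pxt_def
    using Px[OF that, of x "{-9..9}"] by (auto intro!: derivative_eq_intros)
  have pdt: "((\<lambda>t. p t x) has_real_derivative pt t x) (at t within {0..9})"
     "((\<lambda>t. px t x) has_real_derivative pxt t x) (at t within {0..9})"
     "((\<lambda>t. pt t x) has_real_derivative ptt t x) (at t within {0..9})" if "t \<in> {0..9}" for t x
    unfolding p_def px_def pt_def pxt_def ptt_def
    using Pt[OF logk_continuous(1,3) logk_derivs(2) that, of x] Pt[OF logk_continuous(2,5) logk_derivs(4) that, of x]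
      Pt[OF logk_continuous(3) cxx logk_derivs(5) that, of x, unfolded mxx]
    by (auto intro!: derivative_eq_intros)
  define E where "E = (\<lambda>t x. exp (p t x))"
  \<comment> \<open>the estimate is applied to \<open>q (u + iZ)\<close>; \<open>2 g1\<close> bounds the contribution of \<open>V S\<close> and \<open>2 g2\<close> that of the cutoff\<close>
  define q where "q = (\<lambda>t x. cutoff t * cutoff x * E t x)"
  define qx where "qx = (\<lambda>t x. (cutoff t * cutoff' x + cutoff t * cutoff x * px t x) * E t x)"
  define qT where "qT = (\<lambda>t x. (cutoff' t * cutoff x + cutoff t * cutoff x * pt t x) * E t x)"
  define qxT where "qxT = (\<lambda>t x. (cutoff' t * cutoff' x + (cutoff' t * cutoff x * px t x + cutoff t * cutoff x * pxt t x)
      + (cutoff t * cutoff' x + cutoff t * cutoff x * px t x) * pt t x) * E t x)"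
  note cc = continuous_on_first[OF cutoff_continuous] continuous_on_second[OF cutoff_continuous]
     continuous_on_first[OF cutoff'_continuous] continuous_on_second[OF cutoff'_continuous]
  have Ec: "continuous_on ?D (\<lambda>z. E (fst z) (snd z))" unfolding E_def by (intro continuous_intros pc)
  have qc: "continuous_on ?D (\<lambda>z. q (fst z) (snd z))" "continuous_on ?D (\<lambda>z. qx (fst z) (snd z))"
    "continuous_on ?D (\<lambda>z. qT (fst z) (snd z))" "continuous_on ?D (\<lambda>z. qxT (fst z) (snd z))"
    unfolding q_def qx_def qT_def qxT_def by (intro continuous_intros cc pc Ec)+
  have Ed: "(E t has_real_derivative E t x * px t x) (at x within {-9..9})"
      "((\<lambda>t. E t x) has_real_derivative E t x * pt t x) (at t within {0..9})" if "t \<in> {0..9}" for t x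
    unfolding E_def using pdx(1)[OF that, of x] pdt(1)[OF that, of x] by (auto intro!: derivative_eq_intros)
  note cd = has_field_derivative_at_within[OF cutoff_deriv]
  have qd: "(q t has_real_derivative qx t x) (at x within {-9..9})"
     "((\<lambda>t. q t x) has_real_derivative qT t x) (at t within {0..9})"
     "((\<lambda>t. qx t x) has_real_derivative qxT t x) (at t within {0..9})"
     "(qT t has_real_derivative qxT t x) (at x within {-9..9})" if t: "t \<in> {0..9}" for t x
  proof -
    show "(q t has_real_derivative qx t x) (at x within {-9..9})"
      unfolding q_def qx_def
      by (rule DERIV_cong[OF DERIV_mult[OF DERIV_cmult[OF cd] Ed(1)[OF t]]]) (simp add: algebra_simps)
    show "((\<lambda>t. q t x) has_real_derivative qT t x) (at t within {0..9})"
      unfolding q_def qT_def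
      by (rule DERIV_cong[OF DERIV_mult[OF DERIV_cmult_right[OF cd] Ed(2)[OF t]]]) (simp add: algebra_simps)
    show "((\<lambda>t. qx t x) has_real_derivative qxT t x) (at t within {0..9})"
      unfolding qx_def qxT_def
      by (rule DERIV_cong[OF DERIV_mult[OF DERIV_add[OF DERIV_cmult_right[OF cd]
              DERIV_mult[OF DERIV_cmult_right[OF cd] pdt(2)[OF t]]] Ed(2)[OF t]]]) (simp add: algebra_simps)
    show "(qT t has_real_derivative qxT t x) (at x within {-9..9})"
      unfolding qT_def qxT_def
      by (rule DERIV_cong[OF DERIV_mult[OF DERIV_add[OF DERIV_cmult[OF cd]
              DERIV_mult[OF DERIV_cmult[OF cd] pdx(3)[OF t]]] Ed(1)[OF t]]]) (simp add: algebra_simps)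
  qed
  define a where "a = (\<lambda>t x. q t x * u t x)"
  define ax where "ax = (\<lambda>t x. qx t x * u t x + q t x * ux t x)"
  define aT where "aT = (\<lambda>t x. qT t x * u t x + q t x * uT t x)"
  define axT where "axT = (\<lambda>t x. qxT t x * u t x + qx t x * uT t x + (qT t x * ux t x + q t x * uxT t x))"
  define b where "b = (\<lambda>t x. q t x * Z t x)"
  define bT where "bT = (\<lambda>t x. qT t x * Z t x + q t x * ux t x)"
  define bx where "bx = (\<lambda>t x. qx t x * Z t x + q t x * (V x * S t x - uT t x))"
  define g1 where "g1 = (\<lambda>t x. (B * (cutoff t * cutoff x * E t x * S t x))\<^sup>2)"
  define g2 where "g2 = (\<lambda>t x. (E t x)\<^sup>2 * ((cutoff t * cutoff' x)\<^sup>2 + (cutoff' t * cutoff x)\<^sup>2) * ((u t x)\<^sup>2 + (Z t x)\<^sup>2))"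
  have ac: "continuous_on ?D (\<lambda>z. a (fst z) (snd z))" "continuous_on ?D (\<lambda>z. ax (fst z) (snd z))"
    "continuous_on ?D (\<lambda>z. aT (fst z) (snd z))" "continuous_on ?D (\<lambda>z. axT (fst z) (snd z))"
    "continuous_on ?D (\<lambda>z. b (fst z) (snd z))" "continuous_on ?D (\<lambda>z. bT (fst z) (snd z))"
    "continuous_on ?D (\<lambda>z. g1 (fst z) (snd z))" "continuous_on ?D (\<lambda>z. g2 (fst z) (snd z))"
    unfolding a_def ax_def aT_def axT_def b_def bT_def g1_def g2_def by (intro continuous_intros cc Ec qc cont)+
  have "integral {-9..9} (\<lambda>x. pt 0 x * (a 0 x)\<^sup>2) / 2
       + integral {0..9} (\<lambda>t. integral {-9..9} (\<lambda>x. (ptt t x + pxx t x) * ((a t x)\<^sup>2 + (b t x)\<^sup>2))) / 2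
     \<le> integral {0..9} (\<lambda>t. integral {-9..9} (\<lambda>x. 2 * g1 t x + 2 * g2 t x)) / 4"
  proof (rule carleman_estimate[where ax=ax and axT=axT and aT=aT and bT=bT and bx=bx and px=px])
    fix t x :: real assume t: "t \<in> {0..9}" and x: "x \<in> {-9..9}"
    show "(a t has_real_derivative ax t x) (at x within {-9..9})"
      unfolding a_def ax_def by (rule DERIV_cong[OF DERIV_mult[OF qd(1)[OF t] dx(1)[OF t x]]]) simp
    show "((\<lambda>t. a t x) has_real_derivative aT t x) (at t within {0..9})"
      unfolding a_def aT_def by (rule DERIV_cong[OF DERIV_mult[OF qd(2)[OF t] dt(1)[OF t x]]]) simp
    show "((\<lambda>t. b t x) has_real_derivative bT t x) (at t within {0..9})"
      unfolding b_def bT_def by (rule DERIV_cong[OF DERIV_mult[OF qd(2)[OF t] dt(4)[OF t x]]]) simp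
    show "(aT t has_real_derivative axT t x) (at x within {-9..9})"
      unfolding aT_def axT_def
      by (rule DERIV_cong[OF DERIV_add[OF DERIV_mult[OF qd(4)[OF t] dx(1)[OF t x]] DERIV_mult[OF qd(1)[OF t] dx(2)[OF t x]]]]) simp
    show "((\<lambda>t. ax t x) has_real_derivative axT t x) (at t within {0..9})"
      unfolding ax_def axT_def
      by (rule DERIV_cong[OF DERIV_add[OF DERIV_mult[OF qd(3)[OF t] dt(1)[OF t x]] DERIV_mult[OF qd(2)[OF t] dt(2)[OF t x]]]]) simp
    show "(ax t x - bT t x - px t x * a t x + pt t x * b t x)\<^sup>2 + (aT t x + bx t x - pt t x * a t x - px t x * b t x)\<^sup>2
        \<le> 2 * g1 t x + 2 * g2 t x"
    proof -
      \<comment> \<open>Conjugation by the weight removes the terms with \<open>px\<close> and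
        \<open>pt\<close>, and the two Cauchy-Riemann equations remove the derivatives of u and Z.
        What remains is the gradient of the cutoffs acting on u + iZ, and the term with V S.\<close>
      let ?\<alpha> = "cutoff t * cutoff' x" and ?\<beta> = "cutoff' t * cutoff x"
      let ?X = "E t x * (?\<alpha> * u t x - ?\<beta> * Z t x)" and ?Y = "E t x * (?\<beta> * u t x + ?\<alpha> * Z t x)"
      let ?W = "V x * (cutoff t * cutoff x * E t x * S t x)"
      have "ax t x - bT t x - px t x * a t x + pt t x * b t x = ?X"
        unfolding ax_def bT_def a_def b_def qx_def qT_def q_def by (simp add: algebra_simps)
      moreover have "aT t x + bx t x - pt t x * a t x - px t x * b t x = ?Y + ?W"
        unfolding aT_def bx_def a_def b_def qx_def qT_def q_def by (simp add: algebra_simps)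
      moreover have "?X\<^sup>2 + (?Y + ?W)\<^sup>2 \<le> 2 * (?X\<^sup>2 + ?Y\<^sup>2) + 2 * ?W\<^sup>2"
        by (rule square_add_le)
      moreover have "?X\<^sup>2 + ?Y\<^sup>2 = g2 t x"
        unfolding g2_def by (simp add: power2_eq_square algebra_simps)
      moreover have "?W\<^sup>2 \<le> g1 t x"
        unfolding g1_def power_mult_distrib[of "V x"] power_mult_distrib[of B] using V[OF x] B_nonneg
        by (intro mult_right_mono power_mono) auto
      ultimately show ?thesis by simp
    qed
  next
    fix t :: real assume t: "t \<in> {0..9}"
    have bnd: "\<exists>M. \<forall>x\<in>{-9..9}. \<bar>f t x\<bar> \<le> M" if f: "continuous_on ?D (\<lambda>z. f (fst z) (snd z))" for f :: "real \<Rightarrow> real \<Rightarrow> real"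
    proof -
      have "bounded (f t ` {-9..9})"
        using continuous_on_slice[OF f t] by (intro compact_imp_bounded compact_continuous_image) auto
      then show ?thesis unfolding bounded_iff by fastforce
    qed
    obtain M where M: "\<And>x. x \<in> {-9..9} \<Longrightarrow> \<bar>qx t x\<bar> \<le> M" using bnd[OF qc(2)] by blast
    have "acd (-9) 9 (\<lambda>x. Z t x * q t x) (\<lambda>x. (V x * S t x - uT t x) * q t x + Z t x * qx t x)"
      using qd(1)[OF t] continuous_on_slice[OF qc(2) t] by (intro acd_mult[OF Zx[OF t] acd_deriv M]) auto
    then show "acd (-9) 9 (b t) (bx t)"
      by (rule acd_cong) (simp_all add: b_def bx_def)
    have "continuous_on ?D (\<lambda>z. qx (fst z) (snd z) * Z (fst z) (snd z) - q (fst z) (snd z) * uT (fst z) (snd z))"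
      "continuous_on ?D (\<lambda>z. q (fst z) (snd z) * S (fst z) (snd z))"
      by (intro continuous_intros qc cont)+
    then obtain M1 M2 where M1: "\<And>x. x \<in> {-9..9} \<Longrightarrow> \<bar>qx t x * Z t x - q t x * uT t x\<bar> \<le> M1"
        and M2: "\<And>x. x \<in> {-9..9} \<Longrightarrow> \<bar>q t x * S t x\<bar> \<le> M2"
      using bnd[of "\<lambda>t x. qx t x * Z t x - q t x * uT t x"] bnd[of "\<lambda>t x. q t x * S t x"] by meson
    have "\<bar>bx t x\<bar> \<le> M1 + B * M2" if x: "x \<in> {-9..9}" for x
    proof -
      have "bx t x = (qx t x * Z t x - q t x * uT t x) + V x * (q t x * S t x)"
        by (simp add: bx_def algebra_simps)
      moreover have "\<bar>V x * (q t x * S t x)\<bar> \<le> B * M2"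
        unfolding abs_mult[of "V x"] using V[OF x] M2[OF x] by (intro mult_mono) auto
      ultimately show ?thesis using M1[OF x] by linarith
    qed
    then show "\<exists>M. \<forall>x\<in>{-9..9}. \<bar>bx t x\<bar> \<le> M" by blast
  next
    show "continuous_on ?D (\<lambda>z. 2 * g1 (fst z) (snd z) + 2 * g2 (fst z) (snd z))"
      by (intro continuous_intros ac)
  qed (use ac pc pdx pdt cutoff_boundary init in \<open>auto simp: a_def b_def q_def\<close>)
  then have main: "integral {-9..9} (\<lambda>x. pt 0 x * (a 0 x)\<^sup>2) / 2
       + integral {0..9} (\<lambda>t. integral {-9..9} (\<lambda>x. 2 * K * ((a t x)\<^sup>2 + (b t x)\<^sup>2))) / 2
     \<le> integral {0..9} (\<lambda>t. integral {-9..9} (\<lambda>x. 2 * g1 t x + 2 * g2 t x)) / 4"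
    by (simp add: ptt_def pxx_def)
  have a2c: "continuous_on ?D (\<lambda>z. (a (fst z) (snd z))\<^sup>2)"
    and abc: "continuous_on ?D (\<lambda>z. (a (fst z) (snd z))\<^sup>2 + (b (fst z) (snd z))\<^sup>2)"
    and uZc: "continuous_on ?D (\<lambda>z. (u (fst z) (snd z))\<^sup>2 + (Z (fst z) (snd z))\<^sup>2)"
    by (intro continuous_intros ac cont)+
  note it = iterated_integral_continuous[OF a2c] iterated_integral_continuous[OF abc]
    iterated_integral_continuous[OF ac(7)] iterated_integral_continuous[OF ac(8)]
    iterated_integral_continuous[OF uZc]
  note sl = continuous_on_slice[OF a2c] continuous_on_slice[OF abc] continuous_on_slice[OF ac(7)]
    continuous_on_slice[OF ac(8)] continuous_on_slice[OF uZc]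
  have g_split: "integral {0..9} (\<lambda>t. integral {-9..9} (\<lambda>x. 2 * g1 t x + 2 * g2 t x))
      = 2 * integral {0..9} (\<lambda>t. integral {-9..9} (g1 t)) + 2 * integral {0..9} (\<lambda>t. integral {-9..9} (g2 t))"
  proof -
    have "integral {-9..9} (\<lambda>x. 2 * g1 t x + 2 * g2 t x) = 2 * integral {-9..9} (g1 t) + 2 * integral {-9..9} (g2 t)"
      if "t \<in> {0..9}" for t
      using sl(3,4)[OF that] by (subst Henstock_Kurzweil_Integration.integral_add)
        (auto intro!: integrable_continuous_real continuous_intros)
    then have "integral {0..9} (\<lambda>t. integral {-9..9} (\<lambda>x. 2 * g1 t x + 2 * g2 t x))
      = integral {0..9} (\<lambda>t. 2 * integral {-9..9} (g1 t) + 2 * integral {-9..9} (g2 t))"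
      by (intro integral_cong) auto
    also have "\<dots> = 2 * integral {0..9} (\<lambda>t. integral {-9..9} (g1 t)) + 2 * integral {0..9} (\<lambda>t. integral {-9..9} (g2 t))"
      by (subst Henstock_Kurzweil_Integration.integral_add)
        (auto intro!: integrable_continuous_real continuous_intros it)
    finally show ?thesis .
  qed
  \<comment> \<open>The potential increases with t, so only the summand t of the weight exponent,
    which changes by at most 9, can make the weight grow.\<close>
  have sup_gr: "E t x \<le> exp 9 * E s x" if "0 \<le> s" "s \<le> t" "t \<le> 9" for s t x
  proof -
    have "m * ?P logk s x \<le> m * ?P logk t x"
      using log_potential_mono_t[OF h e N _ that(1,2)] h1 by (intro mult_left_mono) auto
    then have "p t x \<le> 9 + p s x" using that by (simp add: p_def)
    then show ?thesis by (simp add: E_def flip: exp_add)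
  qed
  \<comment> \<open>S at height \<open>t\<close> integrates u over lower heights, where the cutoff
    is not smaller and the weight is at least exp(-9) times its value at \<open>t\<close>; hence the
    weighted S is dominated by an integral of |a|.\<close>
  have g1_le: "g1 t x \<le> B\<^sup>2 * (exp 18 * (9 * integral {0..9} (\<lambda>s. (a s x)\<^sup>2)))" if t: "t \<in> {0..9}" and x: "x \<in> {-9..9}" for t x
  proof -
    define c where "c = cutoff t * cutoff x * E t x"
    have c0: "0 \<le> c" by (simp add: c_def cutoff_nonneg E_def)
    have ct: "continuous_on {0..9} (\<lambda>s. f s x)" if "continuous_on ?D (\<lambda>z. f (fst z) (snd z))" for f :: "real \<Rightarrow> real \<Rightarrow> real"
    proof -
      have "continuous_on {0..9} (\<lambda>s. f (fst (s, x)) (snd (s, x)))"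
        by (rule continuous_on_compose2[OF that]) (use x in \<open>auto intro!: continuous_intros\<close>)
      then show ?thesis by simp
    qed
    have uc: "continuous_on {0..t} (\<lambda>s. u s x)" and acx: "continuous_on {0..9} (\<lambda>s. a s x)"
      using ct[OF cont(1)] ct[OF ac(1)] t by (auto intro: continuous_on_subset)
    have "((\<lambda>s. u s x) has_integral (S t x - S 0 x)) {0..t}"
    proof (rule fundamental_theorem_of_calculus)
      fix s assume s: "s \<in> {0..t}"
      then have "((\<lambda>s. S s x) has_real_derivative u s x) (at s within {0..9})" using dt(3)[of s x] t x by auto
      then have "((\<lambda>s. S s x) has_real_derivative u s x) (at s within {0..t})" by (rule DERIV_subset) (use t in auto)
      then show "((\<lambda>s. S s x) has_vector_derivative u s x) (at s within {0..t})"
        by (simp add: has_real_derivative_iff_has_vector_derivative)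
    qed (use t in auto)
    then have "((\<lambda>s. c * u s x) has_integral c * S t x) {0..t}"
      using init(1)[OF x] by (intro has_integral_mult_right) simp
    then have "\<bar>c * S t x\<bar> = norm (integral {0..t} (\<lambda>s. c * u s x))" by (simp only: integral_unique real_norm_def)
    also have "\<dots> \<le> integral {0..t} (\<lambda>s. exp 9 * \<bar>a s x\<bar>)"
    proof (rule integral_norm_bound_integral)
      fix s assume s: "s \<in> {0..t}"
      have "cutoff t * E t x \<le> cutoff s * (exp 9 * E s x)"
        using s t by (intro mult_mono cutoff_antimono sup_gr) (auto simp: cutoff_nonneg E_def)
      then have "cutoff t * E t x * (cutoff x * \<bar>u s x\<bar>) \<le> cutoff s * (exp 9 * E s x) * (cutoff x * \<bar>u s x\<bar>)"
        by (intro mult_right_mono) (auto simp: cutoff_nonneg)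
      then show "norm (c * u s x) \<le> exp 9 * \<bar>a s x\<bar>"
        using c0 by (simp add: a_def q_def c_def abs_mult cutoff_nonneg E_def mult_ac)
    qed (use uc acx t in \<open>auto intro!: integrable_continuous_real continuous_intros intro: continuous_on_subset\<close>)
    also have "\<dots> \<le> integral {0..9} (\<lambda>s. exp 9 * \<bar>a s x\<bar>)"
      using acx t by (intro integral_subset_le)
        (auto intro!: integrable_continuous_real continuous_intros intro: continuous_on_subset)
    also have "\<dots> = exp 9 * integral {0..9} (\<lambda>s. \<bar>a s x\<bar>)" by simp
    finally have "\<bar>c * S t x\<bar>\<^sup>2 \<le> (exp 9 * integral {0..9} (\<lambda>s. \<bar>a s x\<bar>))\<^sup>2" by (intro power_mono) auto
    also have "\<dots> = exp 18 * (integral {0..9} (\<lambda>s. \<bar>a s x\<bar>))\<^sup>2"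
      by (simp add: power_mult_distrib flip: exp_of_nat_mult)
    also have "\<dots> \<le> exp 18 * (9 * integral {0..9} (\<lambda>s. \<bar>a s x\<bar>\<^sup>2))"
      using acx by (intro mult_left_mono integral_Cauchy_Schwarz_interval continuous_intros) auto
    finally have "(c * S t x)\<^sup>2 \<le> exp 18 * (9 * integral {0..9} (\<lambda>s. (a s x)\<^sup>2))" by simp
    then have "B\<^sup>2 * (c * S t x)\<^sup>2 \<le> B\<^sup>2 * (exp 18 * (9 * integral {0..9} (\<lambda>s. (a s x)\<^sup>2)))"
      by (intro mult_left_mono) auto
    then show ?thesis by (simp add: g1_def c_def power_mult_distrib)
  qed
  define I where "I = integral {-9..9} (\<lambda>x. integral {0..9} (\<lambda>s. (a s x)\<^sup>2))"
  have "integral {0..9} (\<lambda>t. integral {-9..9} (g1 t)) \<le> integral {0..9::real} (\<lambda>t. B\<^sup>2 * (exp 18 * (9 * I)))"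
  proof (intro integral_le)
    fix t :: real assume t: "t \<in> {0..9}"
    have "integral {-9..9} (g1 t) \<le> integral {-9..9} (\<lambda>x. B\<^sup>2 * (exp 18 * (9 * integral {0..9} (\<lambda>s. (a s x)\<^sup>2))))"
      using sl(3)[OF t] g1_le[OF t] it(2)
      by (intro integral_le) (auto intro!: integrable_continuous_real continuous_intros)
    then show "integral {-9..9} (g1 t) \<le> B\<^sup>2 * (exp 18 * (9 * I))" by (simp add: I_def)
  qed (auto intro!: integrable_continuous_real it)
  also have "\<dots> = 2 * K * I" by (simp add: carleman_const_def)
  also have "I = integral {0..9} (\<lambda>t. integral {-9..9} (\<lambda>x. (a t x)\<^sup>2))" by (simp add: I_def it(3))
  also have "2 * K * \<dots> \<le> 2 * K * integral {0..9} (\<lambda>t. integral {-9..9} (\<lambda>x. (a t x)\<^sup>2 + (b t x)\<^sup>2))"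
  proof (intro mult_left_mono integral_le)
    show "0 \<le> 2 * K" by (simp add: carleman_const_def)
  qed (auto intro!: integrable_continuous_real it sl)
  also have "\<dots> = integral {0..9} (\<lambda>t. integral {-9..9} (\<lambda>x. 2 * K * ((a t x)\<^sup>2 + (b t x)\<^sup>2)))" by simp
  finally have g1_int: "integral {0..9} (\<lambda>t. integral {-9..9} (g1 t))
    \<le> integral {0..9} (\<lambda>t. integral {-9..9} (\<lambda>x. 2 * K * ((a t x)\<^sup>2 + (b t x)\<^sup>2)))" .
  \<comment> \<open>162 K + 18 is the maximum of 2 (K x^2 + t) on the box, and 32 = 16 + 16 bounds
    the two squared cutoff gradients. These live where the potential is at least ln 7, which
    accounts for (1/49)^m. Integration over t in [0,9] later turns 32 into 288.\<close>
  define c where "c = 32 * exp (162 * K + 18) * (1/49) ^ m"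
  have c0: "0 \<le> c" by (simp add: c_def)
  have K0: "0 \<le> K" by (simp add: carleman_const_def)
  have g2_le: "g2 t x \<le> c * ((u t x)\<^sup>2 + (Z t x)\<^sup>2)" if t: "t \<in> {0..9}" and x: "x \<in> {-9..9}" for t x
  proof -
    have "(E t x)\<^sup>2 * ((cutoff t * cutoff' x)\<^sup>2 + (cutoff' t * cutoff x)\<^sup>2) \<le> c"
    proof (cases "8 \<le> \<bar>x\<bar> \<or> 8 \<le> t")
      case True
      have "\<bar>x\<bar>\<^sup>2 \<le> 9\<^sup>2" using x by (intro power_mono) auto
      then have "K * x\<^sup>2 \<le> K * 81" using K0 by (intro mult_left_mono) auto
      moreover have "m * ln 7 \<le> m * ?P logk t x"
        using log_potential_far[OF h e N _ _ True] h1 t by (intro mult_left_mono) auto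
      ultimately have "2 * p t x \<le> (162 * K + 18) + m * (- ln 49)"
        using t ln_realpow[of "7::real" 2] by (simp add: p_def)
      then have "exp (2 * p t x) \<le> exp ((162 * K + 18) + m * (- ln 49))" by simp
      also have "\<dots> = exp (162 * K + 18) * (1/49) ^ m"
        by (simp only: exp_add exp_of_nat_mult) (simp add: exp_minus inverse_eq_divide)
      finally have E2: "(E t x)\<^sup>2 \<le> exp (162 * K + 18) * (1/49) ^ m" by (simp add: E_def exp_double)
      have "(cutoff t)\<^sup>2 \<le> 1" "(cutoff x)\<^sup>2 \<le> 1" using cutoff_le_1 cutoff_nonneg by (simp_all add: power_le_one)
      then have "(cutoff t * cutoff' x)\<^sup>2 + (cutoff' t * cutoff x)\<^sup>2 \<le> 1 * 16 + 16 * 1"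
        unfolding power_mult_distrib using cutoff'_bound by (intro add_mono mult_mono) auto
      then have "(E t x)\<^sup>2 * ((cutoff t * cutoff' x)\<^sup>2 + (cutoff' t * cutoff x)\<^sup>2) \<le> (exp (162 * K + 18) * (1/49) ^ m) * 32"
        using E2 by (intro mult_mono) auto
      then show ?thesis by (simp add: c_def)
    next
      case False
      then show ?thesis using t c0 by (simp add: cutoff'_eq_0)
    qed
    then show ?thesis unfolding g2_def by (intro mult_right_mono) auto
  qed
  have "integral {0..9} (\<lambda>t. integral {-9..9} (g2 t)) \<le> integral {0..9::real} (\<lambda>t. c * Q)"
  proof (intro integral_le)
    fix t :: real assume t: "t \<in> {0..9}"
    have "integral {-9..9} (g2 t) \<le> integral {-9..9} (\<lambda>x. c * ((u t x)\<^sup>2 + (Z t x)\<^sup>2))"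
      using sl(4,5)[OF t] g2_le[OF t]
      by (intro integral_le) (auto intro!: integrable_continuous_real continuous_intros)
    also have "\<dots> \<le> c * Q" using Q[OF t] c0 by (simp add: mult_left_mono)
    finally show "integral {-9..9} (g2 t) \<le> c * Q" .
  qed (auto intro!: integrable_continuous_real it)
  then have g2_int: "integral {0..9} (\<lambda>t. integral {-9..9} (g2 t)) \<le> 288 * exp (162 * K + 18) * (1/49) ^ m * Q"
    by (simp add: c_def)
  have W: "W x = (a 0 x)\<^sup>2" for x
  proof -
    have "(E 0 x)\<^sup>2 = exp (2 * K * x\<^sup>2 - 2 * m * log_potential h e logk 0 x)"
      unfolding E_def p_def by (simp add: algebra_simps flip: exp_double)
    then show ?thesis by (simp add: W_def a_def q_def cutoff_eq_1 power_mult_distrib)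
  qed
  have "integral {-9..9} (\<lambda>x. pt 0 x * (a 0 x)\<^sup>2) = integral {-9..9} W - m * integral {-9..9} (\<lambda>x. log_potential h e logk_s 0 x * W x)"
  proof -
    have c1: "continuous_on {-9..9} W" using sl(1)[of 0] by (simp add: W cong: continuous_on_cong)
    have c2: "continuous_on {-9..9} (?P logk_s 0)" using continuous_on_slice[OF Pcs(3), of 0] by simp
    have "integral {-9..9} (\<lambda>x. pt 0 x * (a 0 x)\<^sup>2) = integral {-9..9} (\<lambda>x. W x - m * (?P logk_s 0 x * W x))"
      by (simp add: pt_def W left_diff_distrib mult.assoc)
    also have "\<dots> = integral {-9..9} W - integral {-9..9} (\<lambda>x. m * (?P logk_s 0 x * W x))"
      by (intro Henstock_Kurzweil_Integration.integral_diff integrable_continuous_real continuous_intros c1 c2)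
    finally show ?thesis by simp
  qed
  then show ?thesis using main g_split g1_int g2_int by linarith
qed

text \<open>On the axis the squared weight is bounded above through P >= ln N - 3, whence the factor
  exp(162 K + 6 m)/N^(2 m), and below on [-1,1] by (1/5)^m. A slack \<open>w\<close> is fixed first,
  then \<open>e\<close> small depending on it, and finally \<open>w\<close> tends to 0.\<close>

lemma local_estimate:
  fixes h :: "real \<Rightarrow> real" and m :: nat
  defines "N \<equiv> integral {-1..1} h"
  assumes h: "continuous_on {-1..1} h" and h1: "\<And>y. y \<in> {-1..1} \<Longrightarrow> 0 \<le> h y \<and> h y \<le> 1"
    and N: "0 < N"
    and Q: "\<And>t. t \<in> {0..9} \<Longrightarrow> integral {-9..9} (\<lambda>x. (u t x)\<^sup>2 + (Z t x)\<^sup>2) \<le> Q"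
  shows "integral {-1..1} (\<lambda>x. (u 0 x)\<^sup>2)
    \<le> 5 ^ m * (m * (exp (162 * K + 6 * m) / N ^ (2 * m)) * (pi * integral {-1..1} (\<lambda>x. h x * (u 0 x)\<^sup>2)) / N)
     + 288 * exp (162 * K + 18) * (5/49) ^ m * Q"
proof -
  define X where "X = integral {-1..1} (\<lambda>x. (u 0 x)\<^sup>2)"
  define Y where "Y = integral {-1..1} (\<lambda>x. h x * (u 0 x)\<^sup>2)"
  define F where "F = exp (162 * K + 6 * m) / N ^ (2 * m)"
  define c where "c = 288 * exp (162 * K + 18) * (1/49) ^ m * Q"
  have K0: "0 \<le> K" by (simp add: carleman_const_def)
  have F0: "0 < F" using N by (simp add: F_def)
  have u0: "continuous_on {-9..9} (u 0)" using continuous_on_slice[OF cont(1), of 0] by simp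
  define q where "q = (\<lambda>x. (cutoff x)\<^sup>2 * (u 0 x)\<^sup>2)"
  have qc: "continuous_on {-9..9} q" unfolding q_def by (intro continuous_intros cutoff_continuous u0)
  have hq: "integral {-1..1} (\<lambda>y. h y * q y) = Y"
    unfolding Y_def by (intro integral_cong) (auto simp: q_def cutoff_eq_1)
  have step: "(1/5) ^ m * X \<le> m * F * (pi * Y + w) / N + c" if w: "0 < w" for w
  proof -
    obtain e0 where e0: "0 < e0" "\<And>e. 0 < e \<Longrightarrow> e \<le> e0 \<Longrightarrow>
        integral {-9..9} (\<lambda>x. log_potential h e logk_s 0 x * q x) \<le> (pi * Y + w) / N"
      using log_potential_normal_derivative_limit[OF h h1 _ qc _ w] N unfolding hq N_def[symmetric]
      by (auto simp: q_def)
    \<comment> \<open>The bound 1 serves the estimate near the interval, the bound \<open>N\<close>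
      the lower estimate on the axis.\<close>
    define e where "e = min e0 (min 1 N)"
    have e: "0 < e" "e \<le> e0" "e \<le> 1" "e \<le> N" using e0 N by (auto simp: e_def)
    define W where "W = (\<lambda>x. (cutoff x)\<^sup>2 * exp (2 * K * x\<^sup>2 - 2 * m * log_potential h e logk 0 x) * (u 0 x)\<^sup>2)"
    have we: "integral {-9..9} W \<le> m * integral {-9..9} (\<lambda>x. log_potential h e logk_s 0 x * W x) + c"
      unfolding W_def c_def by (rule weighted_estimate[OF h h1 _ e(1) Q]) (use N N_def in auto)
    have Pc: "continuous_on {-9..9} (log_potential h e g 0)"
      if "continuous_on ({0<..} \<times> UNIV) (\<lambda>z. g (fst z) (snd z))" for g
      using continuous_on_slice[OF log_potential_continuous[OF h e(1) that], of 0]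
      by (auto intro: continuous_on_subset)
    have Wc: "continuous_on {-9..9} W"
      unfolding W_def by (intro continuous_intros cutoff_continuous u0 Pc logk_continuous)
    have "(1/5) ^ m * X = integral {-1..1} (\<lambda>x. (1/5) ^ m * (u 0 x)\<^sup>2)" by (simp add: X_def)
    also have "\<dots> \<le> integral {-1..1} W"
    proof (rule integral_le)
      fix x :: real assume x: "x \<in> {-1..1}"
      have "m * log_potential h e logk 0 x \<le> m * (ln 5 / 2)"
        using log_potential_near[OF h e(1)] h1 N x e by (intro mult_left_mono) (auto simp: N_def)
      moreover have "0 \<le> 2 * K * x\<^sup>2" using K0 by simp
      ultimately have "m * (- ln 5) \<le> 2 * K * x\<^sup>2 - 2 * m * log_potential h e logk 0 x" by simp
      then have "exp (m * (- ln 5)) \<le> exp (2 * K * x\<^sup>2 - 2 * m * log_potential h e logk 0 x)"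
        by (simp only: exp_le_cancel_iff)
      moreover have "exp (m * (- ln 5)) = (1/5::real) ^ m"
        by (simp only: exp_of_nat_mult) (simp add: exp_minus inverse_eq_divide)
      ultimately have "(1/5) ^ m \<le> exp (2 * K * x\<^sup>2 - 2 * m * log_potential h e logk 0 x)" by (simp only:)
      moreover have "cutoff x = 1" using x by (intro cutoff_eq_1) auto
      ultimately show "(1/5) ^ m * (u 0 x)\<^sup>2 \<le> W x"
        unfolding W_def by (simp only: power_one mult_1 mult_right_mono zero_le_power2)
    qed (use u0 Wc in \<open>auto intro!: integrable_continuous_real continuous_intros intro: continuous_on_subset\<close>)
    also have "\<dots> \<le> integral {-9..9} W"
      using Wc by (intro integral_subset_le) (auto intro!: integrable_continuous_real intro: continuous_on_subset simp: W_def)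
    also note we
    finally have lower: "(1/5) ^ m * X \<le> m * integral {-9..9} (\<lambda>x. log_potential h e logk_s 0 x * W x) + c" .
    have "integral {-9..9} (\<lambda>x. log_potential h e logk_s 0 x * W x)
       \<le> integral {-9..9} (\<lambda>x. F * (log_potential h e logk_s 0 x * q x))"
    proof (rule integral_le)
      fix x :: real assume x: "x \<in> {-9..9}"
      have "\<bar>x\<bar>\<^sup>2 \<le> 9\<^sup>2" using x by (intro power_mono) auto
      then have "K * x\<^sup>2 \<le> K * 81" using K0 by (intro mult_left_mono) auto
      moreover have "m * (ln N - 3) \<le> m * log_potential h e logk 0 x"
        using log_potential_axis[OF h e(1) h1] e(4) by (intro mult_left_mono) (auto simp: N_def)
      ultimately have "2 * K * x\<^sup>2 - 2 * m * log_potential h e logk 0 x \<le> (162 * K + 6 * m) - (2 * m) * ln N"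
        by (simp add: algebra_simps)
      then have "exp (2 * K * x\<^sup>2 - 2 * m * log_potential h e logk 0 x) \<le> exp ((162 * K + 6 * m) - (2 * m) * ln N)" by simp
      also have "\<dots> = F"
        using N exp_of_nat_mult[of "2 * m" "ln N"] by (simp add: F_def exp_diff)
      finally have "exp (2 * K * x\<^sup>2 - 2 * m * log_potential h e logk 0 x) * q x \<le> F * q x"
        by (rule mult_right_mono) (simp add: q_def)
      then have "W x \<le> F * q x" unfolding W_def q_def by (simp only: mult_ac)
      moreover have "0 \<le> log_potential h e logk_s 0 x"
        by (rule log_potential_ge[OF h e(1) logk_continuous(3)]) (use h1 N N_def e in \<open>auto simp: logk_s_def\<close>)
      ultimately show "log_potential h e logk_s 0 x * W x \<le> F * (log_potential h e logk_s 0 x * q x)"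
        by (simp add: mult.left_commute[of F] mult_left_mono)
    qed (auto intro!: integrable_continuous_real continuous_intros Wc qc Pc logk_continuous)
    also have "\<dots> \<le> F * ((pi * Y + w) / N)" using mult_left_mono[OF e0(2)[OF e(1,2)], of F] F0 by simp
    finally have "m * integral {-9..9} (\<lambda>x. log_potential h e logk_s 0 x * W x) \<le> m * (F * ((pi * Y + w) / N))"
      by (rule mult_left_mono) simp
    with lower show ?thesis by (simp add: mult.assoc)
  qed
  have "(1/5) ^ m * X \<le> m * F * (pi * Y) / N + c"
  proof (rule field_le_epsilon)
    fix d :: real assume d: "0 < d"
    \<comment> \<open>Makes the contribution of the slack at most \<open>d\<close>; the summand 1
      keeps the denominator positive for m = 0 as well.\<close>
    define w where "w = d * N / (m * F + 1)"
    have mF: "0 < m * F + 1" using F0 by (simp add: add_nonneg_pos)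
    have "(1/5) ^ m * X \<le> m * F * (pi * Y + w) / N + c" using d N mF by (intro step) (simp add: w_def)
    also have "\<dots> = m * F * (pi * Y) / N + c + d * (m * F / (m * F + 1))"
      using N mF by (simp add: w_def add_divide_distrib distrib_left)
    also have "\<dots> \<le> m * F * (pi * Y) / N + c + d * 1" using d mF by (intro add_left_mono mult_left_mono) auto
    finally show "(1/5) ^ m * X \<le> m * F * (pi * Y) / N + c + d" by simp
  qed
  then have "5 ^ m * ((1/5) ^ m * X) \<le> 5 ^ m * (m * F * (pi * Y) / N + c)" by (intro mult_left_mono) auto
  moreover have "5 ^ m * ((1/5) ^ m * X) = X" by (simp add: power_divide)
  moreover have "5 ^ m * c = 288 * exp (162 * K + 18) * (5/49) ^ m * Q" by (simp add: c_def power_divide)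
  ultimately show ?thesis unfolding X_def Y_def F_def by (simp add: distrib_left)
qed

end

section \<open>Rescaling and energy bounds\<close>

lemma has_integral_affine:
  fixes g :: "real \<Rightarrow> real"
  assumes g: "(g has_integral i) {c + l * r..c + l * s}" and l: "0 < l"
  shows "((\<lambda>x. g (c + l * x)) has_integral i / l) {r..s}"
proof -
  have "(\<lambda>x. (1 / l) *\<^sub>R x + - ((1 / l) *\<^sub>R c)) ` cbox (c + l * r) (c + l * s)
     = cbox ((1/l) * (c + l * r) - c / l) ((1/l) * (c + l * s) - c / l) \<or> cbox r s = {} \<and> cbox (c + l * r) (c + l * s) = {}"
    using l image_affinity_cbox[of "1/l" "- ((1 / l) *\<^sub>R c)" "c + l * r" "c + l * s"] by (auto simp: divide_simps)
  then have "(\<lambda>x. (1 / l) *\<^sub>R x + - ((1 / l) *\<^sub>R c)) ` cbox (c + l * r) (c + l * s) = cbox r s"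
    using l by (auto simp: field_simps)
  then show ?thesis
    using has_integral_affinity[of g i "c + l * r" "c + l * s" l c] g l
    by (simp add: add.commute divide_inverse mult.commute)
qed

lemma acd_affine:
  assumes F: "acd (c + l * a) (c + l * b) F f" and l: "0 < l"
  shows "acd a b (\<lambda>x. F (c + l * x)) (\<lambda>x. l * f (c + l * x))"
proof -
  have "f integrable_on {c + l * a..c + l * b}" "(\<lambda>x. norm (f x)) integrable_on {c + l * a..c + l * b}"
    using F by (auto simp: acd_def absolutely_integrable_on_def)
  then have "(\<lambda>x. f (c + l * x)) integrable_on {a..b}" "(\<lambda>x. norm (f (c + l * x))) integrable_on {a..b}"
    using has_integral_affine[OF _ l] by (blast dest: integrable_integral)+
  then have 1: "(\<lambda>x. l * f (c + l * x)) absolutely_integrable_on {a..b}"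
    by (simp add: absolutely_integrable_on_def abs_mult integrable_on_mult_right)
  have "((\<lambda>x. l * f (c + l * x)) has_integral F (c + l * x) - F (c + l * a)) {a..x}" if x: "x \<in> {a..b}" for x
  proof -
    have "(f has_integral F (c + l * x) - F (c + l * a)) {c + l * a..c + l * x}"
      by (rule acd_has_integral[OF F]) (use x l in auto)
    from has_integral_mult_right[OF has_integral_affine[OF this l], of l] show ?thesis using l by simp
  qed
  with 1 show ?thesis by (simp add: acd_def)
qed

section \<open>The energy inequality on the line\<close>

lemma square_integrable_mult:
  fixes f g :: "real \<Rightarrow> real"
  assumes "f \<in> borel_measurable lebesgue" "integrable lebesgue (\<lambda>x. (f x)\<^sup>2)"
    and "g \<in> borel_measurable lebesgue" "integrable lebesgue (\<lambda>x. (g x)\<^sup>2)"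
  shows "integrable lebesgue (\<lambda>x. f x * g x)"
proof (rule Bochner_Integration.integrable_bound)
  show "integrable lebesgue (\<lambda>x. (f x)\<^sup>2 + (g x)\<^sup>2)" using assms by simp
  show "(\<lambda>x. f x * g x) \<in> borel_measurable lebesgue" using assms by (intro borel_measurable_times)
  have "\<bar>f x * g x\<bar> \<le> (f x)\<^sup>2 + (g x)\<^sup>2" for x
  proof -
    have "0 \<le> \<bar>f x\<bar> * \<bar>g x\<bar>" by simp
    moreover have "2 * (\<bar>f x\<bar> * \<bar>g x\<bar>) \<le> (f x)\<^sup>2 + (g x)\<^sup>2"
      using sum_squares_bound[of "\<bar>f x\<bar>" "\<bar>g x\<bar>"] by (simp add: mult.assoc)
    ultimately show ?thesis unfolding abs_mult by linarith
  qed
  then show "AE x in lebesgue. norm (f x * g x) \<le> norm ((f x)\<^sup>2 + (g x)\<^sup>2)" by simp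
qed

lemma continuous_borel_measurable_lebesgue:
  "continuous_on UNIV f \<Longrightarrow> f \<in> borel_measurable lebesgue" for f :: "real \<Rightarrow> real"
  by (simp add: borel_measurable_continuous_onI measurable_completion)

text \<open>Test the equation -g'' + V g = w with the square of a cutoff at scale k times g, and let
  k tend to infinity. Nothing is known about g' at infinity, so a fraction 1/k of the energy is
  sacrificed to absorb the cross term, which leaves the factor 1 - 1/k.\<close>

lemma energy_bound:
  fixes g g' w V :: "real \<Rightarrow> real"
  assumes g: "\<And>x. (g has_real_derivative g' x) (at x)" and g': "\<And>a b. acd a b g' (\<lambda>x. V x * g x - w x)"
    and w: "continuous_on UNIV w"
    and V: "V \<in> borel_measurable lebesgue" "\<And>R. \<exists>M. \<forall>x\<in>{-R..R}. \<bar>V x\<bar> \<le> M" "\<And>x. 0 \<le> V x"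
    and g2: "integrable lebesgue (\<lambda>x. (g x)\<^sup>2)" and w2: "integrable lebesgue (\<lambda>x. (w x)\<^sup>2)"
  shows "integral {-r..r} (\<lambda>x. (g' x)\<^sup>2 + V x * (g x)\<^sup>2) \<le> (LINT x|lebesgue. w x * g x)"
proof -
  have gc: "continuous_on S g" for S by (intro DERIV_continuous_on) (rule has_field_derivative_at_within[OF g])
  have g'c: "continuous_on {a..b} g'" for a b by (rule acd_continuous_on[OF g'])
  have wc: "continuous_on S w" for S using w by (rule continuous_on_subset) simp
  have gm: "g \<in> borel_measurable lebesgue" "w \<in> borel_measurable lebesgue"
    using gc wc by (auto intro: continuous_borel_measurable_lebesgue)
  have wg: "integrable lebesgue (\<lambda>x. w x * g x)" by (rule square_integrable_mult[OF gm(2) w2 gm(1) g2])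
  have Va: "(\<lambda>x. V x * f x) absolutely_integrable_on {a..b}" if "continuous_on {a..b} f" for f a b
  proof (intro absolutely_integrable_bounded_measurable_product_real absolutely_integrable_continuous_real that)
    show "V \<in> borel_measurable (lebesgue_on {a..b})" using V(1) by (rule measurable_restrict_space1)
    obtain M where "\<forall>x\<in>{-(\<bar>a\<bar> + \<bar>b\<bar>)..\<bar>a\<bar> + \<bar>b\<bar>}. \<bar>V x\<bar> \<le> M" using V(2) by blast
    moreover have "{a..b} \<subseteq> {-(\<bar>a\<bar> + \<bar>b\<bar>)..\<bar>a\<bar> + \<bar>b\<bar>}" by auto
    ultimately have "\<forall>x\<in>{a..b}. \<bar>V x\<bar> \<le> M" by blast
    then show "bounded (V ` {a..b})" unfolding bounded_iff by auto
  qed auto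
  have e_int: "(\<lambda>x. (g' x)\<^sup>2 + V x * (g x)\<^sup>2) integrable_on {a..b}" for a b
    by (intro integrable_add integrable_continuous_real continuous_intros g'c
        set_lebesgue_integral_eq_integral(1)[OF Va] gc)
  define X where "X = integral {-r..r} (\<lambda>x. (g' x)\<^sup>2 + V x * (g x)\<^sup>2)"
  define G where "G = (LINT x|lebesgue. (g x)\<^sup>2)"
  have e_nonneg: "0 \<le> (g' x)\<^sup>2 + V x * (g x)\<^sup>2" for x using V(3) by simp
  have X0: "0 \<le> X" unfolding X_def by (intro integral_nonneg e_int e_nonneg)
  define a where "a = (\<lambda>k::real. LINT x|lebesgue. (cutoff (x / k))\<^sup>2 * (w x * g x))"
  have step: "(1 - 1 / k) * X \<le> a k + (16 / k) * G" if k: "1 \<le> k" "r \<le> 8 * k" for k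
  proof -
    define \<eta> where "\<eta> = (\<lambda>x. cutoff (x / k))"
    define \<eta>' where "\<eta>' = (\<lambda>x. cutoff' (x / k) * (1 / k))"
    have \<eta>d: "(\<eta> has_real_derivative \<eta>' x) (at x)" for x
      unfolding \<eta>_def \<eta>'_def by (rule DERIV_chain2[OF cutoff_deriv]) (use k in \<open>auto intro!: derivative_eq_intros\<close>)
    have \<eta>c: "continuous_on S \<eta>" for S by (intro DERIV_continuous_on) (rule has_field_derivative_at_within[OF \<eta>d])
    have \<eta>'c: "continuous_on S \<eta>'" for S
    proof -
      have "continuous_on UNIV (\<lambda>x. cutoff' (x / k))"
        by (rule continuous_on_compose2[OF cutoff'_continuous[of UNIV]]) (use k in \<open>auto intro!: continuous_intros\<close>)
      then show ?thesis unfolding \<eta>'_def by (intro continuous_intros) (auto intro: continuous_on_subset)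
    qed
    have \<eta>0: "\<eta> x = 0" if "9 * k \<le> \<bar>x\<bar>" for x
    proof -
      have "9 \<le> \<bar>x / k\<bar>" using that k by (simp add: field_simps)
      then have "9 \<le> x / k \<or> x / k \<le> - 9" by linarith
      then have "1 \<le> max 0 (x / k - 8) \<or> 1 \<le> max 0 (- (x / k) - 8)" by auto
      then have "1 \<le> cutoff_excess (x / k)"
        unfolding cutoff_excess_def by (auto intro: add_increasing add_increasing2 one_le_power)
      then show ?thesis by (simp add: \<eta>_def cutoff_def)
    qed
    have gd: "acd (-9*k) (9*k) g g'"
      by (intro acd_deriv has_field_derivative_at_within[OF g] g'c)
    define H where "H = (\<lambda>x. (\<eta> x)\<^sup>2 * g x)"
    define H' where "H' = (\<lambda>x. 2 * \<eta> x * \<eta>' x * g x + (\<eta> x)\<^sup>2 * g' x)"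
    have Hd: "(H has_real_derivative H' x) (at x)" for x
      unfolding H_def H'_def power2_eq_square
      by (rule DERIV_cong[OF DERIV_mult[OF DERIV_mult[OF \<eta>d \<eta>d] g]]) (simp add: algebra_simps)
    have H'c: "continuous_on {-9*k..9*k} H'" unfolding H'_def by (intro continuous_intros \<eta>c \<eta>'c gc g'c)
    then have "bounded (H' ` {-9*k..9*k})" by (intro compact_imp_bounded compact_continuous_image) auto
    then obtain M where M: "\<And>x. x \<in> {-9*k..9*k} \<Longrightarrow> \<bar>H' x\<bar> \<le> M" unfolding bounded_iff by fastforce
    have HA: "acd (-9*k) (9*k) H H'" by (intro acd_deriv has_field_derivative_at_within[OF Hd] H'c)
    have zero: "((\<lambda>x. (V x * g x - w x) * H x + g' x * H' x) has_integral 0) {-9*k..9*k}"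
      using acd_has_integral[OF acd_mult[OF g' HA M], of "-9*k" "9*k"] k \<eta>0[of "9*k"] \<eta>0[of "-9*k"] by (simp add: H_def)
    have i1: "(\<lambda>x. (\<eta> x)\<^sup>2 * (w x * g x)) integrable_on {-9*k..9*k}" and i2: "(\<lambda>x. (g x)\<^sup>2) integrable_on {-9*k..9*k}"
      by (intro integrable_continuous_real continuous_intros \<eta>c wc gc)+
    have ak: "a k = integral {-9*k..9*k} (\<lambda>x. (\<eta> x)\<^sup>2 * (w x * g x))"
    proof -
      have "(\<lambda>x. (\<eta> x)\<^sup>2 * (w x * g x)) absolutely_integrable_on {-(9*k)..9*k}"
        by (intro absolutely_integrable_continuous_real continuous_intros \<eta>c wc gc)
      from integral_eq_integral_support(1)[OF this] \<eta>0 show ?thesis by (simp add: a_def \<eta>_def)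
    qed
    have Gk: "integral {-9*k..9*k} (\<lambda>x. (g x)\<^sup>2) \<le> G"
    proof -
      have "set_integrable lebesgue {-9*k..9*k} (\<lambda>x. (g x)\<^sup>2)"
        by (intro absolutely_integrable_continuous_real continuous_intros gc)
      then have "integral {-9*k..9*k} (\<lambda>x. (g x)\<^sup>2) = (LINT x:{-9*k..9*k}|lebesgue. (g x)\<^sup>2)"
        by (rule set_lebesgue_integral_eq_integral(2)[symmetric])
      also have "\<dots> \<le> G" unfolding set_lebesgue_integral_def G_def
        using g2 by (intro integral_mono' ) (auto simp: indicator_def)
      finally show ?thesis .
    qed
    have upper: "((\<lambda>x. (\<eta> x)\<^sup>2 * (w x * g x) + (16 / k) * (g x)\<^sup>2 + ((V x * g x - w x) * H x + g' x * H' x)) has_integral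
      (a k + (16 / k) * integral {-9*k..9*k} (\<lambda>x. (g x)\<^sup>2) + 0)) {-9*k..9*k}"
      unfolding ak by (intro has_integral_add has_integral_mult_right zero integrable_integral i1 i2)
    have lower: "((\<lambda>x. (1 - 1 / k) * (if x \<in> {-r..r} then (g' x)\<^sup>2 + V x * (g x)\<^sup>2 else 0)) has_integral (1 - 1 / k) * X) {-9*k..9*k}"
    proof (intro has_integral_mult_right)
      have sub: "{-r..r} \<inter> {-9*k..9*k} = {-r..r}" using k by auto
      show "((\<lambda>x. if x \<in> {-r..r} then (g' x)\<^sup>2 + V x * (g x)\<^sup>2 else 0) has_integral X) {-9*k..9*k}"
        unfolding has_integral_restrict_Int sub X_def by (rule integrable_integral[OF e_int])
    qed
    have le: "(1 - 1 / k) * (if x \<in> {-r..r} then (g' x)\<^sup>2 + V x * (g x)\<^sup>2 else 0)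
        \<le> (\<eta> x)\<^sup>2 * (w x * g x) + (16 / k) * (g x)\<^sup>2 + ((V x * g x - w x) * H x + g' x * H' x)" for x
    proof -
      have k0: "0 \<le> 1 - 1 / k" using k by simp
      have "(if x \<in> {-r..r} then (g' x)\<^sup>2 + V x * (g x)\<^sup>2 else 0) \<le> (\<eta> x)\<^sup>2 * ((g' x)\<^sup>2 + V x * (g x)\<^sup>2)"
      proof (cases "x \<in> {-r..r}")
        case True
        then have "\<bar>x / k\<bar> \<le> 8" using k by (simp add: abs_le_iff field_simps)
        then show ?thesis using True by (simp add: \<eta>_def cutoff_eq_1)
      next
        case False
        have "0 \<le> (\<eta> x)\<^sup>2 * ((g' x)\<^sup>2 + V x * (g x)\<^sup>2)"
          using e_nonneg by (intro mult_nonneg_nonneg) auto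
        then show ?thesis using False by (simp only: if_False)
      qed
      then have 1: "(1 - 1 / k) * (if x \<in> {-r..r} then (g' x)\<^sup>2 + V x * (g x)\<^sup>2 else 0)
          \<le> (1 - 1 / k) * ((\<eta> x)\<^sup>2 * ((g' x)\<^sup>2 + V x * (g x)\<^sup>2))" using k0 by (rule mult_left_mono)
      have 2: "(1 - 1 / k) * ((\<eta> x)\<^sup>2 * ((g' x)\<^sup>2 + V x * (g x)\<^sup>2))
         \<le> (\<eta> x)\<^sup>2 * ((g' x)\<^sup>2 + V x * (g x)\<^sup>2) - (1 / k) * (\<eta> x * g' x)\<^sup>2"
      proof -
        have "0 \<le> (1 / k) * ((\<eta> x)\<^sup>2 * (V x * (g x)\<^sup>2))" using k V(3) by simp
        then show ?thesis by (simp add: algebra_simps power_mult_distrib)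
      qed
      \<comment> \<open>Young's inequality with weight \<open>k\<close> for the cross term. The
        derivative of the rescaled cutoff is at most 4/k in modulus, so the remainder is (16/k)
        g^2.\<close>
      have "(k * \<eta>' x)\<^sup>2 \<le> 16" using cutoff'_bound[of "x / k"] k by (simp add: \<eta>'_def)
      then have "(1 / k) * ((k * \<eta>' x)\<^sup>2 * (g x)\<^sup>2) \<le> (1 / k) * (16 * (g x)\<^sup>2)"
        using k by (intro mult_left_mono mult_right_mono) auto
      moreover have "0 \<le> (1 / k) * (\<eta> x * g' x + k * \<eta>' x * g x)\<^sup>2" using k by simp
      moreover have "(1 / k) * (\<eta> x * g' x + k * \<eta>' x * g x)\<^sup>2
         = (1 / k) * (\<eta> x * g' x)\<^sup>2 + 2 * \<eta> x * \<eta>' x * g x * g' x + (1 / k) * ((k * \<eta>' x)\<^sup>2 * (g x)\<^sup>2)"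
        using k by (simp add: power2_eq_square field_simps)
      ultimately have 3: "- (1 / k) * (\<eta> x * g' x)\<^sup>2 \<le> 2 * \<eta> x * \<eta>' x * g x * g' x + (16 / k) * (g x)\<^sup>2" by simp
      have 4: "(\<eta> x)\<^sup>2 * (w x * g x) + ((V x * g x - w x) * H x + g' x * H' x)
         = (\<eta> x)\<^sup>2 * ((g' x)\<^sup>2 + V x * (g x)\<^sup>2) + 2 * \<eta> x * \<eta>' x * g x * g' x"
        by (simp add: H_def H'_def power2_eq_square algebra_simps)
      show ?thesis using 1 2 3 4 by linarith
    qed
    have "(1 - 1 / k) * X \<le> a k + (16 / k) * integral {-9*k..9*k} (\<lambda>x. (g x)\<^sup>2) + 0"
      by (rule has_integral_le[OF lower upper le])
    moreover have "(16 / k) * integral {-9*k..9*k} (\<lambda>x. (g x)\<^sup>2) \<le> (16 / k) * G" using Gk k by (intro mult_left_mono) auto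
    ultimately show ?thesis by linarith
  qed
  have lim_a: "(\<lambda>n. a (real (Suc n))) \<longlonglongrightarrow> (LINT x|lebesgue. w x * g x)"
    unfolding a_def
  proof (rule integral_dominated_convergence[OF _ _ integrable_norm[OF wg]])
    show "(\<lambda>x. w x * g x) \<in> borel_measurable lebesgue" using gm by (intro borel_measurable_times)
    show "(\<lambda>x. (cutoff (x / real (Suc n)))\<^sup>2 * (w x * g x)) \<in> borel_measurable lebesgue" for n
    proof -
      have "continuous_on UNIV (\<lambda>x. cutoff (x / real (Suc n)))"
        by (rule continuous_on_compose2[OF cutoff_continuous[of UNIV]]) (auto intro!: continuous_intros)
      then show ?thesis by (intro borel_measurable_times borel_measurable_power continuous_borel_measurable_lebesgue wc gc)
    qed
    show "AE x in lebesgue. (\<lambda>n. (cutoff (x / real (Suc n)))\<^sup>2 * (w x * g x)) \<longlonglongrightarrow> w x * g x"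
    proof (rule AE_I2)
      fix x :: real
      obtain n0 :: nat where n0: "\<bar>x\<bar> \<le> real n0" using real_arch_simple by blast
      have "w x * g x = (cutoff (x / real (Suc n)))\<^sup>2 * (w x * g x)" if "n0 \<le> n" for n
      proof -
        have "\<bar>x / real (Suc n)\<bar> \<le> 8" using n0 that by (simp add: abs_divide field_simps)
        then show ?thesis by (simp add: cutoff_eq_1)
      qed
      then have "\<forall>\<^sub>F n in sequentially. w x * g x = (cutoff (x / real (Suc n)))\<^sup>2 * (w x * g x)"
        by (intro eventually_sequentiallyI[of n0])
      then show "(\<lambda>n. (cutoff (x / real (Suc n)))\<^sup>2 * (w x * g x)) \<longlonglongrightarrow> w x * g x"
        by (rule Lim_transform_eventually[OF tendsto_const])
    qed
    show "AE x in lebesgue. norm ((cutoff (x / real (Suc n)))\<^sup>2 * (w x * g x)) \<le> norm (w x * g x)" for n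
    proof (rule AE_I2)
      fix x
      have "(cutoff (x / real (Suc n)))\<^sup>2 \<le> 1" using cutoff_le_1 cutoff_nonneg by (simp add: power_le_one)
      then have "(cutoff (x / real (Suc n)))\<^sup>2 * \<bar>w x * g x\<bar> \<le> 1 * \<bar>w x * g x\<bar>" by (intro mult_right_mono) auto
      then show "norm ((cutoff (x / real (Suc n)))\<^sup>2 * (w x * g x)) \<le> norm (w x * g x)" by (simp add: abs_mult)
    qed
  qed
  have lim0: "(\<lambda>n. 1 / real (Suc n)) \<longlonglongrightarrow> 0" by (rule LIMSEQ_Suc[OF lim_1_over_n])
  have l1: "(\<lambda>n. (1 - 1 / real (Suc n)) * X) \<longlonglongrightarrow> (1 - 0) * X" by (intro tendsto_intros lim0)
  have l2: "(\<lambda>n. a (real (Suc n)) + (16 * (1 / real (Suc n))) * G) \<longlonglongrightarrow> (LINT x|lebesgue. w x * g x) + (16 * 0) * G"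
    by (intro tendsto_intros lim_a lim0)
  obtain n0 :: nat where n0: "r \<le> real n0" using real_arch_simple by blast
  have "(1 - 0) * X \<le> (LINT x|lebesgue. w x * g x) + (16 * 0) * G"
  proof (rule LIMSEQ_le[OF l1 l2])
    show "\<exists>N. \<forall>n\<ge>N. (1 - 1 / real (Suc n)) * X \<le> a (real (Suc n)) + (16 * (1 / real (Suc n))) * G"
    proof (intro exI[of _ n0] allI impI)
      fix n assume "n0 \<le> n"
      then have "r \<le> 8 * real (Suc n)" using n0 by simp
      from step[OF _ this] show "(1 - 1 / real (Suc n)) * X \<le> a (real (Suc n)) + (16 * (1 / real (Suc n))) * G" by simp
    qed
  qed
  then show ?thesis by (simp add: X_def)
qed

section \<open>Eigenfunctions and spectral families\<close>

text \<open>Caratheodory solutions of -g'' + V g = E g: as \<open>V\<close> is only measurable,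
  \<open>g'\<close> is a primitive of (V - E) g and need not be differentiable everywhere.\<close>

definition solves :: "(real \<Rightarrow> real) \<Rightarrow> real \<Rightarrow> (real \<Rightarrow> real) \<Rightarrow> (real \<Rightarrow> real) \<Rightarrow> bool" where
  "solves V E g g' \<longleftrightarrow> (\<forall>x. (g has_real_derivative g' x) (at x)) \<and>
     (\<forall>a b. acd a b g' (\<lambda>x. (V x - E) * g x))"

lemma solves_lincomb:
  assumes "solves V E f f'" "solves V E g g'"
  shows "solves V E (\<lambda>x. a * f x + b * g x) (\<lambda>x. a * f' x + b * g' x)"
  unfolding solves_def
proof (intro conjI allI)
  show "((\<lambda>x. a * f x + b * g x) has_real_derivative a * f' x + b * g' x) (at x)" for x
    using assms unfolding solves_def by (intro DERIV_add DERIV_cmult) auto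
  show "acd s t (\<lambda>x. a * f' x + b * g' x) (\<lambda>x. (V x - E) * (a * f x + b * g x))" for s t
  proof -
    have "acd s t (\<lambda>x. a * f' x + b * g' x) (\<lambda>x. a * ((V x - E) * f x) + b * ((V x - E) * g x))"
      using assms unfolding solves_def by (intro acd_add acd_cmult) auto
    then show ?thesis by (rule acd_cong) (simp_all add: algebra_simps)
  qed
qed

lemma solves_continuous:
  assumes "solves V E g g'"
  shows "continuous_on S g" "continuous_on S g'"
proof -
  have "(g has_real_derivative g' x) (at x within S)" for x
    using assms by (auto simp: solves_def intro: has_field_derivative_at_within)
  then show "continuous_on S g" by (rule DERIV_continuous_on)
  have "continuous_on UNIV g'"
  proof (intro continuous_at_imp_continuous_on ballI)
    fix x
    have "continuous_on {x - 1..x + 1} g'" using assms by (auto simp: solves_def intro: acd_continuous_on)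
    then show "isCont g' x" by (rule continuous_on_interior) simp
  qed
  then show "continuous_on S g'" by (rule continuous_on_subset) simp
qed

section \<open>Continuously differentiable representatives of eigenfunctions\<close>

lemma L2_D:
  assumes "\<phi> \<in> L2"
  shows "\<phi> \<in> borel_measurable lebesgue" "integrable lebesgue (\<lambda>x. (cmod (\<phi> x))\<^sup>2)"
    "integrable lebesgue (\<lambda>x. (Re (\<phi> x))\<^sup>2)" "integrable lebesgue (\<lambda>x. (Im (\<phi> x))\<^sup>2)"
proof -
  show 1: "\<phi> \<in> borel_measurable lebesgue" and 2: "integrable lebesgue (\<lambda>x. (cmod (\<phi> x))\<^sup>2)"
    using assms by (auto simp: L2_def)
  show "integrable lebesgue (\<lambda>x. (Re (\<phi> x))\<^sup>2)" "integrable lebesgue (\<lambda>x. (Im (\<phi> x))\<^sup>2)"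
    by (rule Bochner_Integration.integrable_bound[OF 2]; use 1 in \<open>auto simp: cmod_power2\<close>)+
qed

lemma L2_mult_integrable:
  assumes "\<phi> \<in> L2" "\<psi> \<in> L2"
  shows "integrable lebesgue (\<lambda>x. \<phi> x * cnj (\<psi> x))"
proof (rule Bochner_Integration.integrable_bound)
  show "integrable lebesgue (\<lambda>x. (cmod (\<phi> x))\<^sup>2 + (cmod (\<psi> x))\<^sup>2)"
    using assms by (intro Bochner_Integration.integrable_add L2_D)
  show "(\<lambda>x. \<phi> x * cnj (\<psi> x)) \<in> borel_measurable lebesgue"
  proof -
    have "(\<lambda>x. cnj (\<psi> x)) \<in> borel_measurable lebesgue"
      using L2_D(1)[OF assms(2)] by (rule borel_measurable_continuous_on[OF continuous_on_cnj[OF continuous_on_id]])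
    then show ?thesis using L2_D(1)[OF assms(1)] by (intro borel_measurable_times)
  qed
  show "AE x in lebesgue. norm (\<phi> x * cnj (\<psi> x)) \<le> norm ((cmod (\<phi> x))\<^sup>2 + (cmod (\<psi> x))\<^sup>2)"
  proof (rule AE_I2)
    fix x
    have "0 \<le> cmod (\<phi> x) * cmod (\<psi> x)" by simp
    moreover have "2 * (cmod (\<phi> x) * cmod (\<psi> x)) \<le> (cmod (\<phi> x))\<^sup>2 + (cmod (\<psi> x))\<^sup>2"
      using sum_squares_bound[of "cmod (\<phi> x)" "cmod (\<psi> x)"] by (simp add: mult.assoc)
    moreover have "norm (\<phi> x * cnj (\<psi> x)) = cmod (\<phi> x) * cmod (\<psi> x)"
      "norm ((cmod (\<phi> x))\<^sup>2 + (cmod (\<psi> x))\<^sup>2) = (cmod (\<phi> x))\<^sup>2 + (cmod (\<psi> x))\<^sup>2"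
      by (simp_all add: norm_mult)
    ultimately show "norm (\<phi> x * cnj (\<psi> x)) \<le> norm ((cmod (\<phi> x))\<^sup>2 + (cmod (\<psi> x))\<^sup>2)"
      by linarith
  qed
qed

text \<open>By self-adjointness the eigenpair also lies in the graph of the adjoint, and pairing it
  with test functions is exactly the weak equation. \<open>V\<close>, \<open>E\<close> and the test
  functions are real, so real and imaginary parts separate.\<close>

lemma eigenfunction_regular:
  assumes H: "is_schroedinger_operator V H" and \<phi>: "\<phi> \<in> L2" and eig: "(\<phi>, \<lambda>x. of_real E * \<phi> x) \<in> H"
    and V: "V \<in> borel_measurable lebesgue" "\<And>R. \<exists>M. \<forall>x\<in>{-R..R}. \<bar>V x\<bar> \<le> M"
  shows "\<exists>r r' i i'. solves V E r r' \<and> solves V E i i' \<and> (AE x in lebesgue. \<phi> x = Complex (r x) (i x))"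
proof -
  have weak: "(LINT x|lebesgue. (- f2 x + V x * f x) * Re (\<phi> x)) = (LINT x|lebesgue. f x * (E * Re (\<phi> x)))
      \<and> (LINT x|lebesgue. (- f2 x + V x * f x) * Im (\<phi> x)) = (LINT x|lebesgue. f x * (E * Im (\<phi> x)))"
    if f: "\<And>n. times_differentiable n f" "\<And>x. (f has_real_derivative f1 x) (at x)"
      "\<And>x. (f1 has_real_derivative f2 x) (at x)" "continuous_on UNIV f2" "\<And>x. R < \<bar>x\<bar> \<Longrightarrow> f x = 0" for f f1 f2 R
  proof -
    let ?F = "\<lambda>x. complex_of_real (f x)"
    define k where "k = (\<lambda>x. - f2 x + V x * f x)"
    have fc: "continuous_on UNIV f" by (rule DERIV_continuous_on[OF f(2)])
    have f10: "f1 x = 0" if "R < \<bar>x\<bar>" for x by (rule deriv_vanishes_outside[OF f(5) f(2) that])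
    have f20: "f2 x = 0" if "R < \<bar>x\<bar>" for x by (rule deriv_vanishes_outside[OF f10 f(3) that])
    have "?F \<in> schwartz" by (rule schwartz_of_real[OF f(1) f(5)])
    moreover have v1: "vderiv ?F = (\<lambda>x. complex_of_real (f1 x))" using vderiv_of_real(1)[OF f(2)] by blast
    moreover have "vderiv (\<lambda>x. complex_of_real (f1 x)) = (\<lambda>x. complex_of_real (f2 x))"
      using vderiv_of_real(1)[OF f(3)] by blast
    ultimately have "(?F, \<lambda>x. - complex_of_real (f2 x) + complex_of_real (V x) * complex_of_real (f x)) \<in> H"
      using H[unfolded is_schroedinger_operator_def, THEN conjunct2, THEN bspec, of ?F] by (simp only:)
    then have FH: "(?F, \<lambda>x. complex_of_real (k x)) \<in> H" by (simp add: k_def)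
    have "(\<phi>, \<lambda>x. of_real E * \<phi> x) \<in> adjoint_operator H"
      using H eig by (simp add: is_schroedinger_operator_def self_adjoint_def)
    then have inner: "(LINT x|lebesgue. complex_of_real (k x) * cnj (\<phi> x)) = (LINT x|lebesgue. ?F x * cnj (of_real E * \<phi> x))"
      and L2: "(\<lambda>x. of_real E * \<phi> x) \<in> L2"
      using FH by (auto simp: adjoint_operator_def L2_inner_def)
    \<comment> \<open>Membership in \<open>L2\<close> makes the pairings integrable, so that real
      and imaginary parts can be taken under the integral.\<close>
    have inL2: "(\<lambda>x. complex_of_real (g x)) \<in> L2"
      if gm: "g \<in> borel_measurable lebesgue" and gb: "\<exists>M. \<forall>x\<in>{-R..R}. \<bar>g x\<bar> \<le> M" and g0: "\<And>x. R < \<bar>x\<bar> \<Longrightarrow> g x = 0" for g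
    proof -
      obtain M where M: "\<And>x. x \<in> {-R..R} \<Longrightarrow> \<bar>g x\<bar> \<le> M" using gb by blast
      have "integrable lebesgue (\<lambda>x. (g x)\<^sup>2)"
      proof (rule Bochner_Integration.integrable_bound)
        show "integrable lebesgue (\<lambda>x. M\<^sup>2 * indicat_real {-R..R} x)"
          by (intro integrable_mult_right) (simp add: integrable_indicator_iff emeasure_lborel_Icc_eq)
        show "(\<lambda>x. (g x)\<^sup>2) \<in> borel_measurable lebesgue" using gm by (rule borel_measurable_power)
        show "AE x in lebesgue. norm ((g x)\<^sup>2) \<le> norm (M\<^sup>2 * indicat_real {-R..R} x)"
        proof (rule AE_I2)
          fix x
          show "norm ((g x)\<^sup>2) \<le> norm (M\<^sup>2 * indicat_real {-R..R} x)"
          proof (cases "x \<in> {-R..R}")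
            case True
            have "\<bar>g x\<bar>\<^sup>2 \<le> M\<^sup>2" using M[OF True] by (intro power_mono) auto
            then show ?thesis using True by simp
          next
            case False
            then have "\<not> (- R \<le> x \<and> x \<le> R)" by simp
            then have "R < \<bar>x\<bar>" by linarith
            then show ?thesis using g0 by simp
          qed
        qed
      qed
      moreover have "(\<lambda>x. complex_of_real (g x)) \<in> borel_measurable lebesgue" using gm by simp
      ultimately show ?thesis by (simp add: L2_def)
    qed
    have bnd: "\<exists>M. \<forall>x\<in>{-R..R}. \<bar>g x\<bar> \<le> M" if "continuous_on UNIV g" for g :: "real \<Rightarrow> real"
    proof -
      have "bounded (g ` {-R..R})"
        using that by (intro compact_imp_bounded compact_continuous_image) (auto intro: continuous_on_subset)
      then show ?thesis unfolding bounded_iff by fastforce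
    qed
    have FL: "?F \<in> L2" by (rule inL2[OF continuous_borel_measurable_lebesgue[OF fc] bnd[OF fc] f(5)])
    have kL: "(\<lambda>x. complex_of_real (k x)) \<in> L2"
    proof (rule inL2)
      show "k \<in> borel_measurable lebesgue" unfolding k_def
        by (intro borel_measurable_add borel_measurable_uminus borel_measurable_times V(1) continuous_borel_measurable_lebesgue fc f(4))
      obtain M1 where M1: "\<And>x. x \<in> {-R..R} \<Longrightarrow> \<bar>f x\<bar> \<le> M1" using bnd[OF fc] by blast
      obtain M2 where M2: "\<And>x. x \<in> {-R..R} \<Longrightarrow> \<bar>f2 x\<bar> \<le> M2" using bnd[OF f(4)] by blast
      obtain M3 where M3: "\<And>x. x \<in> {-R..R} \<Longrightarrow> \<bar>V x\<bar> \<le> M3" using V(2)[of R] by blast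
      have "\<bar>k x\<bar> \<le> M2 + M3 * M1" if x: "x \<in> {-R..R}" for x
      proof -
        have "\<bar>V x\<bar> * \<bar>f x\<bar> \<le> M3 * M1"
          by (rule mult_mono[OF M3[OF x] M1[OF x] order.trans[OF abs_ge_zero M3[OF x]] abs_ge_zero])
        then have "\<bar>V x * f x\<bar> \<le> M3 * M1" by (simp add: abs_mult)
        then show ?thesis using M2[OF x] unfolding k_def by linarith
      qed
      then show "\<exists>M. \<forall>x\<in>{-R..R}. \<bar>k x\<bar> \<le> M" by blast
      show "k x = 0" if "R < \<bar>x\<bar>" for x using f20[OF that] f(5)[OF that] by (simp add: k_def)
    qed
    note i1 = L2_mult_integrable[OF kL \<phi>] and i2 = L2_mult_integrable[OF FL L2]
    have "(LINT x|lebesgue. Re (complex_of_real (k x) * cnj (\<phi> x))) = (LINT x|lebesgue. Re (?F x * cnj (of_real E * \<phi> x)))"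
      "(LINT x|lebesgue. Im (complex_of_real (k x) * cnj (\<phi> x))) = (LINT x|lebesgue. Im (?F x * cnj (of_real E * \<phi> x)))"
      using inner integral_Re[OF i1] integral_Re[OF i2] integral_Im[OF i1] integral_Im[OF i2] by simp_all
    then show ?thesis by (simp add: k_def)
  qed
  have m: "(\<lambda>x. Re (\<phi> x)) \<in> borel_measurable lebesgue" "(\<lambda>x. Im (\<phi> x)) \<in> borel_measurable lebesgue"
    using L2_D(1)[OF \<phi>] by simp_all
  have "\<exists>\<psi> \<psi>'. (AE x in lebesgue. Re (\<phi> x) = \<psi> x) \<and> (\<forall>x. (\<psi> has_real_derivative \<psi>' x) (at x)) \<and>
    (\<forall>a b. acd a b \<psi>' (\<lambda>x. (V x - E) * \<psi> x))"
    by (rule weak_eigenfunction_regular[OF m(1) L2_D(3)[OF \<phi>] V]) (rule weak[THEN conjunct1]; assumption)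
  then obtain r r' where r: "AE x in lebesgue. Re (\<phi> x) = r x" "solves V E r r'"
    unfolding solves_def by blast
  have "\<exists>\<psi> \<psi>'. (AE x in lebesgue. Im (\<phi> x) = \<psi> x) \<and> (\<forall>x. (\<psi> has_real_derivative \<psi>' x) (at x)) \<and>
    (\<forall>a b. acd a b \<psi>' (\<lambda>x. (V x - E) * \<psi> x))"
    by (rule weak_eigenfunction_regular[OF m(2) L2_D(4)[OF \<phi>] V]) (rule weak[THEN conjunct2]; assumption)
  then obtain i i' where i: "AE x in lebesgue. Im (\<phi> x) = i x" "solves V E i i'"
    unfolding solves_def by blast
  have "AE x in lebesgue. \<phi> x = Complex (r x) (i x)"
    using r(1) i(1) by eventually_elim (simp add: complex_eq_iff)
  then show ?thesis using r(2) i(2) by blast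
qed

text \<open>\<open>f k\<close> and \<open>g k\<close> are the real and imaginary parts of \<open>c\<^sub>k \<phi>\<^sub>k\<close>, and \<open>b k = |c\<^sub>k|\<^sup>2\<close>.\<close>

locale spectral_family =
  fixes V :: "real \<Rightarrow> real" and S :: "nat set" and \<mu> b :: "nat \<Rightarrow> real" and l :: real
    and f f' g g' :: "nat \<Rightarrow> real \<Rightarrow> real"
  assumes fin: "finite S" and \<mu>: "\<And>k. k \<in> S \<Longrightarrow> 0 < \<mu> k \<and> \<mu> k \<le> l" and b: "\<And>k. k \<in> S \<Longrightarrow> 0 \<le> b k"
    and V: "V \<in> borel_measurable lebesgue" "\<And>R. \<exists>M. \<forall>x\<in>{-R..R}. \<bar>V x\<bar> \<le> M" "\<And>x. 0 \<le> V x"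
    and f: "\<And>k. k \<in> S \<Longrightarrow> solves V ((\<mu> k)\<^sup>2) (f k) (f' k)" "\<And>k. k \<in> S \<Longrightarrow> integrable lebesgue (\<lambda>x. (f k x)\<^sup>2)"
    and g: "\<And>k. k \<in> S \<Longrightarrow> solves V ((\<mu> k)\<^sup>2) (g k) (g' k)" "\<And>k. k \<in> S \<Longrightarrow> integrable lebesgue (\<lambda>x. (g k x)\<^sup>2)"
    and orth: "\<And>j k. j \<in> S \<Longrightarrow> k \<in> S \<Longrightarrow> (LINT x|lebesgue. f j x * f k x + g j x * g k x) = (if j = k then b k else 0)"
begin

text \<open>With a k = F(\<open>\<mu> k\<close>) for a real function F, and h = f or g, this is the
  real or imaginary part of F(sqrt H) applied to the given function. The time slices and the action
  of H are of this form.\<close>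

definition lincomb :: "(nat \<Rightarrow> real) \<Rightarrow> (nat \<Rightarrow> real \<Rightarrow> real) \<Rightarrow> real \<Rightarrow> real" where
  "lincomb a h x = (\<Sum>k\<in>S. a k * h k x)"

lemma continuous: "k \<in> S \<Longrightarrow> continuous_on X (f k)" "k \<in> S \<Longrightarrow> continuous_on X (f' k)"
  "k \<in> S \<Longrightarrow> continuous_on X (g k)" "k \<in> S \<Longrightarrow> continuous_on X (g' k)"
  using f(1) g(1) by (auto intro: solves_continuous)

lemma product_integrable:
  assumes "j \<in> S" "k \<in> S"
  shows "integrable lebesgue (\<lambda>x. f j x * f k x)" "integrable lebesgue (\<lambda>x. g j x * g k x)"
  using assms by (auto intro!: square_integrable_mult continuous_borel_measurable_lebesgue continuous f(2) g(2))

lemma lincomb_product: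
  "lincomb a h x * lincomb c h x = (\<Sum>j\<in>S. \<Sum>k\<in>S. a j * c k * (h j x * h k x))"
  unfolding lincomb_def sum_product by (intro sum.cong refl) (simp add: mult_ac)

lemma lincomb_integrable:
  "integrable lebesgue (\<lambda>x. lincomb a f x * lincomb c f x)" "integrable lebesgue (\<lambda>x. lincomb a g x * lincomb c g x)"
  unfolding lincomb_product
  by (auto intro!: Bochner_Integration.integrable_sum integrable_mult_right product_integrable)

lemma lincomb_continuous:
  "continuous_on X (lincomb a f)" "continuous_on X (lincomb a f')" "continuous_on X (lincomb a g)" "continuous_on X (lincomb a g')"
  unfolding lincomb_def[abs_def] by (intro continuous_intros continuous; assumption)+

text \<open>Complex orthogonality controls only the sum of the products of real parts and of
  imaginary parts; this is why \<open>f\<close> and \<open>g\<close> are carried along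
  together.\<close>

lemma lincomb_inner:
  "(LINT x|lebesgue. lincomb a f x * lincomb c f x) + (LINT x|lebesgue. lincomb a g x * lincomb c g x) = (\<Sum>k\<in>S. a k * c k * b k)"
proof -
  have "(LINT x|lebesgue. lincomb a f x * lincomb c f x) + (LINT x|lebesgue. lincomb a g x * lincomb c g x)
     = (LINT x|lebesgue. lincomb a f x * lincomb c f x + lincomb a g x * lincomb c g x)"
    by (rule Bochner_Integration.integral_add[symmetric]) (rule lincomb_integrable)+
  also have "\<dots> = (LINT x|lebesgue. (\<Sum>j\<in>S. \<Sum>k\<in>S. a j * c k * (f j x * f k x + g j x * g k x)))"
    unfolding lincomb_product by (simp add: sum.distrib[symmetric] distrib_left)
  also have "\<dots> = (\<Sum>j\<in>S. \<Sum>k\<in>S. a j * c k * (LINT x|lebesgue. f j x * f k x + g j x * g k x))"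
    by (subst Bochner_Integration.integral_sum, (intro Bochner_Integration.integrable_sum integrable_mult_right Bochner_Integration.integrable_add product_integrable; assumption))
       (intro sum.cong refl, subst Bochner_Integration.integral_sum,
        (intro integrable_mult_right Bochner_Integration.integrable_add product_integrable; assumption), simp)
  also have "\<dots> = (\<Sum>j\<in>S. \<Sum>k\<in>S. if j = k then a j * c k * b k else 0)"
    by (intro sum.cong refl) (simp add: orth)
  also have "\<dots> = (\<Sum>j\<in>S. a j * c j * b j)"
    using fin by (intro sum.cong refl) (simp add: sum.delta)
  finally show ?thesis .
qed

text \<open>The energy is bounded by the pairing with the image under H, and H multiplies the k-th
  coefficient by the square of \<open>\<mu> k\<close>, which is the meaning of
  \<open>c\<close>.\<close>

lemma lincomb_energy:
  "integral {-r..r} (\<lambda>x. (lincomb a f' x)\<^sup>2 + V x * (lincomb a f x)\<^sup>2)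
   + integral {-r..r} (\<lambda>x. (lincomb a g' x)\<^sup>2 + V x * (lincomb a g x)\<^sup>2) \<le> (\<Sum>k\<in>S. (a k * \<mu> k)\<^sup>2 * b k)"
proof -
  define c where "c = (\<lambda>k. a k * (\<mu> k)\<^sup>2)"
  have E: "integral {-r..r} (\<lambda>x. (lincomb a h' x)\<^sup>2 + V x * (lincomb a h x)\<^sup>2) \<le> (LINT x|lebesgue. lincomb c h x * lincomb a h x)"
    if h: "\<And>k. k \<in> S \<Longrightarrow> solves V ((\<mu> k)\<^sup>2) (h k) (h' k)"
      and i: "\<And>a c. integrable lebesgue (\<lambda>x. lincomb a h x * lincomb c h x)" for h h'
  proof (rule energy_bound[OF _ _ _ V])
    show "(lincomb a h has_real_derivative lincomb a h' x) (at x)" for x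
      unfolding lincomb_def[abs_def] using h by (intro DERIV_sum DERIV_cmult) (simp add: solves_def)
    show "acd s t (lincomb a h') (\<lambda>x. V x * lincomb a h x - lincomb c h x)" for s t
    proof -
      have "acd s t (\<lambda>x. \<Sum>k\<in>S. a k * h' k x) (\<lambda>x. \<Sum>k\<in>S. a k * ((V x - (\<mu> k)\<^sup>2) * h k x))"
        using h by (intro acd_sum acd_cmult) (simp add: solves_def)
      then show ?thesis
        by (rule acd_cong)
          (simp_all add: lincomb_def c_def sum_distrib_left sum_subtractf[symmetric] algebra_simps)
    qed
    show "continuous_on UNIV (lincomb c h)"
      unfolding lincomb_def[abs_def] using h by (intro continuous_intros solves_continuous(1))
    show "integrable lebesgue (\<lambda>x. (lincomb a h x)\<^sup>2)" "integrable lebesgue (\<lambda>x. (lincomb c h x)\<^sup>2)"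
      using i by (simp_all add: power2_eq_square)
  qed
  have "(\<Sum>k\<in>S. c k * a k * b k) = (\<Sum>k\<in>S. (a k * \<mu> k)\<^sup>2 * b k)"
    by (intro sum.cong refl) (simp add: c_def power2_eq_square)
  then show ?thesis
    using E[OF f(1) lincomb_integrable(1)] E[OF g(1) lincomb_integrable(2)] lincomb_inner[of c a] by simp
qed

end

section \<open>Coordinates in the spectral subspace\<close>

lemma sum_fun_apply: "(\<Sum>k\<in>S. F k) x = (\<Sum>k\<in>S. F k x)" for F :: "'a \<Rightarrow> real \<Rightarrow> complex"
  by (induction S rule: infinite_finite_induct) auto

lemma spectral_subspace_representation:
  fixes V :: "real \<Rightarrow> real"
  assumes H: "is_schroedinger_operator V H" and basis: "sqrt_eigenbasis H \<phi> \<mu>" and u: "u \<in> spectral_subspace \<phi> \<mu> l"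
    and V: "V \<in> borel_measurable lebesgue" "\<And>R. \<exists>M. \<forall>x\<in>{-R..R}. \<bar>V x\<bar> \<le> M" "\<And>x. 0 \<le> V x"
  obtains S b f f' g g' where "spectral_family V S \<mu> b l f f' g g'"
    "AE x in lebesgue. u x = Complex (\<Sum>k\<in>S. f k x) (\<Sum>k\<in>S. g k x)"
proof -
  have L2: "\<phi> k \<in> L2" and on: "L2_inner (\<phi> j) (\<phi> k) = (if j = k then 1 else 0)" 
    and eig: "(\<phi> k, \<lambda>x. of_real ((\<mu> k)\<^sup>2) * \<phi> k x) \<in> H" for j k
    using basis by (auto simp: sqrt_eigenbasis_def orthonormal_basis_def)
  have inc: "incseq \<mu>" and \<mu>0: "0 < \<mu> 0" and lim: "filterlim \<mu> at_top sequentially"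
    using basis by (auto simp: sqrt_eigenbasis_def)
  have \<mu>pos: "0 < \<mu> k" for k using incseqD[OF inc, of 0 k] \<mu>0 by simp
  define S where "S = {k. \<mu> k \<le> l}"
  have fin: "finite S"
  proof -
    obtain N where "\<And>n. N \<le> n \<Longrightarrow> l + 1 \<le> \<mu> n"
      using lim unfolding filterlim_at_top eventually_sequentially by blast
    then have "S \<subseteq> {..<N}" unfolding S_def by (force simp: not_less[symmetric])
    then show ?thesis by (rule finite_subset) simp
  qed
  \<comment> \<open>The span is over a set of functions. Injectivity, from orthonormality, turns the
    sum over functions into one over indices.\<close>
  have inj: "inj_on \<phi> S"
  proof (rule inj_onI)
    fix j k assume "\<phi> j = \<phi> k"
    then have "L2_inner (\<phi> j) (\<phi> k) = L2_inner (\<phi> k) (\<phi> k)" by simp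
    then show "j = k" using on[of j k] on[of k k] by (simp split: if_splits)
  qed
  obtain v where v: "v \<in> cfun.span (\<phi> ` S)" "AE x in lebesgue. u x = v x"
  proof -
    have "{\<phi> k |k. \<mu> k \<le> l} = \<phi> ` S" by (auto simp: S_def)
    then show ?thesis using u that by (auto simp: spectral_subspace_def)
  qed
  obtain r where r: "v = (\<Sum>w\<in>\<phi> ` S. (\<lambda>x. r w * w x))"
    using v(1) cfun.span_finite[of "\<phi> ` S"] fin by auto
  define c where "c = (\<lambda>k. r (\<phi> k))"
  have vx: "v x = (\<Sum>k\<in>S. c k * \<phi> k x)" for x
    unfolding r sum_fun_apply c_def using inj by (simp add: sum.reindex)
  have "\<exists>p p' q q'. solves V ((\<mu> k)\<^sup>2) p p' \<and> solves V ((\<mu> k)\<^sup>2) q q' \<and> (AE x in lebesgue. \<phi> k x = Complex (p x) (q x))" for k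
    by (rule eigenfunction_regular[OF H L2 eig V(1,2)])
  then obtain p p' q q' where pq: "\<And>k. solves V ((\<mu> k)\<^sup>2) (p k) (p' k)" "\<And>k. solves V ((\<mu> k)\<^sup>2) (q k) (q' k)"
    "\<And>k. AE x in lebesgue. \<phi> k x = Complex (p k x) (q k x)"
    by metis
  define f where "f = (\<lambda>k x. Re (c k) * p k x + (- Im (c k)) * q k x)"
  define f' where "f' = (\<lambda>k x. Re (c k) * p' k x + (- Im (c k)) * q' k x)"
  define g where "g = (\<lambda>k x. Im (c k) * p k x + Re (c k) * q k x)"
  define g' where "g' = (\<lambda>k x. Im (c k) * p' k x + Re (c k) * q' k x)"
  have sf: "solves V ((\<mu> k)\<^sup>2) (f k) (f' k)" and sg: "solves V ((\<mu> k)\<^sup>2) (g k) (g' k)" for k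
    unfolding f_def f'_def g_def g'_def by (intro solves_lincomb pq)+
  have ae: "AE x in lebesgue. c k * \<phi> k x = Complex (f k x) (g k x)" for k
    using pq(3)[of k] by eventually_elim (simp add: f_def g_def complex_eq_iff)
  have fm: "f k \<in> borel_measurable lebesgue" "g k \<in> borel_measurable lebesgue" for k
    using sf sg by (auto intro!: continuous_borel_measurable_lebesgue solves_continuous(1))
  have cL2: "integrable lebesgue (\<lambda>x. (cmod (c k * \<phi> k x))\<^sup>2)" for k
    using L2_D(2)[OF L2] by (simp add: norm_mult power_mult_distrib)
  have f2: "integrable lebesgue (\<lambda>x. (f k x)\<^sup>2)" and g2: "integrable lebesgue (\<lambda>x. (g k x)\<^sup>2)" for k
  proof -
    have "AE x in lebesgue. (f k x)\<^sup>2 \<le> (cmod (c k * \<phi> k x))\<^sup>2 \<and> (g k x)\<^sup>2 \<le> (cmod (c k * \<phi> k x))\<^sup>2"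
      using ae[of k] by eventually_elim (simp add: cmod_power2)
    then show "integrable lebesgue (\<lambda>x. (f k x)\<^sup>2)" "integrable lebesgue (\<lambda>x. (g k x)\<^sup>2)"
      using fm by (auto intro!: Bochner_Integration.integrable_bound[OF cL2[of k]] borel_measurable_power)
  qed
  have orth: "(LINT x|lebesgue. f j x * f k x + g j x * g k x) = (if j = k then (cmod (c k))\<^sup>2 else 0)" for j k
  proof -
    have i: "integrable lebesgue (\<lambda>x. c j * cnj (c k) * (\<phi> j x * cnj (\<phi> k x)))"
      by (intro integrable_mult_right L2_mult_integrable L2)
    have "(LINT x|lebesgue. f j x * f k x + g j x * g k x) = (LINT x|lebesgue. Re (c j * cnj (c k) * (\<phi> j x * cnj (\<phi> k x))))"
    proof (rule integral_cong_AE)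
      show "(\<lambda>x. f j x * f k x + g j x * g k x) \<in> borel_measurable lebesgue"
        using fm by (intro borel_measurable_add borel_measurable_times)
      show "(\<lambda>x. Re (c j * cnj (c k) * (\<phi> j x * cnj (\<phi> k x)))) \<in> borel_measurable lebesgue"
        by (rule borel_measurable_integrable[OF integrable_Re[OF i]])
      show "AE x in lebesgue. f j x * f k x + g j x * g k x = Re (c j * cnj (c k) * (\<phi> j x * cnj (\<phi> k x)))"
        using ae[of j] ae[of k]
      proof eventually_elim
        case (elim x)
        have "c j * cnj (c k) * (\<phi> j x * cnj (\<phi> k x)) = (c j * \<phi> j x) * cnj (c k * \<phi> k x)" by simp
        also have "\<dots> = Complex (f j x) (g j x) * cnj (Complex (f k x) (g k x))" by (simp only: elim)
        finally show ?case by simp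
      qed
    qed
    also have "\<dots> = Re (LINT x|lebesgue. c j * cnj (c k) * (\<phi> j x * cnj (\<phi> k x)))" by (rule integral_Re[OF i])
    also have "\<dots> = Re (c j * cnj (c k) * L2_inner (\<phi> j) (\<phi> k))" by (simp add: L2_inner_def)
    also have "\<dots> = (if j = k then (cmod (c k))\<^sup>2 else 0)" by (auto simp: on cmod_power2) (simp add: power2_eq_square)
    finally show ?thesis .
  qed
  have fam: "spectral_family V S \<mu> (\<lambda>k. (cmod (c k))\<^sup>2) l f f' g g'"
    by unfold_locales (use fin \<mu>pos V sf sg f2 g2 orth in \<open>auto simp: S_def\<close>)
  have "AE x in lebesgue. \<forall>k\<in>S. c k * \<phi> k x = Complex (f k x) (g k x)"
    using ae fin by (intro AE_finite_allI) auto
  with v(2) have "AE x in lebesgue. u x = Complex (\<Sum>k\<in>S. f k x) (\<Sum>k\<in>S. g k x)"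
  proof eventually_elim
    case (elim x)
    have "(\<Sum>k\<in>S. c k * \<phi> k x) = (\<Sum>k\<in>S. Complex (f k x) (g k x))" using elim(2) by (intro sum.cong) auto
    then show ?case using elim(1) vx by (simp add: complex_eq_iff)
  qed
  with fam show ?thesis by (rule that)
qed

text \<open>The substitution scales space and time by the same length, here called \<open>l\<close>,
  so frequencies become l times \<open>\<mu> k\<close> and the potential l^2 V. The last two
  functions of t and x use sinh because they are primitives in t vanishing at 0; in the second of
  them the length from the x-derivative cancels the one from integrating in t.\<close>

lemma ghost_extension_lincomb:
  fixes V :: "real \<Rightarrow> real" and S :: "nat set" and \<mu> :: "nat \<Rightarrow> real" and p p' :: "nat \<Rightarrow> real \<Rightarrow> real"
  assumes l: "0 < l" and \<mu>: "\<And>k. k \<in> S \<Longrightarrow> 0 < \<mu> k"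
    and p: "\<And>k. k \<in> S \<Longrightarrow> solves V ((\<mu> k)\<^sup>2) (p k) (p' k)"
    and V: "\<And>x. x \<in> {-9..9} \<Longrightarrow> 0 \<le> l\<^sup>2 * V (c + l * x) \<and> l\<^sup>2 * V (c + l * x) \<le> B"
  shows "ghost_extension
    (\<lambda>t x. \<Sum>k\<in>S. cosh (l * \<mu> k * t) * p k (c + l * x))
    (\<lambda>t x. \<Sum>k\<in>S. cosh (l * \<mu> k * t) * (l * p' k (c + l * x)))
    (\<lambda>t x. \<Sum>k\<in>S. l * \<mu> k * sinh (l * \<mu> k * t) * p k (c + l * x))
    (\<lambda>t x. \<Sum>k\<in>S. l * \<mu> k * sinh (l * \<mu> k * t) * (l * p' k (c + l * x)))
    (\<lambda>t x. \<Sum>k\<in>S. sinh (l * \<mu> k * t) / (l * \<mu> k) * p k (c + l * x))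
    (\<lambda>t x. \<Sum>k\<in>S. sinh (l * \<mu> k * t) / \<mu> k * p' k (c + l * x))
    (\<lambda>x. l\<^sup>2 * V (c + l * x)) B"
proof -
  have pc: "continuous_on X (\<lambda>z. p k (c + l * snd z))" "continuous_on X (\<lambda>z. p' k (c + l * snd z))" if "k \<in> S" for X k
    by (rule continuous_on_compose2[OF solves_continuous(1)[OF p[OF that], of UNIV]];
        auto intro!: continuous_intros)
      (rule continuous_on_compose2[OF solves_continuous(2)[OF p[OF that], of UNIV]];
        auto intro!: continuous_intros)
  have pd: "((\<lambda>x. p k (c + l * x)) has_real_derivative l * p' k (c + l * x)) (at x within X)" if "k \<in> S" for k x X
  proof -
    have d: "((\<lambda>x. c + l * x) has_real_derivative l) (at x within X)" by (auto intro!: derivative_eq_intros)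
    have "(p k has_real_derivative p' k (c + l * x)) (at (c + l * x))" using p[OF that] by (simp add: solves_def)
    from DERIV_chain2[OF this d] show ?thesis by (simp add: mult.commute)
  qed
  have dc: "((\<lambda>t. cosh (r * t)) has_real_derivative r * sinh (r * t)) (at t within X)"
    and ds: "((\<lambda>t. sinh (r * t)) has_real_derivative r * cosh (r * t)) (at t within X)" for r t X
    by (auto intro!: derivative_eq_intros)
  have l0: "l \<noteq> 0" and \<mu>0: "\<And>k. k \<in> S \<Longrightarrow> \<mu> k \<noteq> 0" using l \<mu> by force+
  show ?thesis
  proof unfold_locales
    show "((\<lambda>t. \<Sum>k\<in>S. cosh (l * \<mu> k * t) * p k (c + l * x)) has_real_derivative
        (\<Sum>k\<in>S. l * \<mu> k * sinh (l * \<mu> k * t) * p k (c + l * x))) (at t within {0..9})" for t x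
      by (intro DERIV_sum DERIV_cmult_right dc)
    show "((\<lambda>t. \<Sum>k\<in>S. cosh (l * \<mu> k * t) * (l * p' k (c + l * x))) has_real_derivative
        (\<Sum>k\<in>S. l * \<mu> k * sinh (l * \<mu> k * t) * (l * p' k (c + l * x)))) (at t within {0..9})" for t x
      by (intro DERIV_sum DERIV_cmult_right dc)
    show "((\<lambda>t. \<Sum>k\<in>S. sinh (l * \<mu> k * t) / (l * \<mu> k) * p k (c + l * x)) has_real_derivative
        (\<Sum>k\<in>S. cosh (l * \<mu> k * t) * p k (c + l * x))) (at t within {0..9})" for t x
    proof (intro DERIV_sum DERIV_cmult_right)
      fix k assume "k \<in> S"
      then show "((\<lambda>t. sinh (l * \<mu> k * t) / (l * \<mu> k)) has_real_derivative cosh (l * \<mu> k * t)) (at t within {0..9})"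
        using DERIV_cdivide[OF ds[of "l * \<mu> k" t "{0..9}"], of "l * \<mu> k"] l \<mu> by fastforce
    qed
    show "((\<lambda>t. \<Sum>k\<in>S. sinh (l * \<mu> k * t) / \<mu> k * p' k (c + l * x)) has_real_derivative
        (\<Sum>k\<in>S. cosh (l * \<mu> k * t) * (l * p' k (c + l * x)))) (at t within {0..9})" for t x
    proof (intro DERIV_sum)
      fix k assume "k \<in> S"
      then have "\<mu> k \<noteq> 0" using \<mu> by fastforce
      then show "((\<lambda>t. sinh (l * \<mu> k * t) / \<mu> k * p' k (c + l * x)) has_real_derivative
          cosh (l * \<mu> k * t) * (l * p' k (c + l * x))) (at t within {0..9})"
        using DERIV_cmult_right[OF DERIV_cdivide[OF ds[of "l * \<mu> k" t "{0..9}"], of "\<mu> k"], of "p' k (c + l * x)"]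
        by (simp add: mult_ac)
    qed
    show "((\<lambda>x. \<Sum>k\<in>S. cosh (l * \<mu> k * t) * p k (c + l * x)) has_real_derivative
        (\<Sum>k\<in>S. cosh (l * \<mu> k * t) * (l * p' k (c + l * x)))) (at x within {-9..9})" for t x
      by (intro DERIV_sum DERIV_cmult pd)
    show "((\<lambda>x. \<Sum>k\<in>S. l * \<mu> k * sinh (l * \<mu> k * t) * p k (c + l * x)) has_real_derivative
        (\<Sum>k\<in>S. l * \<mu> k * sinh (l * \<mu> k * t) * (l * p' k (c + l * x)))) (at x within {-9..9})" for t x
      by (intro DERIV_sum DERIV_cmult pd)
    show "acd (-9) 9 (\<lambda>x. \<Sum>k\<in>S. sinh (l * \<mu> k * t) / \<mu> k * p' k (c + l * x))
        (\<lambda>x. l\<^sup>2 * V (c + l * x) * (\<Sum>k\<in>S. sinh (l * \<mu> k * t) / (l * \<mu> k) * p k (c + l * x))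
          - (\<Sum>k\<in>S. l * \<mu> k * sinh (l * \<mu> k * t) * p k (c + l * x)))" for t
    proof -
      have "acd (-9) 9 (\<lambda>x. \<Sum>k\<in>S. sinh (l * \<mu> k * t) / \<mu> k * p' k (c + l * x))
        (\<lambda>x. \<Sum>k\<in>S. sinh (l * \<mu> k * t) / \<mu> k * (l * ((V (c + l * x) - (\<mu> k)\<^sup>2) * p k (c + l * x))))"
        by (intro acd_sum acd_cmult acd_affine l) (use p in \<open>simp add: solves_def\<close>)
      moreover have "(\<Sum>k\<in>S. sinh (l * \<mu> k * t) / \<mu> k * (l * ((V (c + l * x) - (\<mu> k)\<^sup>2) * p k (c + l * x))))
        = l\<^sup>2 * V (c + l * x) * (\<Sum>k\<in>S. sinh (l * \<mu> k * t) / (l * \<mu> k) * p k (c + l * x))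
          - (\<Sum>k\<in>S. l * \<mu> k * sinh (l * \<mu> k * t) * p k (c + l * x))" for x
        unfolding sum_distrib_left sum_subtractf[symmetric]
      proof (intro sum.cong refl)
        fix k assume "k \<in> S"
        then have "\<mu> k \<noteq> 0" using \<mu> by fastforce
        then show "sinh (l * \<mu> k * t) / \<mu> k * (l * ((V (c + l * x) - (\<mu> k)\<^sup>2) * p k (c + l * x)))
          = l\<^sup>2 * V (c + l * x) * (sinh (l * \<mu> k * t) / (l * \<mu> k) * p k (c + l * x)) - l * \<mu> k * sinh (l * \<mu> k * t) * p k (c + l * x)"
          using l by (simp add: field_simps power2_eq_square)
      qed
      ultimately show ?thesis by (simp only:)
    qed
  qed (use V l0 \<mu>0 in \<open>auto intro!: continuous_intros pc\<close>)
qed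

section \<open>Estimates on one interval\<close>

context spectral_family
begin

definition "mass = (\<Sum>k\<in>S. b k)"

lemma mass_nonneg: "0 \<le> mass" unfolding mass_def using b by (rule sum_nonneg)

text \<open>The u-part is bounded by orthogonality, the Z-part by the energy: its coefficients carry
  the inverse of \<open>\<mu> k\<close>, which compensates the \<open>\<mu> k\<close> in the energy.
  As t is at most 9, both squared hyperbolic functions are at most exp(18 L l). The 2 counts the two
  parts, and 1/r comes from the substitution.\<close>

lemma interval_mass_bound:
  assumes lL: "0 < r" "r \<le> L" and t: "t \<in> {0..9}" and l: "0 \<le> l"
  shows "integral {-9..9} (\<lambda>x. (\<Sum>k\<in>S. cosh (r * \<mu> k * t) * f k (c + r * x))\<^sup>2 + (\<Sum>k\<in>S. sinh (r * \<mu> k * t) / \<mu> k * f' k (c + r * x))\<^sup>2)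
      \<le> 2 * exp (18 * L * l) * mass / r" (is ?A)
    and "integral {-9..9} (\<lambda>x. (\<Sum>k\<in>S. cosh (r * \<mu> k * t) * g k (c + r * x))\<^sup>2 + (\<Sum>k\<in>S. sinh (r * \<mu> k * t) / \<mu> k * g' k (c + r * x))\<^sup>2)
      \<le> 2 * exp (18 * L * l) * mass / r" (is ?B)
proof -
  define a where "a = (\<lambda>k. cosh (r * \<mu> k * t))"
  define d where "d = (\<lambda>k. sinh (r * \<mu> k * t) / \<mu> k)"
  have y: "0 \<le> r * \<mu> k * t" "r * \<mu> k * t \<le> 9 * L * l" if "k \<in> S" for k
  proof -
    show "0 \<le> r * \<mu> k * t" using \<mu>[OF that] lL t by simp
    have "r * \<mu> k * t \<le> L * l * 9" using \<mu>[OF that] lL t l by (intro mult_mono) auto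
    then show "r * \<mu> k * t \<le> 9 * L * l" by simp
  qed
  have hyp: "cosh y \<le> exp y" "0 \<le> sinh y" "sinh y \<le> exp y" if "0 \<le> y" for y :: real
  proof -
    have e: "exp (- y) \<le> exp y" using that by simp
    show "cosh y \<le> exp y" using e by (simp add: cosh_field_def)
    show "0 \<le> sinh y" using that by simp
    show "sinh y \<le> exp y" by (simp add: sinh_field_def) (rule order.trans[of _ 0]; simp)
  qed
  have sq: "z\<^sup>2 \<le> exp (18 * L * l)" if "0 \<le> z" "z \<le> exp y" "y \<le> 9 * L * l" for y z :: real
  proof -
    have "z\<^sup>2 \<le> (exp y)\<^sup>2" using that by (intro power_mono)
    also have "\<dots> = exp (2 * y)" by (simp add: exp_double)
    also have "\<dots> \<le> exp (18 * L * l)" using that by simp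
    finally show ?thesis .
  qed
  have am: "(\<Sum>k\<in>S. a k * a k * b k) \<le> exp (18 * L * l) * mass"
    unfolding mass_def sum_distrib_left
  proof (intro sum_mono mult_right_mono b)
    fix k assume k: "k \<in> S"
    show "a k * a k \<le> exp (18 * L * l)"
      using sq[OF cosh_real_nonneg hyp(1)[OF y(1)[OF k]] y(2)[OF k]] by (simp add: a_def power2_eq_square)
  qed
  have dm: "(\<Sum>k\<in>S. (d k * \<mu> k)\<^sup>2 * b k) \<le> exp (18 * L * l) * mass"
    unfolding mass_def sum_distrib_left
  proof (intro sum_mono mult_right_mono b)
    fix k assume k: "k \<in> S"
    have "d k * \<mu> k = sinh (r * \<mu> k * t)" using \<mu>[OF k] by (simp add: d_def)
    then show "(d k * \<mu> k)\<^sup>2 \<le> exp (18 * L * l)"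
      using sq[OF hyp(2,3)[OF y(1)[OF k]] y(2)[OF k]] by simp
  qed
  \<comment> \<open>A symmetric interval containing the given one, because the energy bound is
    available on such intervals.\<close>
  define R where "R = \<bar>c\<bar> + 9 * r"
  have sub: "{c + r * (-9)..c + r * 9} \<subseteq> {-R..R}" by (auto simp: R_def)
  have le_R: "integral {c + r * (-9)..c + r * 9} q \<le> integral {-R..R} q"
    if "continuous_on UNIV q" "\<And>x. 0 \<le> q x" for q :: "real \<Rightarrow> real"
    using that by (intro integral_subset_le sub integrable_continuous_real) (auto intro: continuous_on_subset)
  have int_le: "integral {-R..R} (\<lambda>x. (q x)\<^sup>2) \<le> (LINT x|lebesgue. q x * q x)"
    if "integrable lebesgue (\<lambda>x. q x * q x)" "continuous_on UNIV q" for q :: "real \<Rightarrow> real"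
  proof -
    have "set_integrable lebesgue {-R..R} (\<lambda>x. (q x)\<^sup>2)"
      by (intro absolutely_integrable_continuous_real continuous_intros continuous_on_subset[OF that(2)]) auto
    then have "integral {-R..R} (\<lambda>x. (q x)\<^sup>2) = (LINT x:{-R..R}|lebesgue. (q x)\<^sup>2)"
      by (rule set_lebesgue_integral_eq_integral(2)[symmetric])
    also have "\<dots> \<le> (LINT x|lebesgue. q x * q x)" unfolding set_lebesgue_integral_def
      using that(1) by (intro integral_mono') (auto simp: indicator_def power2_eq_square)
    finally show ?thesis .
  qed
  have nonneg: "0 \<le> (LINT x|lebesgue. q x * q x)" for q :: "real \<Rightarrow> real" by (intro integral_nonneg_AE) simp
  have i1: "integral {-R..R} (\<lambda>x. (lincomb a f x)\<^sup>2) \<le> exp (18 * L * l) * mass"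
      "integral {-R..R} (\<lambda>x. (lincomb a g x)\<^sup>2) \<le> exp (18 * L * l) * mass"
    using int_le[OF lincomb_integrable(1) lincomb_continuous(1), of a] int_le[OF lincomb_integrable(2) lincomb_continuous(3), of a]
      lincomb_inner[of a a] am nonneg[of "lincomb a f"] nonneg[of "lincomb a g"] by linarith+
  \<comment> \<open>If the integrand were not integrable, the integral would be 0 by convention, so
    the sign is right in either case.\<close>
  have enn: "0 \<le> integral {-R..R} (\<lambda>x. (lincomb d h' x)\<^sup>2 + V x * (lincomb d h x)\<^sup>2)" for h h'
  proof (cases "(\<lambda>x. (lincomb d h' x)\<^sup>2 + V x * (lincomb d h x)\<^sup>2) integrable_on {-R..R}")
    case True
    then show ?thesis using V(3) by (intro integral_nonneg) auto
  qed (simp add: not_integrable_integral)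
  have e_le: "integral {-R..R} (\<lambda>x. (q' x)\<^sup>2) \<le> integral {-R..R} (\<lambda>x. (q' x)\<^sup>2 + V x * (q x)\<^sup>2)"
    if q: "continuous_on UNIV q" "continuous_on UNIV q'" for q q' :: "real \<Rightarrow> real"
  proof (rule integral_le)
    show i: "(\<lambda>x. (q' x)\<^sup>2) integrable_on {-R..R}"
      by (intro integrable_continuous_real continuous_intros continuous_on_subset[OF q(2)]) auto
    have "(\<lambda>x. V x * (q x)\<^sup>2) absolutely_integrable_on {-R..R}"
    proof (intro absolutely_integrable_bounded_measurable_product_real absolutely_integrable_continuous_real)
      show "V \<in> borel_measurable (lebesgue_on {-R..R})" using V(1) by (rule measurable_restrict_space1)
      show "bounded (V ` {-R..R})" using V(2)[of R] unfolding bounded_iff by auto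
      show "continuous_on {-R..R} (\<lambda>x. (q x)\<^sup>2)" by (intro continuous_intros continuous_on_subset[OF q(1)]) auto
    qed auto
    then show "(\<lambda>x. (q' x)\<^sup>2 + V x * (q x)\<^sup>2) integrable_on {-R..R}"
      by (intro integrable_add i set_lebesgue_integral_eq_integral(1))
  qed (use V(3) in auto)
  have i2: "integral {-R..R} (\<lambda>x. (lincomb d f' x)\<^sup>2) \<le> exp (18 * L * l) * mass"
      "integral {-R..R} (\<lambda>x. (lincomb d g' x)\<^sup>2) \<le> exp (18 * L * l) * mass"
    using e_le[OF lincomb_continuous(1,2), of d d] e_le[OF lincomb_continuous(3,4), of d d]
      enn[of f' f] enn[of g' g] lincomb_energy[of R d] dm by linarith+
  have scale: "integral {-9..9} (\<lambda>x. (q (c + r * x))\<^sup>2 + (q' (c + r * x))\<^sup>2) \<le> 2 * exp (18 * L * l) * mass / r"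
    if q: "continuous_on UNIV q" "continuous_on UNIV q'"
      and i: "integral {-R..R} (\<lambda>x. (q x)\<^sup>2) \<le> exp (18 * L * l) * mass"
       "integral {-R..R} (\<lambda>x. (q' x)\<^sup>2) \<le> exp (18 * L * l) * mass" for q q' :: "real \<Rightarrow> real"
  proof -
    have cq: "continuous_on X (\<lambda>x. (q x)\<^sup>2)" "continuous_on X (\<lambda>x. (q' x)\<^sup>2)" for X
      by (intro continuous_intros continuous_on_subset[OF q(1)] continuous_on_subset[OF q(2)] subset_UNIV)+
    have "((\<lambda>x. (q x)\<^sup>2 + (q' x)\<^sup>2) has_integral
        (integral {c + r * (-9)..c + r * 9} (\<lambda>x. (q x)\<^sup>2) + integral {c + r * (-9)..c + r * 9} (\<lambda>x. (q' x)\<^sup>2))) {c + r * (-9)..c + r * 9}"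
      by (intro has_integral_add integrable_integral integrable_continuous_real cq)
    from integral_unique[OF has_integral_affine[OF this lL(1)]]
    have "integral {-9..9} (\<lambda>x. (q (c + r * x))\<^sup>2 + (q' (c + r * x))\<^sup>2)
      = (integral {c + r * (-9)..c + r * 9} (\<lambda>x. (q x)\<^sup>2) + integral {c + r * (-9)..c + r * 9} (\<lambda>x. (q' x)\<^sup>2)) / r" .
    also have "\<dots> \<le> (2 * exp (18 * L * l) * mass) / r"
      using le_R[OF cq(1)] le_R[OF cq(2)] i lL by (intro divide_right_mono) auto
    finally show ?thesis .
  qed
  show ?A using scale[OF lincomb_continuous(1,2) i1(1) i2(1)] by (simp add: lincomb_def a_def d_def)
  show ?B using scale[OF lincomb_continuous(3,4) i1(2) i2(2)] by (simp add: lincomb_def a_def d_def)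
qed

definition density :: "real \<Rightarrow> real" where
  "density x = (\<Sum>k\<in>S. f k x)\<^sup>2 + (\<Sum>k\<in>S. g k x)\<^sup>2"

lemma density_continuous: "continuous_on X density"
  unfolding density_def[abs_def] by (intro continuous_intros continuous)

lemma density_nonneg: "0 \<le> density x" by (simp add: density_def)

lemma density_integrable: "integrable lebesgue density" and density_integral: "(LINT x|lebesgue. density x) = mass"
proof -
  have e: "density x = lincomb (\<lambda>_. 1) f x * lincomb (\<lambda>_. 1) f x + lincomb (\<lambda>_. 1) g x * lincomb (\<lambda>_. 1) g x" for x
    by (simp add: density_def lincomb_def power2_eq_square)
  show "integrable lebesgue density"
    using Bochner_Integration.integrable_add[OF lincomb_integrable] by (simp add: e[abs_def])
  show "(LINT x|lebesgue. density x) = mass"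
    unfolding e using lincomb_inner[of "\<lambda>_. 1" "\<lambda>_. 1"]
    by (subst Bochner_Integration.integral_add) (auto intro: lincomb_integrable simp: mass_def)
qed

text \<open>The local estimate is applied to real and imaginary parts separately and added; 1152 is
  288 times 2 for the two parts and 2 from the mass bound. The exponent 2 m + 1 collects N^(2 m)
  from the weight and one N from normalising the charge.\<close>

lemma interval_estimate:
  fixes h :: "real \<Rightarrow> real" and m :: nat
  assumes r: "0 < r" "r \<le> L" and l: "0 \<le> l"
    and B: "\<And>x. x \<in> {c - 9 * r..c + 9 * r} \<Longrightarrow> r\<^sup>2 * V x \<le> B"
    and h: "continuous_on UNIV h" and h1: "\<And>y. 0 \<le> h y \<and> h y \<le> 1"
    and N: "0 < N" "N * r \<le> integral {c - r..c + r} h"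
  shows "integral {c - r..c + r} density
    \<le> 5 ^ m * real m * exp (162 * carleman_const B + 6 * real m) * pi / N ^ (2 * m + 1) * integral {c - r..c + r} (\<lambda>x. h x * density x)
     + 1152 * exp (162 * carleman_const B + 18) * (5/49) ^ m * exp (18 * L * l) * mass"
proof -
  let ?h = "\<lambda>x. h (c + r * x)"
  define Nh where "Nh = integral {-1..1} ?h"
  have scale: "integral {-1..1} (\<lambda>x. q (c + r * x)) = integral {c - r..c + r} q / r" if "continuous_on UNIV q" for q :: "real \<Rightarrow> real"
  proof -
    have "(q has_integral integral {c + r * (-1)..c + r * 1} q) {c + r * (-1)..c + r * 1}"
      using that by (intro integrable_integral integrable_continuous_real) (auto intro: continuous_on_subset)
    from integral_unique[OF has_integral_affine[OF this r(1)]] show ?thesis by simp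
  qed
  have hc: "continuous_on X ?h" for X
    by (rule continuous_on_compose2[OF h]) (auto intro!: continuous_intros)
  have Nh: "N \<le> Nh" using N(2) r(1) unfolding Nh_def scale[OF h] by (simp add: pos_le_divide_eq)
  have Vb: "0 \<le> r\<^sup>2 * V (c + r * x) \<and> r\<^sup>2 * V (c + r * x) \<le> B" if "x \<in> {-9..9}" for x
  proof -
    have "r * x \<le> r * 9" "r * (-9) \<le> r * x" using that r by (intro mult_left_mono; simp)+
    then show ?thesis using B[of "c + r * x"] V(3) by auto
  qed
  define Q where "Q = 2 * exp (18 * L * l) * mass / r"
  define C where "C = (\<lambda>N::real. 5 ^ m * real m * exp (162 * carleman_const B + 6 * real m) * pi / N ^ (2 * m + 1))"
  define C2 where "C2 = 288 * exp (162 * carleman_const B + 18) * (5/49) ^ m"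
  have form: "5 ^ m * (m * (exp (162 * carleman_const B + 6 * m) / Nh ^ (2 * m)) * (pi * Y) / Nh) = C Nh * Y" for Y
    by (simp add: C_def mult_ac)
  interpret F: ghost_extension
    "\<lambda>t x. \<Sum>k\<in>S. cosh (r * \<mu> k * t) * f k (c + r * x)"
    "\<lambda>t x. \<Sum>k\<in>S. cosh (r * \<mu> k * t) * (r * f' k (c + r * x))"
    "\<lambda>t x. \<Sum>k\<in>S. r * \<mu> k * sinh (r * \<mu> k * t) * f k (c + r * x)"
    "\<lambda>t x. \<Sum>k\<in>S. r * \<mu> k * sinh (r * \<mu> k * t) * (r * f' k (c + r * x))"
    "\<lambda>t x. \<Sum>k\<in>S. sinh (r * \<mu> k * t) / (r * \<mu> k) * f k (c + r * x)"
    "\<lambda>t x. \<Sum>k\<in>S. sinh (r * \<mu> k * t) / \<mu> k * f' k (c + r * x)"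
    "\<lambda>x. r\<^sup>2 * V (c + r * x)" B
    by (rule ghost_extension_lincomb[OF r(1) _ f(1) Vb]) (use \<mu> in auto)
  interpret G: ghost_extension
    "\<lambda>t x. \<Sum>k\<in>S. cosh (r * \<mu> k * t) * g k (c + r * x)"
    "\<lambda>t x. \<Sum>k\<in>S. cosh (r * \<mu> k * t) * (r * g' k (c + r * x))"
    "\<lambda>t x. \<Sum>k\<in>S. r * \<mu> k * sinh (r * \<mu> k * t) * g k (c + r * x)"
    "\<lambda>t x. \<Sum>k\<in>S. r * \<mu> k * sinh (r * \<mu> k * t) * (r * g' k (c + r * x))"
    "\<lambda>t x. \<Sum>k\<in>S. sinh (r * \<mu> k * t) / (r * \<mu> k) * g k (c + r * x)"
    "\<lambda>t x. \<Sum>k\<in>S. sinh (r * \<mu> k * t) / \<mu> k * g' k (c + r * x)"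
    "\<lambda>x. r\<^sup>2 * V (c + r * x)" B
    by (rule ghost_extension_lincomb[OF r(1) _ g(1) Vb]) (use \<mu> in auto)
  have Fl: "integral {-1..1} (\<lambda>x. (\<Sum>k\<in>S. f k (c + r * x))\<^sup>2)
      \<le> C Nh * integral {-1..1} (\<lambda>x. ?h x * (\<Sum>k\<in>S. f k (c + r * x))\<^sup>2) + C2 * Q"
    using F.local_estimate[OF hc h1 _ interval_mass_bound(1)[OF r _ l, folded Q_def], of m] Nh N(1)
    unfolding Nh_def[symmetric] form C2_def by simp
  have Gl: "integral {-1..1} (\<lambda>x. (\<Sum>k\<in>S. g k (c + r * x))\<^sup>2)
      \<le> C Nh * integral {-1..1} (\<lambda>x. ?h x * (\<Sum>k\<in>S. g k (c + r * x))\<^sup>2) + C2 * Q"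
    using G.local_estimate[OF hc h1 _ interval_mass_bound(2)[OF r _ l, folded Q_def], of m] Nh N(1)
    unfolding Nh_def[symmetric] form C2_def by simp
  have sc: "continuous_on X (\<lambda>x. (\<Sum>k\<in>S. f k (c + r * x))\<^sup>2)" "continuous_on X (\<lambda>x. (\<Sum>k\<in>S. g k (c + r * x))\<^sup>2)" for X
  proof -
    have fc: "continuous_on X (\<lambda>x. f k (c + r * x))" "continuous_on X (\<lambda>x. g k (c + r * x))" if "k \<in> S" for k
      by (rule continuous_on_compose2[OF continuous(1)[OF that, of UNIV]]; auto intro!: continuous_intros)
        (rule continuous_on_compose2[OF continuous(3)[OF that, of UNIV]]; auto intro!: continuous_intros)
    show "continuous_on X (\<lambda>x. (\<Sum>k\<in>S. f k (c + r * x))\<^sup>2)" "continuous_on X (\<lambda>x. (\<Sum>k\<in>S. g k (c + r * x))\<^sup>2)"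
      by (intro continuous_intros fc; assumption)+
  qed
  have "integral {-1..1} (\<lambda>x. density (c + r * x)) = integral {-1..1} (\<lambda>x. (\<Sum>k\<in>S. f k (c + r * x))\<^sup>2) + integral {-1..1} (\<lambda>x. (\<Sum>k\<in>S. g k (c + r * x))\<^sup>2)"
    unfolding density_def
    by (intro Henstock_Kurzweil_Integration.integral_add integrable_continuous_real sc)
  moreover have "integral {-1..1} (\<lambda>x. ?h x * density (c + r * x))
     = integral {-1..1} (\<lambda>x. ?h x * (\<Sum>k\<in>S. f k (c + r * x))\<^sup>2) + integral {-1..1} (\<lambda>x. ?h x * (\<Sum>k\<in>S. g k (c + r * x))\<^sup>2)"
    unfolding density_def distrib_left
    by (intro Henstock_Kurzweil_Integration.integral_add integrable_continuous_real continuous_intros sc hc)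
  ultimately have "integral {-1..1} (\<lambda>x. density (c + r * x)) \<le> C Nh * integral {-1..1} (\<lambda>x. ?h x * density (c + r * x)) + 2 * C2 * Q"
    using Fl Gl by (simp add: distrib_left)
  also have "integral {-1..1} (\<lambda>x. ?h x * density (c + r * x)) = integral {c - r..c + r} (\<lambda>x. h x * density x) / r"
    using scale[of "\<lambda>x. h x * density x"] h density_continuous by (simp add: continuous_on_mult)
  also have "integral {-1..1} (\<lambda>x. density (c + r * x)) = integral {c - r..c + r} density / r"
    by (rule scale[OF density_continuous])
  finally have "integral {c - r..c + r} density \<le> C Nh * integral {c - r..c + r} (\<lambda>x. h x * density x) + 2 * C2 * (Q * r)"
    using r by (simp add: field_simps)
  also have "Q * r = 2 * exp (18 * L * l) * mass" using r by (simp add: Q_def)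
  also have "C Nh * integral {c - r..c + r} (\<lambda>x. h x * density x) \<le> C N * integral {c - r..c + r} (\<lambda>x. h x * density x)"
  proof (rule mult_right_mono)
    show "C Nh \<le> C N" unfolding C_def using N Nh by (intro divide_left_mono power_mono mult_pos_pos) auto
    show "0 \<le> integral {c - r..c + r} (\<lambda>x. h x * density x)"
      using h1 density_nonneg h density_continuous
      by (intro integral_nonneg integrable_continuous_real continuous_intros) (auto intro: continuous_on_subset)
  qed
  finally show ?thesis unfolding C_def C2_def by (simp add: mult_ac)
qed

end

section \<open>From intervals to the line\<close>

text \<open>By inner regularity a closed part \<open>T\<close> of the set still has measure above
  \<open>N\<close>; the strict inequality gives the room. Truncated distance functions decrease to
  the indicator of \<open>T\<close>, and being 1 on \<open>T\<close> they keep their integral above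
  \<open>N\<close>.\<close>

lemma continuous_approximation_from_below:
  fixes D :: "real \<Rightarrow> real"
  assumes \<Omega>: "\<Omega> \<in> sets lebesgue" and N: "0 < N" "N < measure lebesgue (\<Omega> \<inter> {a..b})"
    and D: "continuous_on UNIV D" "\<And>x. 0 \<le> D x" and C: "0 \<le> C"
    and bound: "\<And>h. continuous_on UNIV h \<Longrightarrow> (\<And>x. 0 \<le> h x \<and> h x \<le> 1) \<Longrightarrow> N \<le> integral {a..b} h \<Longrightarrow>
      X \<le> C * integral {a..b} (\<lambda>x. h x * D x) + Y"
  shows "X \<le> C * (LINT x:\<Omega> \<inter> {a..b}|lebesgue. D x) + Y"
proof -
  define E where "E = \<Omega> \<inter> {a..b}"
  have E: "E \<in> lmeasurable"
    unfolding E_def using \<Omega> by (intro bounded_set_imp_lmeasurable) (auto intro: bounded_subset[of "{a..b}"])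
  obtain T where T: "closed T" "T \<subseteq> E" "E - T \<in> lmeasurable" "emeasure lebesgue (E - T) < ennreal (measure lebesgue E - N)"
    using sets_lebesgue_inner_closed[of E "measure lebesgue E - N"] E N(2) by (auto simp: E_def fmeasurable_def)
  have Tm: "T \<in> lmeasurable"
    using T(1,2) by (intro bounded_set_imp_lmeasurable) (auto simp: E_def intro: bounded_subset[of "{a..b}"] borel_closed)
  have Tab: "T \<subseteq> {a..b}" using T(2) by (auto simp: E_def)
  have "measure lebesgue (E - T) < measure lebesgue E - N"
    using T(3,4) N(2) by (simp add: emeasure_eq_measure2 ennreal_less_iff E_def)
  moreover have "measure lebesgue (E - T) = measure lebesgue E - measure lebesgue T"
    by (rule measurable_measure_Diff[OF E _ T(2)]) (use Tm in auto)
  ultimately have TN: "N < measure lebesgue T" by simp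
  then have Tne: "T \<noteq> {}" using N(1) by auto
  define h where "h = (\<lambda>n x. max 0 (1 - real n * infdist x T))"
  have hc: "continuous_on UNIV (h n)" for n unfolding h_def by (intro continuous_intros continuous_on_infdist)
  have h1: "0 \<le> h n x \<and> h n x \<le> 1" for n x using infdist_nonneg[of x T] by (auto simp: h_def)
  have hT: "h n x = 1" if "x \<in> T" for n x using that by (simp add: h_def infdist_zero)
  have hN: "N \<le> integral {a..b} (h n)" for n
  proof -
    have "measure lebesgue T \<le> integral {a..b} (h n)"
    proof (rule has_integral_le)
      show "(indicat_real T has_integral measure lebesgue T) UNIV" using Tm by (simp add: lmeasurable_iff_has_integral)
      show "((\<lambda>x. if x \<in> {a..b} then h n x else 0) has_integral integral {a..b} (h n)) UNIV"
        unfolding has_integral_restrict_UNIV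
        by (intro integrable_integral integrable_continuous_real continuous_on_subset[OF hc]) auto
      show "indicat_real T x \<le> (if x \<in> {a..b} then h n x else 0)" for x
        using hT[of x n] h1[of n x] Tab by (auto simp: indicator_def)
    qed
    then show ?thesis using TN by simp
  qed
  have Di: "D absolutely_integrable_on {a..b}"
    by (intro absolutely_integrable_continuous_real continuous_on_subset[OF D(1)]) auto
  have lim: "(\<lambda>n. integral {a..b} (\<lambda>x. h n x * D x)) \<longlonglongrightarrow> integral {a..b} (\<lambda>x. if x \<in> T then D x else 0)"
  proof (rule dominated_convergence(2))
    show "(\<lambda>x. h n x * D x) integrable_on {a..b}" for n
      by (intro integrable_continuous_real continuous_intros continuous_on_subset[OF hc] continuous_on_subset[OF D(1)]) auto
    show "D integrable_on {a..b}" by (rule set_lebesgue_integral_eq_integral(1)[OF Di])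
    show "norm (h n x * D x) \<le> D x" for n x using h1[of n x] D(2)[of x] by (simp add: abs_mult mult_left_le_one_le)
    show "(\<lambda>n. h n x * D x) \<longlonglongrightarrow> (if x \<in> T then D x else 0)" for x
    proof (cases "x \<in> T")
      case True
      then show ?thesis using hT by simp
    next
      case False
      then have pos: "0 < infdist x T"
        using in_closed_iff_infdist_zero[OF T(1) Tne, of x] infdist_nonneg[of x T] False by (auto simp: less_le)
      obtain n0 :: nat where n0: "1 / infdist x T \<le> real n0" using real_arch_simple by blast
      have "h n x = 0" if "n0 \<le> n" for n
      proof -
        have "1 \<le> real n0 * infdist x T" using n0 pos by (simp add: pos_divide_le_eq)
        also have "\<dots> \<le> real n * infdist x T" using that pos by (intro mult_right_mono) auto
        finally show ?thesis by (simp add: h_def)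
      qed
      then have "\<forall>\<^sub>F n in sequentially. 0 = h n x * D x"
        by (intro eventually_sequentiallyI[of n0]) simp
      then have "(\<lambda>n. h n x * D x) \<longlonglongrightarrow> 0" by (rule Lim_transform_eventually[OF tendsto_const])
      then show ?thesis using False by simp
    qed
  qed
  have "(\<lambda>n. C * integral {a..b} (\<lambda>x. h n x * D x) + Y) \<longlonglongrightarrow> C * integral {a..b} (\<lambda>x. if x \<in> T then D x else 0) + Y"
    by (intro tendsto_intros lim)
  then have "X \<le> C * integral {a..b} (\<lambda>x. if x \<in> T then D x else 0) + Y"
    by (rule LIMSEQ_le_const) (use bound[OF hc h1 hN] in blast)
  also have "integral {a..b} (\<lambda>x. if x \<in> T then D x else 0) = integral T D"
    using Tab by (simp add: Henstock_Kurzweil_Integration.integral_restrict_Int Int_absorb2)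
  also have "integral T D = (LINT x:T|lebesgue. D x)"
    by (intro set_lebesgue_integral_eq_integral(2)[symmetric] set_integrable_subset[OF Di] Tab) (use Tm in auto)
  also have "C * (LINT x:T|lebesgue. D x) \<le> C * (LINT x:E|lebesgue. D x)"
    unfolding set_lebesgue_integral_def
  proof (intro mult_left_mono C integral_mono')
    show "integrable lebesgue (\<lambda>x. indicat_real E x *\<^sub>R D x)"
      using set_integrable_subset[OF Di, of E] E by (auto simp: set_integrable_def E_def)
    show "indicat_real T x *\<^sub>R D x \<le> indicat_real E x *\<^sub>R D x" for x
      using T(2) D(2)[of x] by (auto simp: indicator_def)
    show "0 \<le> indicat_real E x *\<^sub>R D x" for x using D(2)[of x] by simp
  qed
  finally show ?thesis by (simp add: E_def)
qed

section \<open>Coverings and exhaustion of the line\<close>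

lemma integral_le_cover:
  fixes q :: "real \<Rightarrow> real"
  assumes q: "continuous_on UNIV q" and d: "0 \<le> d"
    and C: "\<And>j. j < n \<Longrightarrow> integral {a + real j * d..a + real (Suc j) * d} q \<le> C"
  shows "integral {a..a + real n * d} q \<le> real n * C"
  using C
proof (induction n)
  case (Suc n)
  have "integral {a..a + real n * d} q + integral {a + real n * d..a + real (Suc n) * d} q = integral {a..a + real (Suc n) * d} q"
    using d q by (intro Henstock_Kurzweil_Integration.integral_combine integrable_continuous_real)
      (auto intro: continuous_on_subset mult_right_mono)
  moreover have "integral {a..a + real n * d} q \<le> real n * C" by (rule Suc.IH) (use Suc.prems in auto)
  moreover have "integral {a + real n * d..a + real (Suc n) * d} q \<le> C" by (rule Suc.prems) simp
  ultimately show ?case by (simp add: algebra_simps)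
qed simp

lemma lebesgue_integral_le_of_intervals:
  fixes q :: "real \<Rightarrow> real"
  assumes q: "integrable lebesgue q" "continuous_on UNIV q"
    and C: "\<And>k. R \<le> k \<Longrightarrow> integral {-k..k} q \<le> C"
  shows "(LINT x|lebesgue. q x) \<le> C"
proof -
  have lim: "(\<lambda>n. LINT x|lebesgue. indicat_real {- real n..real n} x *\<^sub>R q x) \<longlonglongrightarrow> (LINT x|lebesgue. q x)"
  proof (rule integral_dominated_convergence[OF _ _ integrable_norm[OF q(1)]])
    show qm: "q \<in> borel_measurable lebesgue" using q(1) by simp
    show "(\<lambda>x. indicat_real {- real n..real n} x *\<^sub>R q x) \<in> borel_measurable lebesgue" for n
      using qm by (intro borel_measurable_scaleR borel_measurable_indicator) auto
    show "AE x in lebesgue. (\<lambda>n. indicat_real {- real n..real n} x *\<^sub>R q x) \<longlonglongrightarrow> q x"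
    proof (rule AE_I2)
      fix x :: real
      obtain n0 :: nat where n0: "\<bar>x\<bar> \<le> real n0" using real_arch_simple by blast
      have "q x = indicat_real {- real n..real n} x *\<^sub>R q x" if "n0 \<le> n" for n
      proof -
        have "real n0 \<le> real n" using that by simp
        then have "- real n \<le> x \<and> x \<le> real n" using n0 by linarith
        then show ?thesis by simp
      qed
      then have "\<forall>\<^sub>F n in sequentially. q x = indicat_real {- real n..real n} x *\<^sub>R q x"
        by (intro eventually_sequentiallyI[of n0])
      then show "(\<lambda>n. indicat_real {- real n..real n} x *\<^sub>R q x) \<longlonglongrightarrow> q x"
        by (rule Lim_transform_eventually[OF tendsto_const])
    qed
    show "AE x in lebesgue. norm (indicat_real {- real n..real n} x *\<^sub>R q x) \<le> norm (q x)" for n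
      by (auto simp: indicator_def)
  qed
  obtain n0 :: nat where n0: "R \<le> real n0" using real_arch_simple by blast
  show ?thesis
  proof (rule LIMSEQ_le_const2[OF lim], intro exI[of _ n0] allI impI)
    fix n assume "n0 \<le> n"
    then have "R \<le> real n" using n0 by simp
    have "q absolutely_integrable_on {- real n..real n}"
      by (intro absolutely_integrable_continuous_real continuous_on_subset[OF q(2)]) auto
    then have "(LINT x|lebesgue. indicat_real {- real n..real n} x *\<^sub>R q x) = integral {- real n..real n} q"
      using set_lebesgue_integral_eq_integral(2) unfolding set_lebesgue_integral_def by blast
    then show "(LINT x|lebesgue. indicat_real {- real n..real n} x *\<^sub>R q x) \<le> C" using C[OF \<open>R \<le> real n\<close>] by simp
  qed
qed

section \<open>Growth of \<open>jbracket\<close>\<close>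

lemma jbracket_ge_1: "1 \<le> jbracket x" by (simp add: jbracket_def)

lemma jbracket_mono: "\<bar>x\<bar> \<le> \<bar>y\<bar> \<Longrightarrow> jbracket x \<le> jbracket y"
  by (simp add: jbracket_def abs_le_square_iff)

lemma jbracket_le: "0 \<le> x \<Longrightarrow> jbracket x \<le> 1 + x"
  unfolding jbracket_def by (rule real_le_lsqrt) (auto simp: power2_sum)

text \<open>Slow variation: within distance 9 L of \<open>x\<close> the bracket grows at most by the
  factor 1 + 9 L, which makes the rescaled potential bounded uniformly in \<open>x\<close>.\<close>

lemma jbracket_translate: "jbracket y \<le> (1 + \<bar>y - x\<bar>) * jbracket x"
proof -
  let ?d = "\<bar>y - x\<bar>"
  have "\<bar>y\<bar> \<le> \<bar>x\<bar> + ?d" by linarith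
  then have "\<bar>y\<bar>\<^sup>2 \<le> (\<bar>x\<bar> + ?d)\<^sup>2" by (intro power_mono) auto
  then have "1 + \<bar>y\<bar>\<^sup>2 \<le> 1 + \<bar>x\<bar>\<^sup>2 + 2 * \<bar>x\<bar> * ?d + ?d\<^sup>2" by (simp only: power2_sum)
  also have "\<dots> \<le> 1 + \<bar>x\<bar>\<^sup>2 + 2 * jbracket x * ?d + ?d\<^sup>2"
  proof -
    have "\<bar>x\<bar> \<le> jbracket x" unfolding jbracket_def by (rule real_le_rsqrt) simp
    then show ?thesis by (intro add_mono mult_right_mono mult_left_mono order_refl) auto
  qed
  also have "\<dots> = (jbracket x + ?d)\<^sup>2" by (simp add: jbracket_def power2_sum)
  finally have "jbracket y \<le> jbracket x + ?d"
    unfolding jbracket_def[of y] using jbracket_ge_1[of x] by (intro real_le_lsqrt) auto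
  also have "\<dots> \<le> jbracket x + ?d * jbracket x" using jbracket_ge_1[of x] by (simp add: mult_left_le mult_le_cancel_left1)
  finally show ?thesis by (simp add: distrib_right)
qed

section \<open>Summation over the intervals\<close>

context spectral_family
begin

text \<open>Chebyshev: the energy is at most l^2 times the mass, while outside [-R,R] its density is
  at least 4 l^2 times \<open>density\<close>; so at most a quarter of the mass lies
  outside.\<close>

lemma tail_estimate:
  assumes l: "0 < l" and R: "0 \<le> R" "\<And>x. R \<le> \<bar>x\<bar> \<Longrightarrow> 4 * l\<^sup>2 \<le> V x"
  shows "mass \<le> integral {-R..R} density + mass / 4"
  unfolding density_integral[symmetric]
proof (rule lebesgue_integral_le_of_intervals[OF density_integrable density_continuous])
  fix k assume k: "R \<le> k"
  have Ve: "(\<lambda>x. (q' x)\<^sup>2 + V x * (q x)\<^sup>2) integrable_on {-k..k}"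
    if "continuous_on UNIV q" "continuous_on UNIV q'" for q q' :: "real \<Rightarrow> real"
  proof -
    have "(\<lambda>x. V x * (q x)\<^sup>2) absolutely_integrable_on {-k..k}"
    proof (intro absolutely_integrable_bounded_measurable_product_real absolutely_integrable_continuous_real)
      show "V \<in> borel_measurable (lebesgue_on {-k..k})" using V(1) by (rule measurable_restrict_space1)
      show "bounded (V ` {-k..k})" using V(2)[of k] unfolding bounded_iff by auto
      show "continuous_on {-k..k} (\<lambda>x. (q x)\<^sup>2)" by (intro continuous_intros continuous_on_subset[OF that(1)]) auto
    qed auto
    then show ?thesis
      by (intro integrable_add set_lebesgue_integral_eq_integral(1) integrable_continuous_real continuous_intros continuous_on_subset[OF that(2)]) auto
  qed
  let ?a = "\<lambda>_::nat. 1::real"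
  have Rk: "{-R..R} \<inter> {-k..k} = {-R..R}" using k by auto
  have di: "density integrable_on {-r..r}" for r
    by (intro integrable_continuous_real density_continuous)
  have "((\<lambda>x. if x \<in> {-R..R} then density x else 0) has_integral integral {-R..R} density) {-k..k}"
    unfolding has_integral_restrict_Int Rk by (rule integrable_integral[OF di])
  then have "((\<lambda>x. 4 * l\<^sup>2 * (density x - (if x \<in> {-R..R} then density x else 0))) has_integral
      4 * l\<^sup>2 * (integral {-k..k} density - integral {-R..R} density)) {-k..k}"
    by (intro has_integral_mult_right has_integral_diff integrable_integral di)
  moreover have "((\<lambda>x. ((lincomb ?a f' x)\<^sup>2 + V x * (lincomb ?a f x)\<^sup>2) + ((lincomb ?a g' x)\<^sup>2 + V x * (lincomb ?a g x)\<^sup>2)) has_integral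
      (integral {-k..k} (\<lambda>x. (lincomb ?a f' x)\<^sup>2 + V x * (lincomb ?a f x)\<^sup>2) + integral {-k..k} (\<lambda>x. (lincomb ?a g' x)\<^sup>2 + V x * (lincomb ?a g x)\<^sup>2))) {-k..k}"
    by (intro has_integral_add integrable_integral Ve lincomb_continuous)
  moreover have "4 * l\<^sup>2 * (density x - (if x \<in> {-R..R} then density x else 0))
      \<le> ((lincomb ?a f' x)\<^sup>2 + V x * (lincomb ?a f x)\<^sup>2) + ((lincomb ?a g' x)\<^sup>2 + V x * (lincomb ?a g x)\<^sup>2)" for x
  proof -
    have "4 * l\<^sup>2 * (density x - (if x \<in> {-R..R} then density x else 0)) \<le> V x * density x"
    proof (cases "x \<in> {-R..R}")
      case True
      then show ?thesis using V(3) density_nonneg by simp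
    next
      case False
      then have "R \<le> \<bar>x\<bar>" by auto
      then have "4 * l\<^sup>2 * density x \<le> V x * density x" by (intro mult_right_mono R(2) density_nonneg)
      then show ?thesis using False by (simp only: if_False diff_zero)
    qed
    also have "V x * density x = V x * (lincomb ?a f x)\<^sup>2 + V x * (lincomb ?a g x)\<^sup>2"
      by (simp add: density_def lincomb_def distrib_left)
    finally show ?thesis
      using zero_le_power2[of "lincomb ?a f' x"] zero_le_power2[of "lincomb ?a g' x"] by linarith
  qed
  ultimately have "4 * l\<^sup>2 * (integral {-k..k} density - integral {-R..R} density)
      \<le> integral {-k..k} (\<lambda>x. (lincomb ?a f' x)\<^sup>2 + V x * (lincomb ?a f x)\<^sup>2) + integral {-k..k} (\<lambda>x. (lincomb ?a g' x)\<^sup>2 + V x * (lincomb ?a g x)\<^sup>2)"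
    by (rule has_integral_le)
  also have "\<dots> \<le> (\<Sum>k\<in>S. (1 * \<mu> k)\<^sup>2 * b k)" by (rule lincomb_energy)
  also have "\<dots> \<le> l\<^sup>2 * mass"
    unfolding mass_def sum_distrib_left
  proof (intro sum_mono mult_right_mono b)
    fix k assume "k \<in> S"
    then show "(1 * \<mu> k)\<^sup>2 \<le> l\<^sup>2" using \<mu>[of k] by (intro power_mono) auto
  qed
  finally have "l\<^sup>2 * (4 * (integral {-k..k} density - integral {-R..R} density)) \<le> l\<^sup>2 * mass"
    by (simp only: mult.assoc mult.left_commute)
  then have "4 * (integral {-k..k} density - integral {-R..R} density) \<le> mass" using l by simp
  then show "integral {-k..k} density \<le> integral {-R..R} density + (LINT x|lebesgue. density x) / 4"
    by (simp add: density_integral)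
qed

text \<open>[-R,R] is cut into \<open>n\<close> pieces no longer than the smallest interval radius,
  and each is estimated on the interval centred at its left end. The observation is simply counted
  \<open>n\<close> times, without regard to overlap. Cutoff errors and tail each cost a quarter of
  the mass, which leaves one half and explains the factor 2.\<close>

lemma observability:
  fixes m n :: nat and K N :: real
  assumes l: "0 < l" and L: "0 < L" and s: "0 \<le> s" "0 \<le> \<beta>" "\<beta> \<le> 2 * s" and c: "0 \<le> c"
    and Vup: "\<And>x. V x \<le> c * jbracket x powr \<beta>"
    and \<Omega>: "\<Omega> \<in> sets lebesgue" and \<gamma>: "0 < \<gamma>" "\<gamma> < 1" and \<tau>: "0 \<le> \<tau>"
    and thick: "\<And>x. measure lebesgue (\<Omega> \<inter> {x - L * rho s x .. x + L * rho s x})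
            \<ge> \<gamma> powr (jbracket x powr \<tau>) * measure lebesgue {x - L * rho s x .. x + L * rho s x}"
    and R: "0 \<le> R" "\<And>x. R \<le> \<bar>x\<bar> \<Longrightarrow> 4 * l\<^sup>2 \<le> V x"
    and n: "0 < n" "2 * R / n \<le> L * rho s R"
  defines "K \<equiv> carleman_const (L\<^sup>2 * c * (1 + 9 * L) powr \<beta>)"
    and "N \<equiv> \<gamma> powr (jbracket R powr \<tau>)"
  assumes absorb: "real n * (1152 * exp (162 * K + 18) * (5/49) ^ m * exp (18 * L * l)) \<le> 1 / 4"
  shows "mass \<le> 2 * real n * (5 ^ m * real m * exp (162 * K + 6 * real m) * pi / N ^ (2 * m + 1)) * (LINT x:\<Omega>|lebesgue. density x)"
proof -
  define C where "C = 5 ^ m * real m * exp (162 * K + 6 * real m) * pi / N ^ (2 * m + 1)"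
  define C3 where "C3 = 1152 * exp (162 * K + 18) * (5/49) ^ m * exp (18 * L * l)"
  define Y where "Y = (LINT x:\<Omega>|lebesgue. density x)"
  define d where "d = 2 * R / n"
  have d0: "0 \<le> d" using R n by (simp add: d_def)
  have N0: "0 < N" using \<gamma> by (simp add: N_def)
  have C0: "0 \<le> C" using N0 by (simp add: C_def)
  have loc: "integral {x..x + d} density \<le> C * Y + C3 * mass" if x: "x \<in> {-R..R}" for x
  proof -
    define r where "r = L * rho s x"
    have xR: "jbracket x \<le> jbracket R" using x by (intro jbracket_mono) auto
    have J: "0 < jbracket x" "1 \<le> jbracket x" using jbracket_ge_1[of x] by auto
    have r0: "0 < r" using L J by (simp add: r_def rho_def)
    have "rho s x \<le> 1" using J s powr_mono[of "-s" 0 "jbracket x"] by (simp add: rho_def)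
    then have rL: "r \<le> L" using L by (simp add: r_def)
    have "rho s R \<le> rho s x" unfolding rho_def using J xR s by (intro powr_mono2') auto
    then have dr: "d \<le> r" using n(2) mult_left_mono[of "rho s R" "rho s x" L] L unfolding d_def r_def by linarith
    have B: "r\<^sup>2 * V y \<le> L\<^sup>2 * c * (1 + 9 * L) powr \<beta>" if y: "y \<in> {x - 9 * r..x + 9 * r}" for y
    proof -
      have "\<bar>y - x\<bar> \<le> 9 * L" using y rL by (auto simp: abs_le_iff)
      then have "(1 + \<bar>y - x\<bar>) * jbracket x \<le> (1 + 9 * L) * jbracket x" using J by (intro mult_right_mono) auto
      then have "jbracket y \<le> (1 + 9 * L) * jbracket x" using jbracket_translate[of y x] by linarith
      then have "jbracket y powr \<beta> \<le> ((1 + 9 * L) * jbracket x) powr \<beta>"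
        using jbracket_ge_1[of y] s by (intro powr_mono2) auto
      also have "\<dots> = (1 + 9 * L) powr \<beta> * jbracket x powr \<beta>" using L J by (simp add: powr_mult)
      finally have "c * jbracket y powr \<beta> \<le> c * ((1 + 9 * L) powr \<beta> * jbracket x powr \<beta>)"
        using c by (rule mult_left_mono)
      with Vup[of y] have "V y \<le> c * ((1 + 9 * L) powr \<beta> * jbracket x powr \<beta>)" by (rule order.trans)
      then have "r\<^sup>2 * V y \<le> r\<^sup>2 * (c * ((1 + 9 * L) powr \<beta> * jbracket x powr \<beta>))" by (rule mult_left_mono) simp
      also have "\<dots> = L\<^sup>2 * c * (1 + 9 * L) powr \<beta> * ((rho s x)\<^sup>2 * jbracket x powr \<beta>)"
        by (simp add: r_def power_mult_distrib mult_ac)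
      \<comment> \<open>The place where s >= \<beta>/2 enters: the squared radius compensates the
        growth of \<open>V\<close>.\<close>
      also have "(rho s x)\<^sup>2 * jbracket x powr \<beta> = jbracket x powr (\<beta> - 2 * s)"
        using J by (simp add: rho_def power2_eq_square powr_add[symmetric])
      also have "\<dots> \<le> 1" using powr_mono[of "\<beta> - 2 * s" 0 "jbracket x"] J s by simp
      finally show ?thesis using c L by (simp add: mult_left_mono)
    qed
    have "N * (2 * r) \<le> \<gamma> powr (jbracket x powr \<tau>) * (2 * r)"
    proof (intro mult_right_mono)
      have "jbracket x powr \<tau> \<le> jbracket R powr \<tau>" using xR J \<tau> by (intro powr_mono2) auto
      then show "N \<le> \<gamma> powr (jbracket x powr \<tau>)" unfolding N_def using \<gamma> by (intro powr_mono') auto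
    qed (use r0 in auto)
    also have "\<dots> \<le> measure lebesgue (\<Omega> \<inter> {x - r..x + r})"
      using thick[of x] r0 by (simp add: r_def[symmetric])
    \<comment> \<open>Half of the guaranteed measure 2 N r is given away to obtain a strict
      inequality.\<close>
    finally have Nr: "N * r < measure lebesgue (\<Omega> \<inter> {x - r..x + r})" using mult_pos_pos[OF N0 r0] by simp
    have "integral {x - r..x + r} density \<le> C * (LINT y:\<Omega> \<inter> {x - r..x + r}|lebesgue. density y) + C3 * mass"
    proof (rule continuous_approximation_from_below[OF \<Omega> _ Nr density_continuous density_nonneg C0])
      show "0 < N * r" using N0 r0 by simp
      fix h :: "real \<Rightarrow> real"
      assume h: "continuous_on UNIV h" "\<And>x. 0 \<le> h x \<and> h x \<le> 1" "N * r \<le> integral {x - r..x + r} h"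
      show "integral {x - r..x + r} density \<le> C * integral {x - r..x + r} (\<lambda>x. h x * density x) + C3 * mass"
        using interval_estimate[OF r0 rL _ B h(1,2) N0 h(3), of m] l by (simp add: C_def C3_def K_def)
    qed
    moreover have "C * (LINT y:\<Omega> \<inter> {x - r..x + r}|lebesgue. density y) \<le> C * Y"
      unfolding Y_def set_lebesgue_integral_def
    proof (intro mult_left_mono integral_mono' C0)
      show "integrable lebesgue (\<lambda>y. indicat_real \<Omega> y *\<^sub>R density y)"
        using integrable_mult_indicator[OF \<Omega> density_integrable] .
    qed (auto simp: indicator_def density_nonneg)
    moreover have "integral {x..x + d} density \<le> integral {x - r..x + r} density"
      using dr r0 by (intro integral_subset_le integrable_continuous_real density_continuous) (auto simp: density_nonneg)
    ultimately show ?thesis by linarith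
  qed
  have "integral {-R..-R + real n * d} density \<le> real n * (C * Y + C3 * mass)"
  proof (rule integral_le_cover[OF density_continuous d0])
    fix j assume j: "j < n"
    have "real j * d \<le> real n * d" using j d0 by (intro mult_right_mono) auto
    also have "\<dots> = 2 * R" using n by (simp add: d_def)
    finally have "- R + real j * d \<in> {-R..R}" using d0 by auto
    from loc[OF this] show "integral {- R + real j * d..- R + real (Suc j) * d} density \<le> C * Y + C3 * mass"
      by (simp add: algebra_simps)
  qed
  also have "-R + real n * d = R" using n by (simp add: d_def)
  finally have main: "integral {-R..R} density \<le> n * C * Y + (n * C3) * mass" by (simp add: algebra_simps)
  have "(n * C3) * mass \<le> 1 / 4 * mass" using absorb mass_nonneg unfolding C3_def by (intro mult_right_mono)
  then have "mass \<le> 2 * (n * C * Y)" using main tail_estimate[OF l R] by linarith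
  then show ?thesis by (simp add: C_def Y_def mult_ac)
qed

end

section \<open>Choice of the parameters\<close>

text \<open>With \<Lambda> = 1 + l every nonnegative power is at least 1, so small and large
  \<open>l\<close> are treated alike. The radius is of order \<Lambda>^p with p = 2/\<beta>1, the
  number of pieces at most of order \<Lambda>^q, and \<open>m\<close> of order \<Lambda>. The final
  exponent is a multiple of \<Lambda>^(1 + \<sigma>), where \<sigma> = 2 \<tau>/\<beta>1, and is
  estimated by the power \<zeta> = 1 + 2 \<sigma>.\<close>

lemma observability_constant:
  fixes \<beta>1 s \<tau> c1 c3 L \<gamma> K :: real
  assumes \<beta>1: "0 < \<beta>1" and s: "0 \<le> s" and \<tau>: "0 \<le> \<tau>" and c: "0 < c1" "0 < c3" and L: "0 < L"
    and \<gamma>: "0 < \<gamma>" "\<gamma> < 1" and K: "0 \<le> K"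
  shows "\<exists>C>0. \<forall>l>0. \<exists>R n m. 0 \<le> R \<and> (\<forall>x. R \<le> \<bar>x\<bar> \<longrightarrow> 4 * l\<^sup>2 \<le> c1 * (max 0 (\<bar>x\<bar> - c3)) powr \<beta>1) \<and>
    0 < n \<and> 2 * R / real n \<le> L * rho s R \<and>
    real n * (1152 * exp (162 * K + 18) * (5/49) ^ m * exp (18 * L * l)) \<le> 1 / 4 \<and>
    sqrt (2 * real n * (5 ^ m * real m * exp (162 * K + 6 * real m) * pi / (\<gamma> powr (jbracket R powr \<tau>)) ^ (2 * m + 1)))
      \<le> C * exp (C * l powr (4 * \<tau> / \<beta>1 + 1))"
proof -
  define p where "p = 2 / \<beta>1"
  define \<sigma> where "\<sigma> = p * \<tau>"
  define \<zeta> where "\<zeta> = 4 * \<tau> / \<beta>1 + 1"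
  \<comment> \<open>The first two summands make c1 (R - c3)^\<beta>1 at least 4 \<Lambda>^2 for R =
    a \<Lambda>^p.\<close>
  define a where "a = c3 + (4 / c1) powr (1 / \<beta>1) + 1"
  define q where "q = p + p * s"
  \<comment> \<open>The summand 2 pays for rounding up in the choice of \<open>n\<close>.\<close>
  define b where "b = 2 * a / L * (1 + a) powr s + 2"
  \<comment> \<open>4608 = 4 * 1152, moved into the exponent by the crude bound x <= exp x.\<close>
  define k0 where "k0 = 162 * K + 18 + 4608"
  \<comment> \<open>\<open>D1 - 1\<close> collects the exponents that (5/49)^m <= exp(-m) has to
    absorb: number of pieces, constant, growth of cosh. The summand 1 pays for rounding
    \<open>m\<close> up.\<close>
  define D1 where "D1 = b + q + k0 + 18 * L + 1"
  define A where "A = (1 + a) powr \<tau>"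
  define g0 where "g0 = - ln \<gamma>"
  \<comment> \<open>4 = 1 + 3 accounts for the factors 2 and pi, and 11 = 4 + 1 + 6 for 5^m, m and
    exp(6 m); the last term is the price of the density of the thick set.\<close>
  define M where "M = 4 + (b + q) + 11 * D1 + 162 * K + (2 * D1 + 1) * (g0 * A)"
  \<comment> \<open>The power of 2 comes from (1 + l)^\<zeta> <= 2^\<zeta> (1 + l^\<zeta>).\<close>
  define D where "D = M * 2 powr \<zeta>"
  have p0: "0 < p" using \<beta>1 by (simp add: p_def)
  have \<sigma>0: "0 \<le> \<sigma>" using p0 \<tau> by (simp add: \<sigma>_def)
  have \<zeta>: "\<zeta> = 1 + 2 * \<sigma>" by (simp add: \<zeta>_def \<sigma>_def p_def)
  have a1: "1 < a" using c by (simp add: a_def add_pos_nonneg)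
  have q0: "0 \<le> q" using p0 s by (simp add: q_def)
  have b2: "2 \<le> b" using a1 L by (simp add: b_def)
  have k00: "0 \<le> k0" using K by (simp add: k0_def)
  have D10: "1 \<le> D1" using b2 q0 k00 L by (simp add: D1_def)
  have A0: "0 \<le> A" by (simp add: A_def)
  have g00: "0 \<le> g0" using \<gamma> by (simp add: g0_def)
  have M0: "0 \<le> M" using b2 q0 D10 K A0 g00 by (simp add: M_def)
  have "\<exists>R n m. 0 \<le> R \<and> (\<forall>x. R \<le> \<bar>x\<bar> \<longrightarrow> 4 * l\<^sup>2 \<le> c1 * (max 0 (\<bar>x\<bar> - c3)) powr \<beta>1) \<and>
    0 < n \<and> 2 * R / real n \<le> L * rho s R \<and>
    real n * (1152 * exp (162 * K + 18) * (5/49) ^ m * exp (18 * L * l)) \<le> 1 / 4 \<and>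
    sqrt (2 * real n * (5 ^ m * real m * exp (162 * K + 6 * real m) * pi / (\<gamma> powr (jbracket R powr \<tau>)) ^ (2 * m + 1)))
      \<le> exp D * exp (exp D * l powr \<zeta>)" if l: "0 < l" for l
  proof -
    define \<Lambda> where "\<Lambda> = 1 + l"
    have \<Lambda>: "1 \<le> \<Lambda>" "l \<le> \<Lambda>" "0 < \<Lambda>" using l by (auto simp: \<Lambda>_def)
    have P1: "1 \<le> \<Lambda> powr r" if "0 \<le> r" for r using powr_mono[OF that \<Lambda>(1)] \<Lambda> by simp
    define R where "R = a * \<Lambda> powr p"
    have R0: "0 \<le> R" using a1 by (simp add: R_def)
    have far: "4 * l\<^sup>2 \<le> c1 * (max 0 (\<bar>x\<bar> - c3)) powr \<beta>1" if x: "R \<le> \<bar>x\<bar>" for x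
    proof -
      have "c3 * 1 \<le> c3 * \<Lambda> powr p" using c P1[of p] p0 by (intro mult_left_mono) auto
      moreover have "(4 / c1) powr (1 / \<beta>1) * \<Lambda> powr p + c3 * \<Lambda> powr p \<le> R"
        by (simp add: R_def a_def distrib_right)
      ultimately have "(4 / c1) powr (1 / \<beta>1) * \<Lambda> powr p \<le> max 0 (\<bar>x\<bar> - c3)" using x by linarith
      then have "((4 / c1) powr (1 / \<beta>1) * \<Lambda> powr p) powr \<beta>1 \<le> (max 0 (\<bar>x\<bar> - c3)) powr \<beta>1"
        using \<beta>1 by (intro powr_mono2) auto
      moreover have "((4 / c1) powr (1 / \<beta>1) * \<Lambda> powr p) powr \<beta>1 = 4 / c1 * \<Lambda>\<^sup>2"
        using \<beta>1 c \<Lambda> by (simp add: powr_mult powr_powr p_def)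
      ultimately have "c1 * (4 / c1 * \<Lambda>\<^sup>2) \<le> c1 * (max 0 (\<bar>x\<bar> - c3)) powr \<beta>1" using c by (intro mult_left_mono) auto
      moreover have "l\<^sup>2 \<le> \<Lambda>\<^sup>2" using \<Lambda> l by (intro power_mono) auto
      ultimately show ?thesis using c by simp
    qed
    have J: "jbracket R \<le> (1 + a) * \<Lambda> powr p"
      using jbracket_le[OF R0] P1[of p] p0 by (simp add: R_def distrib_right)
    have J1: "1 \<le> jbracket R" by (rule jbracket_ge_1)
    have rho: "rho s R = 1 / jbracket R powr s" by (simp add: rho_def powr_minus_divide)
    define y where "y = 2 * R / (L * rho s R)"
    have y0: "0 \<le> y" using R0 L by (simp add: y_def rho_def)
    \<comment> \<open>The summand 1 makes \<open>n\<close> positive whatever \<open>y\<close>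
      is.\<close>
    define n where "n = nat \<lceil>y\<rceil> + 1"
    have n0: "0 < n" by (simp add: n_def)
    have yn: "y \<le> real n" unfolding n_def by linarith
    have ny: "real n \<le> y + 2" unfolding n_def using y0 by linarith
    have step: "2 * R / real n \<le> L * rho s R"
    proof -
      have "0 < L * rho s R" using L J1 by (simp add: rho_def)
      then have "2 * R \<le> real n * (L * rho s R)" using yn by (simp add: y_def pos_divide_le_eq)
      then show ?thesis using n0 by (simp add: divide_le_eq mult.commute)
    qed
    have "y \<le> (b - 2) * \<Lambda> powr q"
    proof -
      have "y = 2 * R / L * jbracket R powr s" using J1 by (simp add: y_def rho)
      also have "\<dots> \<le> 2 * R / L * ((1 + a) * \<Lambda> powr p) powr s"
        using J J1 s R0 L by (intro mult_left_mono powr_mono2) auto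
      also have "\<dots> = (b - 2) * (\<Lambda> powr p * \<Lambda> powr (p * s))"
        using a1 \<Lambda> by (simp add: R_def b_def powr_mult powr_powr)
      also have "\<Lambda> powr p * \<Lambda> powr (p * s) = \<Lambda> powr q" by (simp add: q_def powr_add)
      finally show ?thesis .
    qed
    then have "real n \<le> b * \<Lambda> powr q" using ny P1[OF q0] by (simp add: algebra_simps)
    also have "\<dots> \<le> exp (b * \<Lambda>) * exp (q * \<Lambda>)"
    proof (intro mult_mono)
      have "b \<le> b * \<Lambda>" using b2 \<Lambda> by (simp add: mult_le_cancel_left1)
      also have "\<dots> \<le> exp (b * \<Lambda>)" using exp_ge_add_one_self[of "b * \<Lambda>"] by linarith
      finally show "b \<le> exp (b * \<Lambda>)" .
      have "ln \<Lambda> \<le> \<Lambda>" using ln_le_minus_one[of \<Lambda>] \<Lambda> by linarith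
      then have "q * ln \<Lambda> \<le> q * \<Lambda>" using q0 by (intro mult_left_mono)
      then show "\<Lambda> powr q \<le> exp (q * \<Lambda>)" using \<Lambda> by (simp add: powr_def)
    qed auto
    finally have nb: "real n \<le> exp ((b + q) * \<Lambda>)" by (simp add: exp_add[symmetric] distrib_right)
    define m where "m = nat \<lceil>(D1 - 1) * \<Lambda>\<rceil>"
    have Dm: "0 \<le> (D1 - 1) * \<Lambda>" using D10 \<Lambda> by simp
    have m1: "(D1 - 1) * \<Lambda> \<le> real m" unfolding m_def by linarith
    have m2: "real m \<le> D1 * \<Lambda>"
    proof -
      have "real m \<le> (D1 - 1) * \<Lambda> + 1" unfolding m_def using Dm by linarith
      then show ?thesis using \<Lambda> by (simp add: algebra_simps)
    qed
    have absorb: "real n * (1152 * exp (162 * K + 18) * (5/49) ^ m * exp (18 * L * l)) \<le> 1 / 4"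
    proof -
      have "(5/49) ^ m \<le> (exp (-1::real)) ^ m"
      proof (rule power_mono)
        have "exp 1 \<le> (49/5::real)" using exp_le by linarith
        then show "5/49 \<le> exp (-1::real)" by (simp add: exp_minus field_simps)
      qed simp
      also have "\<dots> = exp (- real m)" by (simp add: exp_of_nat_mult[symmetric])
      finally have e1: "(5/49) ^ m \<le> exp (- real m)" .
      have "(4608::real) \<le> exp 4608" using exp_ge_add_one_self[of "4608::real"] by linarith
      then have "4608 * exp (162 * K + 18) \<le> exp 4608 * exp (162 * K + 18)" by (rule mult_right_mono) simp
      also have "\<dots> = exp k0" unfolding k0_def exp_add[symmetric] by (simp only: add_ac)
      finally have e2: "4608 * exp (162 * K + 18) \<le> exp k0" .
      have "4 * (real n * (1152 * exp (162 * K + 18) * (5/49) ^ m * exp (18 * L * l)))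
         = real n * (4608 * exp (162 * K + 18)) * (5/49) ^ m * exp (18 * L * l)" by simp
      also have "\<dots> \<le> exp ((b + q) * \<Lambda>) * exp k0 * exp (- real m) * exp (18 * L * l)"
        using nb e1 e2 by (intro mult_mono) auto
      also have "\<dots> = exp ((b + q) * \<Lambda> + k0 - real m + 18 * L * l)" by (simp add: exp_add[symmetric])
      also have "\<dots> \<le> exp 0"
      proof -
        have "k0 \<le> k0 * \<Lambda>" using k00 \<Lambda> by (simp add: mult_le_cancel_left1)
        moreover have "18 * L * l \<le> 18 * L * \<Lambda>" using L \<Lambda> by simp
        moreover have "(D1 - 1) * \<Lambda> = (b + q) * \<Lambda> + k0 * \<Lambda> + 18 * L * \<Lambda>" by (simp add: D1_def algebra_simps)
        ultimately show ?thesis using m1 by simp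
      qed
      finally show ?thesis by simp
    qed
    define N where "N = \<gamma> powr (jbracket R powr \<tau>)"
    have Ninv: "1 / N ^ (2 * m + 1) \<le> exp ((2 * m + 1) * (g0 * (A * \<Lambda> powr \<sigma>)))"
    proof -
      have "jbracket R powr \<tau> \<le> ((1 + a) * \<Lambda> powr p) powr \<tau>" using J J1 \<tau> by (intro powr_mono2) auto
      also have "\<dots> = A * \<Lambda> powr \<sigma>" using a1 \<Lambda> by (simp add: A_def \<sigma>_def powr_mult powr_powr)
      finally have jt: "g0 * (jbracket R powr \<tau>) \<le> g0 * (A * \<Lambda> powr \<sigma>)" using g00 by (intro mult_left_mono)
      have "1 / N = exp (g0 * jbracket R powr \<tau>)" using \<gamma> by (simp add: N_def powr_def g0_def exp_minus inverse_eq_divide mult.commute)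
      then have "1 / N ^ (2 * m + 1) = exp (g0 * jbracket R powr \<tau>) ^ (2 * m + 1)" by (metis power_one_over)
      also have "\<dots> = exp (real (2 * m + 1) * (g0 * jbracket R powr \<tau>))" by (rule exp_of_nat_mult[symmetric])
      also have "\<dots> \<le> exp ((2 * m + 1) * (g0 * (A * \<Lambda> powr \<sigma>)))"
        using jt by (simp only: exp_le_cancel_iff) (rule mult_left_mono, simp_all)
      finally show ?thesis .
    qed
    have T1: "(2::real) \<le> exp 1" using exp_ge_add_one_self[of "1::real"] by linarith
    have T2: "(5::real) ^ m \<le> exp (4 * m)"
    proof -
      have "(5::real) \<le> exp 4" using exp_ge_add_one_self[of "4::real"] by linarith
      then have "(5::real) ^ m \<le> exp 4 ^ m" by (rule power_mono) simp
      then show ?thesis by (simp add: exp_of_nat_mult[symmetric] mult.commute)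
    qed
    have T3: "real m \<le> exp m" using exp_ge_add_one_self[of "real m"] by linarith
    have T4: "pi \<le> exp 3" using exp_ge_add_one_self[of "3::real"] pi_less_4 by linarith
    have "2 * real n * (5 ^ m * real m * exp (162 * K + 6 * real m) * pi / N ^ (2 * m + 1))
        = 2 * real n * (5 ^ m) * real m * exp (162 * K + 6 * m) * pi * (1 / N ^ (2 * m + 1))" by simp
    also have "\<dots> \<le> exp 1 * exp ((b + q) * \<Lambda>) * exp (4 * m) * exp m * exp (162 * K + 6 * m) * exp 3
          * exp ((2 * m + 1) * (g0 * (A * \<Lambda> powr \<sigma>)))"
    proof (intro mult_mono T1 T2 T3 T4 nb Ninv order_refl)
      show "0 \<le> 1 / N ^ (2 * m + 1)" by (simp add: N_def)
    qed auto
    also have "\<dots> = exp (1 + (b + q) * \<Lambda> + 4 * m + m + (162 * K + 6 * m) + 3 + (2 * m + 1) * (g0 * (A * \<Lambda> powr \<sigma>)))"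
      by (simp only: exp_add[symmetric])
    also have "\<dots> \<le> exp (M * \<Lambda> powr (1 + \<sigma>))"
    proof -
      define w where "w = \<Lambda> powr (1 + \<sigma>)"
      have w: "w = \<Lambda> * \<Lambda> powr \<sigma>" using \<Lambda> by (simp add: w_def powr_add)
      have w1: "1 \<le> w" using P1[of "1 + \<sigma>"] \<sigma>0 by (simp add: w_def)
      have \<Lambda>w: "\<Lambda> \<le> w" using w P1[OF \<sigma>0] \<Lambda> by (simp add: mult_le_cancel_left1)
      have "(b + q) * \<Lambda> \<le> (b + q) * w" using \<Lambda>w b2 q0 by (intro mult_left_mono) auto
      moreover have "11 * real m \<le> 11 * D1 * w"
      proof -
        have "D1 * \<Lambda> \<le> D1 * w" using \<Lambda>w D10 by (intro mult_left_mono) auto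
        then show ?thesis using m2 by linarith
      qed
      moreover have "162 * K \<le> 162 * K * w" using w1 K by (simp add: mult_le_cancel_left1)
      moreover have "(2 * m + 1) * (g0 * (A * \<Lambda> powr \<sigma>)) \<le> (2 * D1 + 1) * (g0 * A) * w"
      proof -
        have "2 * real m + 1 \<le> (2 * D1 + 1) * \<Lambda>" using m2 \<Lambda> by (simp add: algebra_simps)
        then have "(2 * real m + 1) * (g0 * (A * \<Lambda> powr \<sigma>)) \<le> ((2 * D1 + 1) * \<Lambda>) * (g0 * (A * \<Lambda> powr \<sigma>))"
          using g00 A0 by (intro mult_right_mono) auto
        then show ?thesis by (simp add: w mult_ac add_ac)
      qed
      moreover have "M * w = 4 * w + (b + q) * w + 11 * D1 * w + 162 * K * w + (2 * D1 + 1) * (g0 * A) * w"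
        by (simp add: M_def distrib_right)
      ultimately have "1 + (b + q) * \<Lambda> + 4 * m + m + (162 * K + 6 * m) + 3 + (2 * m + 1) * (g0 * (A * \<Lambda> powr \<sigma>)) \<le> M * w"
        using w1 by linarith
      then show ?thesis by (simp only: exp_le_cancel_iff w_def)
    qed
    also have "\<dots> \<le> exp (D + D * l powr \<zeta>)"
    proof -
      have "\<Lambda> powr (1 + \<sigma>) \<le> \<Lambda> powr \<zeta>" using \<Lambda> \<sigma>0 \<zeta> by (intro powr_mono) auto
      also have "\<dots> \<le> 2 powr \<zeta> * (1 + l powr \<zeta>)"
      proof (cases "l \<le> 1")
        case True
        then have "\<Lambda> powr \<zeta> \<le> 2 powr \<zeta>" using \<Lambda> \<sigma>0 \<zeta> by (intro powr_mono2) (auto simp: \<Lambda>_def)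
        also have "\<dots> \<le> 2 powr \<zeta> * (1 + l powr \<zeta>)" by (simp add: mult_le_cancel_left1)
        finally show ?thesis .
      next
        case False
        then have "\<Lambda> powr \<zeta> \<le> (2 * l) powr \<zeta>" using \<Lambda> \<sigma>0 \<zeta> by (intro powr_mono2) (auto simp: \<Lambda>_def)
        also have "\<dots> = 2 powr \<zeta> * l powr \<zeta>" using l by (simp add: powr_mult)
        also have "\<dots> \<le> 2 powr \<zeta> * (1 + l powr \<zeta>)" by (intro mult_left_mono) auto
        finally show ?thesis .
      qed
      finally have "M * \<Lambda> powr (1 + \<sigma>) \<le> M * (2 powr \<zeta> * (1 + l powr \<zeta>))" using M0 by (rule mult_left_mono)
      then show ?thesis by (simp add: D_def algebra_simps)
    qed
    finally have big: "2 * real n * (5 ^ m * real m * exp (162 * K + 6 * real m) * pi / N ^ (2 * m + 1)) \<le> exp (D + D * l powr \<zeta>)" .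
    have D0: "0 \<le> D" using M0 by (simp add: D_def)
    define E where "E = D + D * l powr \<zeta>"
    have E0: "0 \<le> E" using D0 by (simp add: E_def)
    have "sqrt (2 * real n * (5 ^ m * real m * exp (162 * K + 6 * real m) * pi / N ^ (2 * m + 1))) \<le> sqrt (exp E)"
      using big unfolding E_def[symmetric] by (rule real_sqrt_le_mono)
    also have "\<dots> \<le> exp E"
    proof (rule real_le_lsqrt)
      have "exp E * 1 \<le> exp E * exp E" using E0 by (intro mult_left_mono) auto
      then show "exp E \<le> (exp E)\<^sup>2" by (simp add: power2_eq_square)
    qed (use E0 in auto)
    also have "\<dots> = exp D * exp (D * l powr \<zeta>)" by (simp add: E_def exp_add)
    \<comment> \<open>One constant has to serve both as factor and in the exponent;
      \<open>exp D\<close> dominates \<open>D\<close> and is positive.\<close>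
    also have "\<dots> \<le> exp D * exp (exp D * l powr \<zeta>)"
    proof -
      have "D \<le> exp D" using exp_ge_add_one_self[of D] by linarith
      then have "D * l powr \<zeta> \<le> exp D * l powr \<zeta>" by (rule mult_right_mono) simp
      then show ?thesis by simp
    qed
    finally have "sqrt (2 * real n * (5 ^ m * real m * exp (162 * K + 6 * real m) * pi / N ^ (2 * m + 1))) \<le> exp D * exp (exp D * l powr \<zeta>)" .
    then show ?thesis using R0 far n0 step absorb unfolding N_def by blast
  qed
  then show ?thesis unfolding \<zeta>_def by (intro exI[of _ "exp D"]) simp
qed

theorem theorem1p7:
  fixes \<beta>1 \<beta>2 s \<tau> :: real and V :: "real \<Rightarrow> real" and \<Omega> :: "real set"
  assumes "\<beta>1 > 0" and "\<beta>2 \<ge> \<beta>1"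
    and "V \<in> L_infty_loc"
    and "\<forall>x. V x \<ge> 0"
    and "\<exists>c1 c2 c3. c1 > 0 \<and> c2 > 0 \<and> c3 > 0 \<and>
           (\<forall>x. c1 * (max 0 (\<bar>x\<bar> - c3)) powr \<beta>1 \<le> V x \<and> V x \<le> c2 * jbracket x powr \<beta>2)"
    and "s \<ge> \<beta>2 / 2" and "\<tau> \<ge> 0"
    and "\<Omega> \<in> sets lebesgue"
    and "thick_of_type (rho s) \<tau> \<Omega>"
  shows "\<exists>C>0. \<forall>H \<phi> \<mu>. is_schroedinger_operator V H \<longrightarrow> sqrt_eigenbasis H \<phi> \<mu> \<longrightarrow>
           (\<forall>l>0. \<forall>u \<in> spectral_subspace \<phi> \<mu> l.
              L2_norm u \<le> C * exp (C * l powr (4 * \<tau> / \<beta>1 + 1)) * L2_norm_on \<Omega> u)"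
proof -
  obtain c1 c2 c3 where c: "0 < c1" "0 < c2" "0 < c3"
    and Vlow: "\<And>x. c1 * (max 0 (\<bar>x\<bar> - c3)) powr \<beta>1 \<le> V x" and Vup: "\<And>x. V x \<le> c2 * jbracket x powr \<beta>2"
    using assms(5) by blast
  obtain \<gamma> L where \<gamma>: "0 < \<gamma>" "\<gamma> < 1" and L: "0 < L"
    and thick: "\<And>x. \<gamma> powr (jbracket x powr \<tau>) * measure lebesgue {x - L * rho s x .. x + L * rho s x}
        \<le> measure lebesgue (\<Omega> \<inter> {x - L * rho s x .. x + L * rho s x})"
    using assms(9) unfolding thick_of_type_def by blast
  have s: "0 \<le> s" "0 \<le> \<beta>2" "\<beta>2 \<le> 2 * s" using assms(1,2,6) by auto
  have Vm: "V \<in> borel_measurable lebesgue" using assms(3) by (simp add: L_infty_loc_def)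
  have V0: "0 \<le> V x" for x using assms(4) by simp
  \<comment> \<open>The pointwise growth bound gives boundedness at every point of a compact
    interval, not only almost everywhere.\<close>
  have Vb: "\<exists>M. \<forall>x\<in>{-R..R}. \<bar>V x\<bar> \<le> M" for R
  proof (intro exI ballI)
    fix x assume "x \<in> {-R..R}"
    then have "jbracket x powr \<beta>2 \<le> jbracket R powr \<beta>2"
      using jbracket_ge_1[of x] s by (intro powr_mono2 jbracket_mono) auto
    then have "c2 * jbracket x powr \<beta>2 \<le> c2 * jbracket R powr \<beta>2" using c by (intro mult_left_mono) auto
    then show "\<bar>V x\<bar> \<le> c2 * jbracket R powr \<beta>2" using Vup[of x] V0[of x] by simp
  qed
  define K where "K = carleman_const (L\<^sup>2 * c2 * (1 + 9 * L) powr \<beta>2)"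
  have K: "0 \<le> K" by (simp add: K_def carleman_const_def)
  \<comment> \<open>Fixed before \<open>H\<close>, the eigenbasis and \<open>l\<close>, from data of
    the potential and the thick set only.\<close>
  obtain C where C: "0 < C" and const: "\<And>l. 0 < l \<Longrightarrow> \<exists>R n m. 0 \<le> R \<and> (\<forall>x. R \<le> \<bar>x\<bar> \<longrightarrow> 4 * l\<^sup>2 \<le> c1 * (max 0 (\<bar>x\<bar> - c3)) powr \<beta>1) \<and>
    0 < n \<and> 2 * R / real n \<le> L * rho s R \<and>
    real n * (1152 * exp (162 * K + 18) * (5/49) ^ m * exp (18 * L * l)) \<le> 1 / 4 \<and>
    sqrt (2 * real n * (5 ^ m * real m * exp (162 * K + 6 * real m) * pi / (\<gamma> powr (jbracket R powr \<tau>)) ^ (2 * m + 1)))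
      \<le> C * exp (C * l powr (4 * \<tau> / \<beta>1 + 1))"
    using observability_constant[OF assms(1) s(1) assms(7) c(1,3) L \<gamma> K] by blast
  show ?thesis
  proof (intro exI[of _ C] conjI C allI impI ballI)
    fix H \<phi> \<mu> l u
    assume H: "is_schroedinger_operator V H" "sqrt_eigenbasis H \<phi> \<mu>" and l: "0 < l" and u: "u \<in> spectral_subspace \<phi> \<mu> l"
    obtain S b f f' g g' where fam: "spectral_family V S \<mu> b l f f' g g'"
      and ae: "AE x in lebesgue. u x = Complex (\<Sum>k\<in>S. f k x) (\<Sum>k\<in>S. g k x)"
      by (rule spectral_subspace_representation[OF H u Vm Vb V0])
    interpret spectral_family V S \<mu> b l f f' g g' by (rule fam)
    obtain R n m where R: "0 \<le> R" "\<And>x. R \<le> \<bar>x\<bar> \<Longrightarrow> 4 * l\<^sup>2 \<le> c1 * (max 0 (\<bar>x\<bar> - c3)) powr \<beta>1"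
      and n: "0 < n" "2 * R / real n \<le> L * rho s R"
      and absorb: "real n * (1152 * exp (162 * K + 18) * (5/49) ^ m * exp (18 * L * l)) \<le> 1 / 4"
      and bound: "sqrt (2 * real n * (5 ^ m * real m * exp (162 * K + 6 * real m) * pi / (\<gamma> powr (jbracket R powr \<tau>)) ^ (2 * m + 1)))
        \<le> C * exp (C * l powr (4 * \<tau> / \<beta>1 + 1))"
      using const[OF l] by blast
    have obs: "mass \<le> 2 * real n * (5 ^ m * real m * exp (162 * K + 6 * real m) * pi / (\<gamma> powr (jbracket R powr \<tau>)) ^ (2 * m + 1))
        * (LINT x:\<Omega>|lebesgue. density x)"
      unfolding K_def
      by (rule observability[OF l L s less_imp_le[OF c(2)] Vup assms(8) \<gamma> assms(7) thick R(1) order.trans[OF R(2) Vlow] n absorb[unfolded K_def]])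
    have aed: "AE x in lebesgue. (cmod (u x))\<^sup>2 = density x"
      using ae by eventually_elim (simp add: cmod_power2 density_def)
    have um: "u \<in> borel_measurable lebesgue" using u by (simp add: spectral_subspace_def L2_def)
    \<comment> \<open>\<open>u\<close> agrees with its continuous representative only almost
      everywhere, which suffices to express the norms through \<open>density\<close>.\<close>
    have norm: "L2_norm_on X u = sqrt (LINT x:X|lebesgue. density x)" if X: "X \<in> sets lebesgue" for X
    proof -
      have "(LINT x:X|lebesgue. (cmod (u x))\<^sup>2) = (LINT x:X|lebesgue. density x)"
        unfolding set_lebesgue_integral_def
      proof (rule integral_cong_AE)
        show "AE x in lebesgue. indicat_real X x *\<^sub>R (cmod (u x))\<^sup>2 = indicat_real X x *\<^sub>R density x"
          using aed by eventually_elim simp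
        show "(\<lambda>x. indicat_real X x *\<^sub>R (cmod (u x))\<^sup>2) \<in> borel_measurable lebesgue"
          using X borel_measurable_continuous_on[OF continuous_on_norm[OF continuous_on_id] um]
          by (intro borel_measurable_scaleR borel_measurable_indicator borel_measurable_power)
        show "(\<lambda>x. indicat_real X x *\<^sub>R density x) \<in> borel_measurable lebesgue"
          using X borel_measurable_integrable[OF density_integrable] by (intro borel_measurable_scaleR borel_measurable_indicator)
      qed
      then show ?thesis by (simp add: L2_norm_on_def)
    qed
    have "L2_norm u = sqrt mass" using norm[of UNIV] by (simp add: density_integral set_lebesgue_integral_def)
    also have "\<dots> \<le> sqrt (2 * real n * (5 ^ m * real m * exp (162 * K + 6 * real m) * pi / (\<gamma> powr (jbracket R powr \<tau>)) ^ (2 * m + 1))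
        * (LINT x:\<Omega>|lebesgue. density x))"
      using obs by (rule real_sqrt_le_mono)
    also have "\<dots> = sqrt (2 * real n * (5 ^ m * real m * exp (162 * K + 6 * real m) * pi / (\<gamma> powr (jbracket R powr \<tau>)) ^ (2 * m + 1))) * L2_norm_on \<Omega> u"
      by (simp only: real_sqrt_mult norm[OF assms(8)])
    also have "\<dots> \<le> C * exp (C * l powr (4 * \<tau> / \<beta>1 + 1)) * L2_norm_on \<Omega> u"
    proof (rule mult_right_mono[OF bound])
      have "0 \<le> (LINT x:\<Omega>|lebesgue. density x)"
        unfolding set_lebesgue_integral_def by (intro integral_nonneg_AE AE_I2) (simp add: density_nonneg)
      then show "0 \<le> L2_norm_on \<Omega> u" by (simp add: norm[OF assms(8)])
    qed
    finally show "L2_norm u \<le> C * exp (C * l powr (4 * \<tau> / \<beta>1 + 1)) * L2_norm_on \<Omega> u" .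
  qed
qed

end
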